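(* Let $\mathcal C_G,\mathcal C_H,\mathcal D_G,\mathcal D_H$ be model categories equipped with Quillen adjunctions (left adjoint written first) $$\theta_*\colon\mathcal C_G\rightleftarrows\mathcal C_H:\theta^*,\qquad \theta^\dagger\colon\mathcal C_H\rightleftarrows\mathcal C_G:\theta_{( * )},\qquad \phi_*\colon\mathcal D_G\rightleftarrows\mathcal D_H:\phi^*,\qquad \phi^\dagger\colon\mathcal D_H\rightleftarrows\mathcal D_G:\phi_{( * )},$$ and Quillen equivalences $F_G\colon\mathcal C_G\rightleftarrows\mathcal D_G:U_G$ and $F_H\colon\mathcal C_H\rightleftarrows\mathcal D_H:U_H$. Suppose that there are natural isomorphisms of derived functors $\mathbb L\theta_*\cong\mathbb R\theta_{( * )}$ and $\mathbb L\phi_*\cong\mathbb R\phi_{( * )}$. Consider the statements: (a) There is a natural transformation between $\phi_*F_G$ and $F_H\theta_*$ which restricts to a natural weak equivalence on cofibrant objects. (b) There is a natural transformation between $\theta^*U_H$ and $U_G\phi^*$ which restricts to a natural weak equivalence on fibrant objects. (c) There is a natural transformation between $F_G\theta^\dagger$ and $\phi^\dagger F_H$ which restricts to a natural weak equivalence on cofibrant objects. (d) There is a natural transformation between $\theta_{( * )}U_G$ and $U_H\phi_{( * )}$ which restricts to a natural weak equivalence on fibrant objects. If either (a) or (b) is true and either (c) or (d) is true, then each of the following squares of derived functors commutes, i.e. there are natural isomorphisms: 1. $\mathbb L\phi_*\circ\mathbb LF_G\cong\mathbb LF_H\circ\mathbb L\theta_*$; 2. $\mathbb R\theta^*\circ\mathbb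 RU_H\cong\mathbb RU_G\circ\mathbb R\phi^*$; 3. $\mathbb LF_G\circ\mathbb L\theta^\dagger\cong\mathbb L\phi^\dagger\circ\mathbb LF_H$; 4. $\mathbb R\theta_{( * )}\circ\mathbb RU_G\cong\mathbb RU_H\circ\mathbb R\phi_{( * )}$; 5. $\mathbb L\theta^\dagger\circ\mathbb RU_H\cong\mathbb RU_G\circ\mathbb L\phi^\dagger$; 6. $\mathbb LF_G\circ\mathbb R\theta^*\cong\mathbb R\phi^*\circ\mathbb LF_H$.
   Context: "There is a natural transformation between $F$ and $F'$" means that there is either a natural transformation $F\Rightarrow F'$ or a natural transformation $F'\Rightarrow F$; zig-zags are not permitted. The subscripts $G,H$ are only notation: no group actions are assumed. $\mathbb L$ and $\mathbb R$ denote total left and right derived functors between homotopy categories. *)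

theory Defs
  imports Main
begin

section \<open>Categories, functors, natural transformations\<close>

record ('o, 'm) cat =
  Obj :: "'o set"
  Arr :: "'m set"
  Dom :: "'m \<Rightarrow> 'o"
  Cod :: "'m \<Rightarrow> 'o"
  Id :: "'o \<Rightarrow> 'm"
  Comp :: "'m \<Rightarrow> 'm \<Rightarrow> 'm"  (infixr "\<cdot>\<index>" 70)

text \<open>Composition is written in the usual order: \<open>g \<cdot>\<^bsub>C\<^esub> f\<close> is first \<open>f\<close>, then \<open>g\<close>. It is only meaningful
  on composable arrows of \<open>C\<close>.\<close>

definition hom :: "('o, 'm, 'z) cat_scheme \<Rightarrow> 'o \<Rightarrow> 'o \<Rightarrow> 'm set" where
  "hom C x y = {f \<in> Arr C. Dom C f = x \<and> Cod C f = y}"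

locale category =
  fixes C :: "('o, 'm, 'z) cat_scheme" (structure)
  assumes dom_in: "f \<in> Arr C \<Longrightarrow> Dom C f \<in> Obj C"
    and cod_in: "f \<in> Arr C \<Longrightarrow> Cod C f \<in> Obj C"
    and id_in: "x \<in> Obj C \<Longrightarrow> Id C x \<in> hom C x x"
    and comp_in: "f \<in> hom C x y \<Longrightarrow> g \<in> hom C y z \<Longrightarrow> g \<cdot> f \<in> hom C x z"
    and comp_id_right: "f \<in> hom C x y \<Longrightarrow> f \<cdot> Id C x = f"
    and comp_id_left: "f \<in> hom C x y \<Longrightarrow> Id C y \<cdot> f = f"
    and comp_assoc: "f \<in> hom C w x \<Longrightarrow> g \<in> hom C x y \<Longrightarrow> h \<in> hom C y z \<Longrightarrow>
      (h \<cdot> g) \<cdot> f = h \<cdot> (g \<cdot> f)"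

definition is_iso :: "('o, 'm, 'z) cat_scheme \<Rightarrow> 'm \<Rightarrow> bool" where
  "is_iso C f \<longleftrightarrow> f \<in> Arr C \<and> (\<exists>g \<in> hom C (Cod C f) (Dom C f).
     g \<cdot>\<^bsub>C\<^esub> f = Id C (Dom C f) \<and> f \<cdot>\<^bsub>C\<^esub> g = Id C (Cod C f))"

record ('o, 'm, 'p, 'n) ftor =
  Fobj :: "'o \<Rightarrow> 'p"
  Fmap :: "'m \<Rightarrow> 'n"

definition is_functor ::
  "('o, 'm, 'y) cat_scheme \<Rightarrow> ('p, 'n, 'z) cat_scheme \<Rightarrow> ('o, 'm, 'p, 'n) ftor \<Rightarrow> bool" where
  "is_functor C D F \<longleftrightarrow>
     (\<forall>x \<in> Obj C. Fobj F x \<in> Obj D) \<and>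
     (\<forall>x y. \<forall>f \<in> hom C x y. Fmap F f \<in> hom D (Fobj F x) (Fobj F y)) \<and>
     (\<forall>x \<in> Obj C. Fmap F (Id C x) = Id D (Fobj F x)) \<and>
     (\<forall>x y z. \<forall>f \<in> hom C x y. \<forall>g \<in> hom C y z.
        Fmap F (g \<cdot>\<^bsub>C\<^esub> f) = Fmap F g \<cdot>\<^bsub>D\<^esub> Fmap F f)"

definition fcomp ::
  "('p, 'n, 'q, 'l) ftor \<Rightarrow> ('o, 'm, 'p, 'n) ftor \<Rightarrow> ('o, 'm, 'q, 'l) ftor"  (infixr "\<circ>\<^sub>F" 75) where
  "G \<circ>\<^sub>F F = \<lparr>Fobj = Fobj G \<circ> Fobj F, Fmap = Fmap G \<circ> Fmap F\<rparr>"

definition nat_trans ::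
  "('o, 'm, 'y) cat_scheme \<Rightarrow> ('p, 'n, 'z) cat_scheme \<Rightarrow>
   ('o, 'm, 'p, 'n) ftor \<Rightarrow> ('o, 'm, 'p, 'n) ftor \<Rightarrow> ('o \<Rightarrow> 'n) \<Rightarrow> bool" where
  "nat_trans C D F G \<eta> \<longleftrightarrow>
     is_functor C D F \<and> is_functor C D G \<and>
     (\<forall>x \<in> Obj C. \<eta> x \<in> hom D (Fobj F x) (Fobj G x)) \<and>
     (\<forall>x y. \<forall>f \<in> hom C x y. \<eta> y \<cdot>\<^bsub>D\<^esub> Fmap F f = Fmap G f \<cdot>\<^bsub>D\<^esub> \<eta> x)"

definition nat_isomorphic ::
  "('o, 'm, 'y) cat_scheme \<Rightarrow> ('p, 'n, 'z) cat_scheme \<Rightarrow>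
   ('o, 'm, 'p, 'n) ftor \<Rightarrow> ('o, 'm, 'p, 'n) ftor \<Rightarrow> bool" where
  "nat_isomorphic C D F G \<longleftrightarrow>
     (\<exists>\<eta>. nat_trans C D F G \<eta> \<and> (\<forall>x \<in> Obj C. is_iso D (\<eta> x)))"

text \<open>\<open>F\<close> is left adjoint to \<open>U\<close>, with unit \<open>\<eta>\<close> and counit \<open>\<epsilon>\<close>.\<close>

definition adjunction ::
  "('o, 'm, 'y) cat_scheme \<Rightarrow> ('p, 'n, 'z) cat_scheme \<Rightarrow>
   ('o, 'm, 'p, 'n) ftor \<Rightarrow> ('p, 'n, 'o, 'm) ftor \<Rightarrow> ('o \<Rightarrow> 'm) \<Rightarrow> ('p \<Rightarrow> 'n) \<Rightarrow> bool" where
  "adjunction C D F U \<eta> \<epsilon> \<longleftrightarrow>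
     is_functor C D F \<and> is_functor D C U \<and>
     nat_trans C C \<lparr>Fobj = \<lambda>x. x, Fmap = \<lambda>f. f\<rparr> (U \<circ>\<^sub>F F) \<eta> \<and>
     nat_trans D D (F \<circ>\<^sub>F U) \<lparr>Fobj = \<lambda>y. y, Fmap = \<lambda>g. g\<rparr> \<epsilon> \<and>
     (\<forall>x \<in> Obj C. \<epsilon> (Fobj F x) \<cdot>\<^bsub>D\<^esub> Fmap F (\<eta> x) = Id D (Fobj F x)) \<and>
     (\<forall>y \<in> Obj D. Fmap U (\<epsilon> y) \<cdot>\<^bsub>C\<^esub> \<eta> (Fobj U y) = Id C (Fobj U y))"

section \<open>Finite limits and colimits\<close>

definition is_cone where
  "is_cone J C D x l \<longleftrightarrow> x \<in> Obj C \<and>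
     (\<forall>j \<in> Obj J. l j \<in> hom C x (Fobj D j)) \<and>
     (\<forall>i j. \<forall>u \<in> hom J i j. Fmap D u \<cdot>\<^bsub>C\<^esub> l i = l j)"

definition is_limit ::
  "('j, 'u, 'y) cat_scheme \<Rightarrow> ('o, 'm, 'z) cat_scheme \<Rightarrow> ('j, 'u, 'o, 'm) ftor \<Rightarrow>
   'o \<Rightarrow> ('j \<Rightarrow> 'm) \<Rightarrow> bool" where
  "is_limit J C D x l \<longleftrightarrow> is_cone J C D x l \<and>
     (\<forall>y k. is_cone J C D y k \<longrightarrow> (\<exists>!h. h \<in> hom C y x \<and> (\<forall>j \<in> Obj J. l j \<cdot>\<^bsub>C\<^esub> h = k j)))"

definition is_cocone where
  "is_cocone J C D x l \<longleftrightarrow> x \<in> Obj C \<and>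
     (\<forall>j \<in> Obj J. l j \<in> hom C (Fobj D j) x) \<and>
     (\<forall>i j. \<forall>u \<in> hom J i j. l j \<cdot>\<^bsub>C\<^esub> Fmap D u = l i)"

definition is_colimit ::
  "('j, 'u, 'y) cat_scheme \<Rightarrow> ('o, 'm, 'z) cat_scheme \<Rightarrow> ('j, 'u, 'o, 'm) ftor \<Rightarrow>
   'o \<Rightarrow> ('j \<Rightarrow> 'm) \<Rightarrow> bool" where
  "is_colimit J C D x l \<longleftrightarrow> is_cocone J C D x l \<and>
     (\<forall>y k. is_cocone J C D y k \<longrightarrow> (\<exists>!h. h \<in> hom C x y \<and> (\<forall>j \<in> Obj J. h \<cdot>\<^bsub>C\<^esub> l j = k j)))"

text \<open>Every finite category is isomorphic to one whose objects and arrows are natural numbers, so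
  index categories of that type suffice.\<close>

definition finite_index_cat :: "(nat, nat) cat \<Rightarrow> bool" where
  "finite_index_cat J \<longleftrightarrow> category J \<and> finite (Obj J) \<and> finite (Arr J)"

definition has_finite_limits :: "('o, 'm, 'z) cat_scheme \<Rightarrow> bool" where
  "has_finite_limits C \<longleftrightarrow>
     (\<forall>J D. finite_index_cat J \<and> is_functor J C D \<longrightarrow> (\<exists>x l. is_limit J C D x l))"

definition has_finite_colimits :: "('o, 'm, 'z) cat_scheme \<Rightarrow> bool" where
  "has_finite_colimits C \<longleftrightarrow>
     (\<forall>J D. finite_index_cat J \<and> is_functor J C D \<longrightarrow> (\<exists>x l. is_colimit J C D x l))"

definition is_initial :: "('o, 'm, 'z) cat_scheme \<Rightarrow> 'o \<Rightarrow> bool" where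
  "is_initial C i \<longleftrightarrow> i \<in> Obj C \<and> (\<forall>x \<in> Obj C. \<exists>!f. f \<in> hom C i x)"

definition is_terminal :: "('o, 'm, 'z) cat_scheme \<Rightarrow> 'o \<Rightarrow> bool" where
  "is_terminal C t \<longleftrightarrow> t \<in> Obj C \<and> (\<forall>x \<in> Obj C. \<exists>!f. f \<in> hom C x t)"

section \<open>Model categories\<close>

definition is_retract :: "('o, 'm, 'z) cat_scheme \<Rightarrow> 'm \<Rightarrow> 'm \<Rightarrow> bool" where
  "is_retract C f g \<longleftrightarrow> f \<in> Arr C \<and> g \<in> Arr C \<and>
     (\<exists>a \<in> hom C (Dom C f) (Dom C g). \<exists>b \<in> hom C (Dom C g) (Dom C f).
      \<exists>c \<in> hom C (Cod C f) (Cod C g). \<exists>d \<in> hom C (Cod C g) (Cod C f).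
        b \<cdot>\<^bsub>C\<^esub> a = Id C (Dom C f) \<and> d \<cdot>\<^bsub>C\<^esub> c = Id C (Cod C f) \<and>
        g \<cdot>\<^bsub>C\<^esub> a = c \<cdot>\<^bsub>C\<^esub> f \<and> f \<cdot>\<^bsub>C\<^esub> b = d \<cdot>\<^bsub>C\<^esub> g)"

definition has_lifting :: "('o, 'm, 'z) cat_scheme \<Rightarrow> 'm \<Rightarrow> 'm \<Rightarrow> bool" where
  "has_lifting C i p \<longleftrightarrow>
     (\<forall>f \<in> hom C (Dom C i) (Dom C p). \<forall>g \<in> hom C (Cod C i) (Cod C p).
        p \<cdot>\<^bsub>C\<^esub> f = g \<cdot>\<^bsub>C\<^esub> i \<longrightarrow>
        (\<exists>h \<in> hom C (Cod C i) (Dom C p). h \<cdot>\<^bsub>C\<^esub> i = f \<and> p \<cdot>\<^bsub>C\<^esub> h = g))"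

definition is_subcategory :: "('o, 'm, 'z) cat_scheme \<Rightarrow> 'm set \<Rightarrow> bool" where
  "is_subcategory C S \<longleftrightarrow> S \<subseteq> Arr C \<and> (\<forall>x \<in> Obj C. Id C x \<in> S) \<and>
     (\<forall>f \<in> S. \<forall>g \<in> S. Cod C f = Dom C g \<longrightarrow> g \<cdot>\<^bsub>C\<^esub> f \<in> S)"

record ('o, 'm) model_cat = "('o, 'm) cat" +
  Weq :: "'m set"
  Cof :: "'m set"
  Fib :: "'m set"

text \<open>Model categories in Quillen's sense (closed model categories): finite limits and colimits are
  required, and the factorizations need not be functorial. Model categories satisfying the stronger
  axioms (all small limits and colimits, functorial factorizations) are special cases.\<close>

locale model_category = category M for M :: "('o, 'm, 'z) model_cat_scheme" (structure) +
  assumes finite_limits: "has_finite_limits M"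
    and finite_colimits: "has_finite_colimits M"
    and weq_subcategory: "is_subcategory M (Weq M)"
    and cof_subcategory: "is_subcategory M (Cof M)"
    and fib_subcategory: "is_subcategory M (Fib M)"
    and two_of_three_left: "f \<in> hom M x y \<Longrightarrow> g \<in> hom M y z \<Longrightarrow>
      g \<in> Weq M \<Longrightarrow> g \<cdot> f \<in> Weq M \<Longrightarrow> f \<in> Weq M"
    and two_of_three_right: "f \<in> hom M x y \<Longrightarrow> g \<in> hom M y z \<Longrightarrow>
      f \<in> Weq M \<Longrightarrow> g \<cdot> f \<in> Weq M \<Longrightarrow> g \<in> Weq M"
    and weq_retract: "is_retract M f g \<Longrightarrow> g \<in> Weq M \<Longrightarrow> f \<in> Weq M"
    and cof_retract: "is_retract M f g \<Longrightarrow> g \<in> Cof M \<Longrightarrow> f \<in> Cof M"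
    and fib_retract: "is_retract M f g \<Longrightarrow> g \<in> Fib M \<Longrightarrow> f \<in> Fib M"
    and lift_acyclic_fib: "i \<in> Cof M \<Longrightarrow> p \<in> Fib M \<inter> Weq M \<Longrightarrow> has_lifting M i p"
    and lift_acyclic_cof: "i \<in> Cof M \<inter> Weq M \<Longrightarrow> p \<in> Fib M \<Longrightarrow> has_lifting M i p"
    and factor_acyclic_fib: "f \<in> Arr M \<Longrightarrow>
      \<exists>i \<in> Cof M. \<exists>p \<in> Fib M \<inter> Weq M. Cod M i = Dom M p \<and> f = p \<cdot> i"
    and factor_acyclic_cof: "f \<in> Arr M \<Longrightarrow>
      \<exists>i \<in> Cof M \<inter> Weq M. \<exists>p \<in> Fib M. Cod M i = Dom M p \<and> f = p \<cdot> i"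

definition cofibrant :: "('o, 'm, 'z) model_cat_scheme \<Rightarrow> 'o \<Rightarrow> bool" where
  "cofibrant M x \<longleftrightarrow> x \<in> Obj M \<and> (\<exists>i f. is_initial M i \<and> f \<in> hom M i x \<and> f \<in> Cof M)"

definition fibrant :: "('o, 'm, 'z) model_cat_scheme \<Rightarrow> 'o \<Rightarrow> bool" where
  "fibrant M x \<longleftrightarrow> x \<in> Obj M \<and> (\<exists>t f. is_terminal M t \<and> f \<in> hom M x t \<and> f \<in> Fib M)"

definition preserves_cofibrations ::
  "('o, 'm, 'y) model_cat_scheme \<Rightarrow> ('p, 'n, 'z) model_cat_scheme \<Rightarrow> ('o, 'm, 'p, 'n) ftor \<Rightarrow> bool" where
  "preserves_cofibrations M N F \<longleftrightarrow>
     (\<forall>f \<in> Cof M. Fmap F f \<in> Cof N) \<and>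
     (\<forall>f \<in> Cof M \<inter> Weq M. Fmap F f \<in> Cof N \<inter> Weq N)"

definition quillen_adjunction ::
  "('o, 'm, 'y) model_cat_scheme \<Rightarrow> ('p, 'n, 'z) model_cat_scheme \<Rightarrow>
   ('o, 'm, 'p, 'n) ftor \<Rightarrow> ('p, 'n, 'o, 'm) ftor \<Rightarrow> bool" where
  "quillen_adjunction M N F U \<longleftrightarrow>
     (\<exists>\<eta> \<epsilon>. adjunction M N F U \<eta> \<epsilon>) \<and> preserves_cofibrations M N F"

text \<open>The condition compares \<open>f : F x \<rightarrow> y\<close> with its adjunct \<open>U f \<cdot> \<eta> x : x \<rightarrow> U y\<close>.\<close>

definition quillen_equivalence ::
  "('o, 'm, 'y) model_cat_scheme \<Rightarrow> ('p, 'n, 'z) model_cat_scheme \<Rightarrow>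
   ('o, 'm, 'p, 'n) ftor \<Rightarrow> ('p, 'n, 'o, 'm) ftor \<Rightarrow> bool" where
  "quillen_equivalence M N F U \<longleftrightarrow>
     (\<exists>\<eta> \<epsilon>. adjunction M N F U \<eta> \<epsilon> \<and> preserves_cofibrations M N F \<and>
        (\<forall>x y f. cofibrant M x \<and> fibrant N y \<and> f \<in> hom N (Fobj F x) y \<longrightarrow>
           (f \<in> Weq N \<longleftrightarrow> Fmap U f \<cdot>\<^bsub>M\<^esub> \<eta> x \<in> Weq M)))"

text \<open>There is a natural transformation \<open>F \<Rightarrow> F'\<close> or \<open>F' \<Rightarrow> F\<close>, defined on all of \<open>M\<close>, whose
  components at objects satisfying \<open>P\<close> are weak equivalences.\<close>

definition nat_trans_between_weq_on ::
  "('o \<Rightarrow> bool) \<Rightarrow> ('o, 'm, 'y) cat_scheme \<Rightarrow> ('p, 'n, 'z) model_cat_scheme \<Rightarrow>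
   ('o, 'm, 'p, 'n) ftor \<Rightarrow> ('o, 'm, 'p, 'n) ftor \<Rightarrow> bool" where
  "nat_trans_between_weq_on P M N F F' \<longleftrightarrow>
     (\<exists>\<tau>. (nat_trans M N F F' \<tau> \<or> nat_trans M N F' F \<tau>) \<and>
          (\<forall>x \<in> Obj M. P x \<longrightarrow> \<tau> x \<in> Weq N))"

section \<open>Homotopy categories\<close>

text \<open>The homotopy category is the localization at the weak equivalences: its arrows from \<open>x\<close> to \<open>y\<close>
  are words in the arrows and the formal inverses of weak equivalences leading from \<open>x\<close> to \<open>y\<close>, modulo
  the congruence generated by \<open>zigzag_rel\<close>. Words are read in the order of travel, i.e. opposite to
  the notation for composition.\<close>

datatype 'm letter = Fwd 'm | Bwd 'm

inductive zigzag :: "('o, 'm, 'z) model_cat_scheme \<Rightarrow> 'o \<Rightarrow> 'm letter list \<Rightarrow> 'o \<Rightarrow> bool"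
  for M where
  zigzag_Nil: "x \<in> Obj M \<Longrightarrow> zigzag M x [] x"
| zigzag_Fwd: "f \<in> Arr M \<Longrightarrow> zigzag M (Cod M f) p y \<Longrightarrow> zigzag M (Dom M f) (Fwd f # p) y"
| zigzag_Bwd: "w \<in> Weq M \<Longrightarrow> zigzag M (Dom M w) p y \<Longrightarrow> zigzag M (Cod M w) (Bwd w # p) y"

inductive zigzag_rel :: "('o, 'm, 'z) model_cat_scheme \<Rightarrow> 'm letter list \<Rightarrow> 'm letter list \<Rightarrow> bool"
  for M where
  rel_id: "x \<in> Obj M \<Longrightarrow> zigzag_rel M [Fwd (Id M x)] []"
| rel_comp: "f \<in> hom M x y \<Longrightarrow> g \<in> hom M y z \<Longrightarrow> zigzag_rel M [Fwd f, Fwd g] [Fwd (g \<cdot>\<^bsub>M\<^esub> f)]"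
| rel_inv1: "w \<in> Weq M \<Longrightarrow> zigzag_rel M [Fwd w, Bwd w] []"
| rel_inv2: "w \<in> Weq M \<Longrightarrow> zigzag_rel M [Bwd w, Fwd w] []"

inductive zigzag_eq ::
  "('o, 'm, 'z) model_cat_scheme \<Rightarrow> 'o \<Rightarrow> 'o \<Rightarrow> 'm letter list \<Rightarrow> 'm letter list \<Rightarrow> bool"
  for M x y where
  eq_step: "zigzag M x (u @ p @ v) y \<Longrightarrow> zigzag M x (u @ q @ v) y \<Longrightarrow> zigzag_rel M p q \<Longrightarrow>
     zigzag_eq M x y (u @ p @ v) (u @ q @ v)"
| eq_refl: "zigzag M x p y \<Longrightarrow> zigzag_eq M x y p p"
| eq_sym: "zigzag_eq M x y p q \<Longrightarrow> zigzag_eq M x y q p"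
| eq_trans: "zigzag_eq M x y p q \<Longrightarrow> zigzag_eq M x y q r \<Longrightarrow> zigzag_eq M x y p r"

text \<open>An arrow of the homotopy category is a triple: source, target, equivalence class of words.\<close>

type_synonym ('o, 'm) ho_arr = "'o \<times> 'o \<times> 'm letter list set"

definition zigzag_class ::
  "('o, 'm, 'z) model_cat_scheme \<Rightarrow> 'o \<Rightarrow> 'o \<Rightarrow> 'm letter list \<Rightarrow> ('o, 'm) ho_arr" where
  "zigzag_class M x y p = (x, y, {q. zigzag_eq M x y p q})"

definition Ho :: "('o, 'm, 'z) model_cat_scheme \<Rightarrow> ('o, ('o, 'm) ho_arr) cat" where
  "Ho M = \<lparr>
     Obj = Obj M,
     Arr = {zigzag_class M x y p |x y p. zigzag M x p y},
     Dom = (\<lambda>(x, y, A). x),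
     Cod = (\<lambda>(x, y, A). y),
     Id = (\<lambda>x. zigzag_class M x x []),
     Comp = (\<lambda>(y', z, B) (x, y, A). (x, z, {r. \<exists>p \<in> A. \<exists>q \<in> B. zigzag_eq M x z (p @ q) r}))\<rparr>"

definition ho_proj :: "('o, 'm, 'z) model_cat_scheme \<Rightarrow> ('o, 'm, 'o, ('o, 'm) ho_arr) ftor" where
  "ho_proj M = \<lparr>Fobj = (\<lambda>x. x), Fmap = (\<lambda>f. zigzag_class M (Dom M f) (Cod M f) [Fwd f])\<rparr>"

section \<open>Total derived functors\<close>

type_synonym ('o, 'm, 'p, 'n) ho_ftor = "('o, ('o, 'm) ho_arr, 'p, ('p, 'n) ho_arr) ftor"

text \<open>With \<open>\<gamma>\<close> the projection to the homotopy category, the total left derived functor of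
  \<open>F : M \<rightarrow> N\<close> is the functor \<open>L : Ho M \<rightarrow> Ho N\<close> with a natural transformation
  \<open>t : L \<gamma> \<Rightarrow> \<gamma> F\<close> that is terminal among all such pairs (the right Kan extension of \<open>\<gamma> F\<close>
  along \<open>\<gamma>\<close>). The total right derived functor is the dual notion.\<close>

definition is_left_derived ::
  "('o, 'm, 'y) model_cat_scheme \<Rightarrow> ('p, 'n, 'z) model_cat_scheme \<Rightarrow> ('o, 'm, 'p, 'n) ftor \<Rightarrow>
   ('o, 'm, 'p, 'n) ho_ftor \<Rightarrow> ('o \<Rightarrow> ('p, 'n) ho_arr) \<Rightarrow> bool" where
  "is_left_derived M N F L t \<longleftrightarrow>
     is_functor (Ho M) (Ho N) L \<and>
     nat_trans M (Ho N) (L \<circ>\<^sub>F ho_proj M) (ho_proj N \<circ>\<^sub>F F) t \<and>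
     (\<forall>G s. is_functor (Ho M) (Ho N) G \<and>
        nat_trans M (Ho N) (G \<circ>\<^sub>F ho_proj M) (ho_proj N \<circ>\<^sub>F F) s \<longrightarrow>
        (\<exists>r. nat_trans (Ho M) (Ho N) G L r \<and> (\<forall>x \<in> Obj M. t x \<cdot>\<^bsub>Ho N\<^esub> r x = s x) \<and>
           (\<forall>r'. nat_trans (Ho M) (Ho N) G L r' \<and> (\<forall>x \<in> Obj M. t x \<cdot>\<^bsub>Ho N\<^esub> r' x = s x) \<longrightarrow>
              (\<forall>x \<in> Obj M. r' x = r x))))"

definition is_right_derived ::
  "('o, 'm, 'y) model_cat_scheme \<Rightarrow> ('p, 'n, 'z) model_cat_scheme \<Rightarrow> ('o, 'm, 'p, 'n) ftor \<Rightarrow>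
   ('o, 'm, 'p, 'n) ho_ftor \<Rightarrow> ('o \<Rightarrow> ('p, 'n) ho_arr) \<Rightarrow> bool" where
  "is_right_derived M N F R t \<longleftrightarrow>
     is_functor (Ho M) (Ho N) R \<and>
     nat_trans M (Ho N) (ho_proj N \<circ>\<^sub>F F) (R \<circ>\<^sub>F ho_proj M) t \<and>
     (\<forall>G s. is_functor (Ho M) (Ho N) G \<and>
        nat_trans M (Ho N) (ho_proj N \<circ>\<^sub>F F) (G \<circ>\<^sub>F ho_proj M) s \<longrightarrow>
        (\<exists>r. nat_trans (Ho M) (Ho N) R G r \<and> (\<forall>x \<in> Obj M. r x \<cdot>\<^bsub>Ho N\<^esub> t x = s x) \<and>
           (\<forall>r'. nat_trans (Ho M) (Ho N) R G r' \<and> (\<forall>x \<in> Obj M. r' x \<cdot>\<^bsub>Ho N\<^esub> t x = s x) \<longrightarrow>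
              (\<forall>x \<in> Obj M. r' x = r x))))"

text \<open>A chosen total derived functor; it exists for left, respectively right, Quillen functors, and
  the universal property determines it up to unique natural isomorphism.\<close>

definition Lder ::
  "('o, 'm, 'y) model_cat_scheme \<Rightarrow> ('p, 'n, 'z) model_cat_scheme \<Rightarrow> ('o, 'm, 'p, 'n) ftor \<Rightarrow>
   ('o, 'm, 'p, 'n) ho_ftor" where
  "Lder M N F = (SOME L. \<exists>t. is_left_derived M N F L t)"

definition Rder ::
  "('o, 'm, 'y) model_cat_scheme \<Rightarrow> ('p, 'n, 'z) model_cat_scheme \<Rightarrow> ('o, 'm, 'p, 'n) ftor \<Rightarrow>
   ('o, 'm, 'p, 'n) ho_ftor" where
  "Rder M N F = (SOME R. \<exists>t. is_right_derived M N F R t)"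

end

theory Submission
  imports Defs
begin

text \<open>Fix a left Quillen functor \<open>F\<close>. Composed with the projection to the homotopy category, it inverts weak
  equivalences between cofibrant objects (Ken Brown) and identifies any two lifts of a map to
  cofibrant replacements, so applying \<open>F\<close> to chosen cofibrant replacements is functorial although
  the factorizations are not. The derived functor is therefore characterized as a functor out of the
  homotopy category with a transformation to \<open>F\<close> that is invertible on cofibrant objects. This
  characterization is stable under composition of left Quillen functors, so (a) gives 1 and (c)
  gives 3, and dually (b) gives 2 and (d) gives 4. The derived functors of a Quillen adjunction are
  adjoint: unit and counit come from the universal properties of \<open>RU \<circ> LF\<close> and \<open>LF \<circ> RU\<close>. By uniqueness
  of adjoints, 1 and 2 are equivalent, and so are 3 and 4. Finally 5 and 6 follow from 3 and 2 by
  composing with the derived equivalences.\<close>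

section \<open>Categories, functors and natural transformations\<close>

text \<open>The obstacle is that a universal property of Kan extension type says nothing about a
  composite of two derived functors. Invertibility at cofibrant objects does compose, because left
  Quillen functors preserve cofibrant objects. Each chosen \<open>Lder\<close> is therefore compared
  once with a constructed derived functor in order to acquire this pointwise property. A
  transformation between functors that invert weak equivalences is determined by its components at
  cofibrant objects, and is invertible as soon as those are; the triangle identities and the
  comparison isomorphisms are checked only there, or dually at fibrant objects. Duality is applied
  before localization and with an arbitrary target category \<open>E\<close>:
  \<open>opc (opc E)\<close> is \<open>E\<close> itself, whereas \<open>Ho (opm M)\<close> is
  isomorphic but not equal to the opposite of \<open>Ho M\<close>, since its words are
  reversed.\<close>

context category
begin

lemma arrI: "f \<in> hom C x y \<Longrightarrow> f \<in> Arr C" and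
  domI: "f \<in> hom C x y \<Longrightarrow> Dom C f = x" and
  codI: "f \<in> hom C x y \<Longrightarrow> Cod C f = y"
  by (auto simp: hom_def)

lemma in_homI: "f \<in> Arr C \<Longrightarrow> f \<in> hom C (Dom C f) (Cod C f)"
  by (auto simp: hom_def)

lemma hom_objs: "f \<in> hom C x y \<Longrightarrow> x \<in> Obj C \<and> y \<in> Obj C"
  using dom_in cod_in by (auto simp: hom_def)

lemma comp_simps [simp]:
  assumes "f \<in> Arr C" "g \<in> Arr C" "Cod C f = Dom C g"
  shows "g \<cdot> f \<in> Arr C" "Dom C (g \<cdot> f) = Dom C f" "Cod C (g \<cdot> f) = Cod C g"
  using comp_in[of f "Dom C f" "Dom C g" g "Cod C g"] assms by (auto simp: hom_def)

lemma id_simps [simp]: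
  assumes "x \<in> Obj C"
  shows "Id C x \<in> Arr C" "Dom C (Id C x) = x" "Cod C (Id C x) = x"
  using id_in[OF assms] by (auto simp: hom_def)

lemma obj_simps [simp]: "f \<in> Arr C \<Longrightarrow> Dom C f \<in> Obj C" "f \<in> Arr C \<Longrightarrow> Cod C f \<in> Obj C"
  by (auto intro: dom_in cod_in)

lemma comp_id [simp]:
  "f \<in> Arr C \<Longrightarrow> Dom C f = x \<Longrightarrow> f \<cdot> Id C x = f"
  "f \<in> Arr C \<Longrightarrow> Cod C f = y \<Longrightarrow> Id C y \<cdot> f = f"
  by (auto intro: comp_id_left comp_id_right in_homI)

lemma assoc [simp]:
  "f \<in> Arr C \<Longrightarrow> g \<in> Arr C \<Longrightarrow> h \<in> Arr C \<Longrightarrow> Cod C f = Dom C g \<Longrightarrow> Cod C g = Dom C h \<Longrightarrow>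
    (h \<cdot> g) \<cdot> f = h \<cdot> (g \<cdot> f)"
  using comp_assoc[of f "Dom C f" "Dom C g" g "Dom C h" h "Cod C h"] by (auto simp: hom_def)

text \<open>Composites are normalized by nesting to the right, so an equation for
  \<open>g \<cdot> f\<close> no longer matches inside a longer composite. This is its form for that
  normal form.\<close>

lemma reassoc:
  assumes "g \<cdot> f = k" "f \<in> Arr C" "g \<in> Arr C" "Cod C f = Dom C g" "h \<in> Arr C" "Cod C h = Dom C f"
  shows "g \<cdot> (f \<cdot> h) = k \<cdot> h"
  using assms assoc[of h f g] by auto

lemma is_iso_arr: "is_iso C f \<Longrightarrow> f \<in> Arr C"
  by (simp add: is_iso_def)

lemma is_isoI:
  assumes "f \<in> hom C x y" "g \<in> hom C y x" "g \<cdot> f = Id C x" "f \<cdot> g = Id C y"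
  shows "is_iso C f"
  using assms by (auto simp: is_iso_def hom_def)

lemma is_iso_id: "x \<in> Obj C \<Longrightarrow> is_iso C (Id C x)"
  by (rule is_isoI[of _ x x "Id C x"]) (auto simp: id_in)

end

section \<open>Inverse arrows and cancellation of isomorphisms\<close>

definition inv_arr :: "('o, 'm, 'z) cat_scheme \<Rightarrow> 'm \<Rightarrow> 'm" where
  "inv_arr C f = (SOME g. g \<in> hom C (Cod C f) (Dom C f) \<and>
     g \<cdot>\<^bsub>C\<^esub> f = Id C (Dom C f) \<and> f \<cdot>\<^bsub>C\<^esub> g = Id C (Cod C f))"

context category
begin

lemma inv_arr:
  assumes "is_iso C f"
  shows "inv_arr C f \<in> hom C (Cod C f) (Dom C f)"
    "inv_arr C f \<cdot> f = Id C (Dom C f)" "f \<cdot> inv_arr C f = Id C (Cod C f)"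
proof -
  have "\<exists>g. g \<in> hom C (Cod C f) (Dom C f) \<and> g \<cdot> f = Id C (Dom C f) \<and> f \<cdot> g = Id C (Cod C f)"
    using assms by (auto simp: is_iso_def)
  from someI_ex[OF this, folded inv_arr_def]
  show "inv_arr C f \<in> hom C (Cod C f) (Dom C f)"
    "inv_arr C f \<cdot> f = Id C (Dom C f)" "f \<cdot> inv_arr C f = Id C (Cod C f)" by auto
qed

lemma inv_simps [simp]:
  assumes "is_iso C f"
  shows "inv_arr C f \<in> Arr C" "Dom C (inv_arr C f) = Cod C f" "Cod C (inv_arr C f) = Dom C f"
    "inv_arr C f \<cdot> f = Id C (Dom C f)" "f \<cdot> inv_arr C f = Id C (Cod C f)"
  using inv_arr[OF assms] by (auto simp: hom_def)

lemma inv_assoc [simp]: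
  assumes "is_iso C f" "g \<in> Arr C"
  shows "Cod C g = Dom C f \<Longrightarrow> inv_arr C f \<cdot> (f \<cdot> g) = g"
    "Cod C g = Cod C f \<Longrightarrow> f \<cdot> (inv_arr C f \<cdot> g) = g"
proof -
  note [simp] = assms is_iso_arr[OF assms(1)]
  show "inv_arr C f \<cdot> (f \<cdot> g) = g" if "Cod C g = Dom C f"
    by (subst reassoc[OF inv_simps(4)]) (simp_all add: that)
  show "f \<cdot> (inv_arr C f \<cdot> g) = g" if "Cod C g = Cod C f"
    by (subst reassoc[OF inv_simps(5)]) (simp_all add: that)
qed

lemma is_iso_inv: "is_iso C f \<Longrightarrow> is_iso C (inv_arr C f)"
  using is_iso_arr[of f] by (intro is_isoI[of _ "Cod C f" "Dom C f" f]) (auto simp: inv_arr in_homI)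

lemma is_iso_comp:
  assumes "is_iso C f" "is_iso C g" "Cod C f = Dom C g"
  shows "is_iso C (g \<cdot> f)"
proof -
  note [simp] = assms is_iso_arr[OF assms(1)] is_iso_arr[OF assms(2)]
  show ?thesis
    by (rule is_isoI[of _ "Dom C f" "Cod C g" "inv_arr C f \<cdot> inv_arr C g"]) (simp_all add: hom_def)
qed

lemma iso_cancel_left:
  assumes "is_iso C f" "f \<cdot> g = f \<cdot> h" "g \<in> Arr C" "h \<in> Arr C" "Cod C g = Dom C f" "Cod C h = Dom C f"
  shows "g = h"
proof -
  have "inv_arr C f \<cdot> (f \<cdot> g) = inv_arr C f \<cdot> (f \<cdot> h)" by (simp only: assms(2))
  then show ?thesis by (simp add: assms(1,3-6))
qed

lemma iso_cancel_right:
  assumes "is_iso C f" "g \<cdot> f = h \<cdot> f" "g \<in> Arr C" "h \<in> Arr C" "Dom C g = Cod C f" "Dom C h = Cod C f"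
  shows "g = h"
proof -
  note [simp] = assms(1,3-6) is_iso_arr[OF assms(1)]
  have "(g \<cdot> f) \<cdot> inv_arr C f = (h \<cdot> f) \<cdot> inv_arr C f" by (simp only: assms(2))
  then show ?thesis by simp
qed

lemma is_iso_left_factor:
  assumes "is_iso C (g \<cdot> f)" "is_iso C f" "g \<in> Arr C" "Cod C f = Dom C g"
  shows "is_iso C g"
proof -
  note [simp] = assms is_iso_arr[OF assms(2)]
  have "is_iso C ((g \<cdot> f) \<cdot> inv_arr C f)"
    by (rule is_iso_comp) (simp_all add: is_iso_inv)
  moreover have "(g \<cdot> f) \<cdot> inv_arr C f = g"
    by simp
  ultimately show ?thesis by (simp only:)
qed

lemma is_iso_right_factor:
  assumes "is_iso C (g \<cdot> f)" "is_iso C g" "f \<in> Arr C" "Cod C f = Dom C g"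
  shows "is_iso C f"
proof -
  note [simp] = assms is_iso_arr[OF assms(2)]
  have "is_iso C (inv_arr C g \<cdot> (g \<cdot> f))"
    by (rule is_iso_comp) (simp_all add: is_iso_inv)
  moreover have "inv_arr C g \<cdot> (g \<cdot> f) = f"
    by simp
  ultimately show ?thesis by (simp only:)
qed

end

section \<open>Calculus of functors and natural transformations\<close>

abbreviation id_ftor :: "('o, 'm, 'o, 'm) ftor" where
  "id_ftor \<equiv> \<lparr>Fobj = \<lambda>x. x, Fmap = \<lambda>f. f\<rparr>"

lemma functor_simps:
  assumes "is_functor C D F"
  shows "x \<in> Obj C \<Longrightarrow> Fobj F x \<in> Obj D"
    "f \<in> Arr C \<Longrightarrow> Fmap F f \<in> Arr D"
    "f \<in> Arr C \<Longrightarrow> Dom D (Fmap F f) = Fobj F (Dom C f)"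
    "f \<in> Arr C \<Longrightarrow> Cod D (Fmap F f) = Fobj F (Cod C f)"
    "x \<in> Obj C \<Longrightarrow> Fmap F (Id C x) = Id D (Fobj F x)"
    "f \<in> Arr C \<Longrightarrow> g \<in> Arr C \<Longrightarrow> Cod C f = Dom C g \<Longrightarrow>
      Fmap F (g \<cdot>\<^bsub>C\<^esub> f) = Fmap F g \<cdot>\<^bsub>D\<^esub> Fmap F f"
proof -
  have *: "f \<in> Arr C \<Longrightarrow> Fmap F f \<in> hom D (Fobj F (Dom C f)) (Fobj F (Cod C f))" for f
    using assms by (auto simp: is_functor_def hom_def)
  show "f \<in> Arr C \<Longrightarrow> Fmap F f \<in> Arr D"
    "f \<in> Arr C \<Longrightarrow> Dom D (Fmap F f) = Fobj F (Dom C f)"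
    "f \<in> Arr C \<Longrightarrow> Cod D (Fmap F f) = Fobj F (Cod C f)"
    using * by (auto simp: hom_def)
qed (use assms in \<open>auto simp: is_functor_def hom_def\<close>)

lemma is_functorI:
  assumes "\<And>x. x \<in> Obj C \<Longrightarrow> Fobj F x \<in> Obj D"
    and "\<And>f. f \<in> Arr C \<Longrightarrow> Fmap F f \<in> hom D (Fobj F (Dom C f)) (Fobj F (Cod C f))"
    and "\<And>x. x \<in> Obj C \<Longrightarrow> Fmap F (Id C x) = Id D (Fobj F x)"
    and "\<And>f g. f \<in> Arr C \<Longrightarrow> g \<in> Arr C \<Longrightarrow> Cod C f = Dom C g \<Longrightarrow>
      Fmap F (g \<cdot>\<^bsub>C\<^esub> f) = Fmap F g \<cdot>\<^bsub>D\<^esub> Fmap F f"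
  shows "is_functor C D F"
  using assms unfolding is_functor_def by (auto simp: hom_def)

lemma fcomp_simps [simp]:
  "Fobj (G \<circ>\<^sub>F F) x = Fobj G (Fobj F x)" "Fmap (G \<circ>\<^sub>F F) f = Fmap G (Fmap F f)"
  by (auto simp: fcomp_def)

lemma fcomp_assoc: "(H \<circ>\<^sub>F G) \<circ>\<^sub>F F = H \<circ>\<^sub>F (G \<circ>\<^sub>F F)"
  by (simp add: fcomp_def comp_assoc)

lemma fcomp_id_ftor [simp]: "F \<circ>\<^sub>F id_ftor = F" "id_ftor \<circ>\<^sub>F F = F"
  by (cases F; simp add: fcomp_def comp_def)+

lemma is_functor_id [simp]: "is_functor C C id_ftor"
  by (auto simp: is_functor_def)

lemma is_functor_fcomp:
  assumes "is_functor C D F" "is_functor D E G"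
  shows "is_functor C E (G \<circ>\<^sub>F F)"
  by (rule is_functorI) (auto simp: functor_simps[OF assms(1)] functor_simps[OF assms(2)] hom_def)

lemma functor_is_iso:
  assumes "category C" "category D" "is_functor C D F" "is_iso C f"
  shows "is_iso D (Fmap F f)" "inv_arr D (Fmap F f) = Fmap F (inv_arr C f)"
proof -
  interpret C: category C by fact
  interpret D: category D by fact
  note [simp] = functor_simps[OF assms(3)] C.is_iso_arr[OF assms(4)] assms(4)
  have 1: "Fmap F (inv_arr C f) \<cdot>\<^bsub>D\<^esub> Fmap F f = Id D (Fobj F (Dom C f))"
    by (simp flip: functor_simps(6)[OF assms(3)])
  have 2: "Fmap F f \<cdot>\<^bsub>D\<^esub> Fmap F (inv_arr C f) = Id D (Fobj F (Cod C f))"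
    by (simp flip: functor_simps(6)[OF assms(3)])
  show i: "is_iso D (Fmap F f)"
    by (rule D.is_isoI[OF _ _ 1 2]) (auto simp: hom_def)
  show "inv_arr D (Fmap F f) = Fmap F (inv_arr C f)"
    by (rule D.iso_cancel_left[OF i]) (auto simp: 2 i)
qed

lemma nat_trans_functor:
  assumes "nat_trans C D F G \<eta>"
  shows "is_functor C D F" "is_functor C D G"
  using assms by (auto simp: nat_trans_def)

lemma nat_trans_simps:
  assumes "nat_trans C D F G \<eta>"
  shows "x \<in> Obj C \<Longrightarrow> \<eta> x \<in> Arr D"
    "x \<in> Obj C \<Longrightarrow> Dom D (\<eta> x) = Fobj F x"
    "x \<in> Obj C \<Longrightarrow> Cod D (\<eta> x) = Fobj G x"
  using assms by (auto simp: nat_trans_def hom_def)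

lemma nat_trans_natural:
  assumes "nat_trans C D F G \<eta>" "f \<in> Arr C" "Dom C f = x" "Cod C f = y"
  shows "\<eta> y \<cdot>\<^bsub>D\<^esub> Fmap F f = Fmap G f \<cdot>\<^bsub>D\<^esub> \<eta> x"
  using assms by (auto simp: nat_trans_def hom_def)

lemma nat_trans_natural_assoc:
  assumes "category C" "category D" "nat_trans C D F G \<eta>" "f \<in> Arr C" "Dom C f = x" "Cod C f = y"
    "k \<in> Arr D" "Cod D k = Fobj F x"
  shows "\<eta> y \<cdot>\<^bsub>D\<^esub> (Fmap F f \<cdot>\<^bsub>D\<^esub> k) = Fmap G f \<cdot>\<^bsub>D\<^esub> (\<eta> x \<cdot>\<^bsub>D\<^esub> k)"
proof -
  interpret C: category C by fact
  interpret D: category D by fact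
  note nat_trans_simps[OF assms(3), simp] functor_simps[OF nat_trans_functor(1)[OF assms(3)], simp]
    functor_simps[OF nat_trans_functor(2)[OF assms(3)], simp]
  have [simp]: "x \<in> Obj C" "y \<in> Obj C" using assms by auto
  show ?thesis
    using D.reassoc[OF nat_trans_natural[OF assms(3-6)], of k] assms by simp
qed

lemma nat_transI:
  assumes "is_functor C D F" "is_functor C D G"
    and "\<And>x. x \<in> Obj C \<Longrightarrow> \<eta> x \<in> hom D (Fobj F x) (Fobj G x)"
    and "\<And>f. f \<in> Arr C \<Longrightarrow> \<eta> (Cod C f) \<cdot>\<^bsub>D\<^esub> Fmap F f = Fmap G f \<cdot>\<^bsub>D\<^esub> \<eta> (Dom C f)"
  shows "nat_trans C D F G \<eta>"
  using assms by (auto simp: nat_trans_def hom_def)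

lemma nat_trans_id:
  assumes "category C" "category D" "is_functor C D F"
  shows "nat_trans C D F F (\<lambda>x. Id D (Fobj F x))"
proof -
  interpret C: category C by fact
  interpret D: category D by fact
  show ?thesis
    by (rule nat_transI) (auto simp: assms functor_simps[OF assms(3)] hom_def)
qed

lemma nat_trans_comp:
  assumes "category C" "category D" "nat_trans C D F G \<eta>" "nat_trans C D G H \<mu>"
  shows "nat_trans C D F H (\<lambda>x. \<mu> x \<cdot>\<^bsub>D\<^esub> \<eta> x)"
proof -
  interpret C: category C by fact
  interpret D: category D by fact
  note nat_trans_simps[OF assms(3), simp] nat_trans_simps[OF assms(4), simp]
    functor_simps[OF nat_trans_functor(1)[OF assms(3)], simp]
    functor_simps[OF nat_trans_functor(2)[OF assms(3)], simp]
    functor_simps[OF nat_trans_functor(2)[OF assms(4)], simp]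
  show ?thesis
    by (rule nat_transI)
      (auto simp: hom_def nat_trans_functor[OF assms(3)] nat_trans_functor[OF assms(4)]
        nat_trans_natural[OF assms(3)] nat_trans_natural_assoc[OF assms(1,2,4)])
qed

lemma nat_trans_whisker_left:
  assumes "nat_trans C D F G \<eta>" "is_functor D E H" "category C"
  shows "nat_trans C E (H \<circ>\<^sub>F F) (H \<circ>\<^sub>F G) (\<lambda>x. Fmap H (\<eta> x))"
proof -
  interpret C: category C by fact
  note [simp] = nat_trans_simps[OF assms(1)] functor_simps[OF assms(2)]
    functor_simps[OF nat_trans_functor(1)[OF assms(1)]]
    functor_simps[OF nat_trans_functor(2)[OF assms(1)]]
  show ?thesis
    by (rule nat_transI)
      (auto simp: hom_def nat_trans_natural[OF assms(1)]
       intro!: is_functor_fcomp nat_trans_functor[OF assms(1)] assms simp flip: functor_simps(6)[OF assms(2)])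
qed

lemma nat_trans_whisker_right:
  assumes "nat_trans C D F G \<eta>" "is_functor B C H" "category B"
  shows "nat_trans B D (F \<circ>\<^sub>F H) (G \<circ>\<^sub>F H) (\<lambda>x. \<eta> (Fobj H x))"
proof -
  interpret B: category B by fact
  note [simp] = nat_trans_simps[OF assms(1)] functor_simps[OF assms(2)]
    functor_simps[OF nat_trans_functor(1)[OF assms(1)]]
    functor_simps[OF nat_trans_functor(2)[OF assms(1)]]
  show ?thesis
    by (rule nat_transI)
      (auto simp: hom_def nat_trans_natural[OF assms(1)]
       intro!: is_functor_fcomp nat_trans_functor[OF assms(1)] assms)
qed

lemma nat_trans_inv:
  assumes "category C" "category D" "nat_trans C D F G \<eta>" "\<And>x. x \<in> Obj C \<Longrightarrow> is_iso D (\<eta> x)"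
  shows "nat_trans C D G F (\<lambda>x. inv_arr D (\<eta> x))"
proof -
  interpret C: category C by fact
  interpret D: category D by fact
  note [simp] = nat_trans_simps[OF assms(3)]
    functor_simps[OF nat_trans_functor(1)[OF assms(3)]]
    functor_simps[OF nat_trans_functor(2)[OF assms(3)]] assms(4)
  show ?thesis
  proof (rule nat_transI)
    fix f assume f [simp]: "f \<in> Arr C"
    show "inv_arr D (\<eta> (Cod C f)) \<cdot>\<^bsub>D\<^esub> Fmap G f = Fmap F f \<cdot>\<^bsub>D\<^esub> inv_arr D (\<eta> (Dom C f))"
    proof (rule D.iso_cancel_left)
      show "is_iso D (\<eta> (Cod C f))" by simp
      show "\<eta> (Cod C f) \<cdot>\<^bsub>D\<^esub> (inv_arr D (\<eta> (Cod C f)) \<cdot>\<^bsub>D\<^esub> Fmap G f) =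
        \<eta> (Cod C f) \<cdot>\<^bsub>D\<^esub> (Fmap F f \<cdot>\<^bsub>D\<^esub> inv_arr D (\<eta> (Dom C f)))"
        by (simp add: nat_trans_natural_assoc[OF assms(1-3) f])
    qed auto
  qed (auto simp: hom_def nat_trans_functor[OF assms(3)])
qed

lemma nat_isomorphic_sym:
  assumes "category C" "category D" "nat_isomorphic C D F G"
  shows "nat_isomorphic C D G F"
  using assms(3) nat_trans_inv[OF assms(1,2)] category.is_iso_inv[OF assms(2)]
  unfolding nat_isomorphic_def by blast

lemma nat_isomorphic_trans:
  assumes "category C" "category D" "nat_isomorphic C D F G" "nat_isomorphic C D G H"
  shows "nat_isomorphic C D F H"
proof -
  obtain \<eta> \<mu> where e: "nat_trans C D F G \<eta>" "\<forall>x \<in> Obj C. is_iso D (\<eta> x)"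
    and m: "nat_trans C D G H \<mu>" "\<forall>x \<in> Obj C. is_iso D (\<mu> x)"
    using assms unfolding nat_isomorphic_def by blast
  have "is_iso D (\<mu> x \<cdot>\<^bsub>D\<^esub> \<eta> x)" if "x \<in> Obj C" for x
    using that e(2) m(2) nat_trans_simps[OF e(1)] nat_trans_simps[OF m(1)]
    by (intro category.is_iso_comp[OF assms(2)]) auto
  then show ?thesis
    using nat_trans_comp[OF assms(1,2) e(1) m(1)] unfolding nat_isomorphic_def by blast
qed

lemma nat_isomorphic_whisker_left:
  assumes "category C" "category D" "category E" "nat_isomorphic C D F G" "is_functor D E H"
  shows "nat_isomorphic C E (H \<circ>\<^sub>F F) (H \<circ>\<^sub>F G)"
  using assms(4) nat_trans_whisker_left[OF _ assms(5,1)] functor_is_iso(1)[OF assms(2,3,5)]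
  unfolding nat_isomorphic_def by blast

lemma nat_isomorphic_whisker_right:
  assumes "category B" "nat_isomorphic C D F G" "is_functor B C H"
  shows "nat_isomorphic B D (F \<circ>\<^sub>F H) (G \<circ>\<^sub>F H)"
  using assms(2) nat_trans_whisker_right[OF _ assms(3,1)] functor_simps(1)[OF assms(3)]
  unfolding nat_isomorphic_def by blast

section \<open>Opposite categories\<close>

text \<open>Updating the record keeps any extra fields, so that \<open>opc (opc C)\<close> equals
  \<open>C\<close> literally. A functor between opposites is the same \<open>ftor\<close> record,
  and dual statements need no translation of functors.\<close>

definition opc :: "('o, 'm, 'z) cat_scheme \<Rightarrow> ('o, 'm, 'z) cat_scheme" where
  "opc C = C\<lparr>Dom := Cod C, Cod := Dom C, Comp := \<lambda>g f. f \<cdot>\<^bsub>C\<^esub> g\<rparr>"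

lemma opc_simps [simp]:
  "Obj (opc C) = Obj C" "Arr (opc C) = Arr C" "Dom (opc C) = Cod C" "Cod (opc C) = Dom C"
  "Id (opc C) = Id C" "g \<cdot>\<^bsub>opc C\<^esub> f = f \<cdot>\<^bsub>C\<^esub> g" "hom (opc C) x y = hom C y x"
  by (auto simp: opc_def hom_def)

lemma opc_opc [simp]: "opc (opc C) = C"
  by (cases C) (auto simp: opc_def)

lemma category_opc: "category C \<Longrightarrow> category (opc C)"
  by (simp add: category_def) metis

lemma category_opc_iff [simp]: "category (opc C) \<longleftrightarrow> category C"
  using category_opc[of C] category_opc[of "opc C"] by auto

lemma is_iso_opc [simp]: "is_iso (opc C) f \<longleftrightarrow> is_iso C f"
  by (auto simp: is_iso_def)

lemma is_functor_opc [simp]: "is_functor (opc C) (opc D) F \<longleftrightarrow> is_functor C D F"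
  by (simp add: is_functor_def) blast

lemma nat_trans_opc [simp]: "nat_trans (opc C) (opc D) F G \<eta> \<longleftrightarrow> nat_trans C D G F \<eta>"
  by (simp add: nat_trans_def) metis

lemma nat_isomorphic_opc [simp]:
  "nat_isomorphic (opc C) (opc D) F G \<longleftrightarrow> nat_isomorphic C D G F"
  by (simp add: nat_isomorphic_def)

lemma adjunction_opc [simp]:
  "adjunction (opc D) (opc C) U F \<epsilon> \<eta> \<longleftrightarrow> adjunction C D F U \<eta> \<epsilon>"
  by (auto simp: adjunction_def)

section \<open>Adjunctions\<close>

lemma adjunctionD:
  assumes "adjunction C D F U \<eta> \<epsilon>"
  shows "is_functor C D F" "is_functor D C U" "nat_trans C C id_ftor (U \<circ>\<^sub>F F) \<eta>"
    "nat_trans D D (F \<circ>\<^sub>F U) id_ftor \<epsilon>"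
    "x \<in> Obj C \<Longrightarrow> \<epsilon> (Fobj F x) \<cdot>\<^bsub>D\<^esub> Fmap F (\<eta> x) = Id D (Fobj F x)"
    "y \<in> Obj D \<Longrightarrow> Fmap U (\<epsilon> y) \<cdot>\<^bsub>C\<^esub> \<eta> (Fobj U y) = Id C (Fobj U y)"
  using assms by (auto simp: adjunction_def)

lemma adjunction_natural:
  assumes "adjunction C D F U \<eta> \<epsilon>"
  shows "f \<in> Arr C \<Longrightarrow> Dom C f = x \<Longrightarrow> Cod C f = x' \<Longrightarrow> \<eta> x' \<cdot>\<^bsub>C\<^esub> f = Fmap U (Fmap F f) \<cdot>\<^bsub>C\<^esub> \<eta> x"
    "g \<in> Arr D \<Longrightarrow> Dom D g = y \<Longrightarrow> Cod D g = y' \<Longrightarrow> \<epsilon> y' \<cdot>\<^bsub>D\<^esub> Fmap F (Fmap U g) = g \<cdot>\<^bsub>D\<^esub> \<epsilon> y"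
  using nat_trans_natural[OF adjunctionD(3)[OF assms]] nat_trans_natural[OF adjunctionD(4)[OF assms]]
  by auto

lemma adjunction_simps:
  assumes "adjunction C D F U \<eta> \<epsilon>"
  shows "x \<in> Obj C \<Longrightarrow> \<eta> x \<in> Arr C" "x \<in> Obj C \<Longrightarrow> Dom C (\<eta> x) = x"
    "x \<in> Obj C \<Longrightarrow> Cod C (\<eta> x) = Fobj U (Fobj F x)"
    "y \<in> Obj D \<Longrightarrow> \<epsilon> y \<in> Arr D" "y \<in> Obj D \<Longrightarrow> Dom D (\<epsilon> y) = Fobj F (Fobj U y)"
    "y \<in> Obj D \<Longrightarrow> Cod D (\<epsilon> y) = y"
  using nat_trans_simps[OF adjunctionD(3)[OF assms]] nat_trans_simps[OF adjunctionD(4)[OF assms]]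
  by auto

text \<open>Each triangle identity of the composite follows from one naturality square, of
  \<epsilon> at a component of \<eta>' or of \<eta>' at a component of \<epsilon>, which brings the
  two given triangle identities together.\<close>

lemma adjunction_comp:
  assumes "category C" "category D" "category E"
    and adj: "adjunction C D F U \<eta> \<epsilon>" and adj': "adjunction D E F' U' \<eta>' \<epsilon>'"
  shows "\<exists>\<eta> \<epsilon>. adjunction C E (F' \<circ>\<^sub>F F) (U \<circ>\<^sub>F U') \<eta> \<epsilon>"
proof -
  interpret C: category C by fact
  interpret D: category D by fact
  interpret E: category E by fact
  note F = adjunctionD(1)[OF adj] and U = adjunctionD(2)[OF adj]
  note F' = adjunctionD(1)[OF adj'] and U' = adjunctionD(2)[OF adj']
  note [simp] = functor_simps[OF F] functor_simps[OF U] functor_simps[OF F'] functor_simps[OF U']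
    adjunction_simps[OF adj] adjunction_simps[OF adj']
  define \<eta>'' where "\<eta>'' = (\<lambda>x. Fmap U (\<eta>' (Fobj F x)) \<cdot>\<^bsub>C\<^esub> \<eta> x)"
  define \<epsilon>'' where "\<epsilon>'' = (\<lambda>z. \<epsilon>' z \<cdot>\<^bsub>E\<^esub> Fmap F' (\<epsilon> (Fobj U' z)))"
  have 1: "nat_trans C C id_ftor ((U \<circ>\<^sub>F U') \<circ>\<^sub>F (F' \<circ>\<^sub>F F)) \<eta>''"
    unfolding \<eta>''_def
    using nat_trans_comp[OF assms(1,1) adjunctionD(3)[OF adj]
      nat_trans_whisker_left[OF nat_trans_whisker_right[OF adjunctionD(3)[OF adj'] F assms(1)] U assms(1), simplified]]
    by (simp add: fcomp_assoc)
  have 2: "nat_trans E E ((F' \<circ>\<^sub>F F) \<circ>\<^sub>F (U \<circ>\<^sub>F U')) id_ftor \<epsilon>''"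
    unfolding \<epsilon>''_def
    using nat_trans_comp[OF assms(3,3) _ adjunctionD(4)[OF adj'],
      OF nat_trans_whisker_left[OF nat_trans_whisker_right[OF adjunctionD(4)[OF adj] U' assms(3)] F' assms(3), simplified]]
    by (simp add: fcomp_assoc)
  have 3: "\<epsilon>'' (Fobj F' (Fobj F x)) \<cdot>\<^bsub>E\<^esub> Fmap F' (Fmap F (\<eta>'' x)) = Id E (Fobj F' (Fobj F x))"
    if [simp]: "x \<in> Obj C" for x
  proof -
    have "Fmap F' (\<epsilon> (Fobj U' (Fobj F' (Fobj F x)))) \<cdot>\<^bsub>E\<^esub> Fmap F' (Fmap F (\<eta>'' x)) =
        Fmap F' ((\<epsilon> (Fobj U' (Fobj F' (Fobj F x))) \<cdot>\<^bsub>D\<^esub> Fmap F (Fmap U (\<eta>' (Fobj F x)))) \<cdot>\<^bsub>D\<^esub> Fmap F (\<eta> x))"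
      by (simp add: \<eta>''_def)
    also have "\<dots> = Fmap F' (\<eta>' (Fobj F x) \<cdot>\<^bsub>D\<^esub> (\<epsilon> (Fobj F x) \<cdot>\<^bsub>D\<^esub> Fmap F (\<eta> x)))"
      by (subst adjunction_natural(2)[OF adj _ refl]) simp_all
    also have "\<dots> = Fmap F' (\<eta>' (Fobj F x))"
      by (subst adjunctionD(5)[OF adj]) simp_all
    finally show ?thesis
      by (simp add: \<epsilon>''_def) (simp add: \<eta>''_def adjunctionD(5)[OF adj'])
  qed
  have 4: "Fmap U (Fmap U' (\<epsilon>'' z)) \<cdot>\<^bsub>C\<^esub> \<eta>'' (Fobj U (Fobj U' z)) = Id C (Fobj U (Fobj U' z))"
    if [simp]: "z \<in> Obj E" for z
  proof -
    have "Fmap U (Fmap U' (\<epsilon>'' z)) \<cdot>\<^bsub>C\<^esub> Fmap U (\<eta>' (Fobj F (Fobj U (Fobj U' z)))) =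
        Fmap U (Fmap U' (\<epsilon>' z) \<cdot>\<^bsub>D\<^esub> (Fmap U' (Fmap F' (\<epsilon> (Fobj U' z))) \<cdot>\<^bsub>D\<^esub> \<eta>' (Fobj F (Fobj U (Fobj U' z)))))"
      by (simp add: \<epsilon>''_def)
    also have "\<dots> = Fmap U ((Fmap U' (\<epsilon>' z) \<cdot>\<^bsub>D\<^esub> \<eta>' (Fobj U' z)) \<cdot>\<^bsub>D\<^esub> \<epsilon> (Fobj U' z))"
      by (subst adjunction_natural(1)[OF adj', where x' = "Fobj U' z", symmetric]) simp_all
    also have "\<dots> = Fmap U (\<epsilon> (Fobj U' z))"
      by (subst adjunctionD(6)[OF adj']) simp_all
    finally have "(Fmap U (Fmap U' (\<epsilon>'' z)) \<cdot>\<^bsub>C\<^esub> Fmap U (\<eta>' (Fobj F (Fobj U (Fobj U' z))))) \<cdot>\<^bsub>C\<^esub> \<eta> (Fobj U (Fobj U' z)) =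
        Fmap U (\<epsilon> (Fobj U' z)) \<cdot>\<^bsub>C\<^esub> \<eta> (Fobj U (Fobj U' z))" by (rule arg_cong)
    then show ?thesis
      by (simp add: \<epsilon>''_def \<eta>''_def adjunctionD(6)[OF adj])
  qed
  have "adjunction C E (F' \<circ>\<^sub>F F) (U \<circ>\<^sub>F U') \<eta>'' \<epsilon>''"
    unfolding adjunction_def
    using 1 2 3 4 is_functor_fcomp[OF F F'] is_functor_fcomp[OF U' U] by simp
  then show ?thesis by blast
qed

text \<open>The unit is transported along the inverse of \<alpha> and the counit along \<alpha>.
  This reduces uniqueness of adjoints for isomorphic left adjoints to the case of one common left
  adjoint.\<close>

lemma adjunction_iso_left:
  assumes "category C" "category D" and adj: "adjunction C D F' U \<eta> \<epsilon>"
    and "nat_isomorphic C D F F'"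
  shows "\<exists>\<eta> \<epsilon>. adjunction C D F U \<eta> \<epsilon>"
proof -
  interpret C: category C by fact
  interpret D: category D by fact
  obtain \<alpha> where \<alpha>: "nat_trans C D F F' \<alpha>" "\<And>x. x \<in> Obj C \<Longrightarrow> is_iso D (\<alpha> x)"
    using assms(4) by (auto simp: nat_isomorphic_def)
  note \<beta> = nat_trans_inv[OF assms(1,2) \<alpha>]
  note F = nat_trans_functor(1)[OF \<alpha>(1)] and F' = adjunctionD(1)[OF adj] and U = adjunctionD(2)[OF adj]
  note [simp] = functor_simps[OF F] functor_simps[OF F'] functor_simps[OF U]
    adjunction_simps[OF adj] nat_trans_simps[OF \<alpha>(1)] \<alpha>(2)
  define \<eta>' where "\<eta>' = (\<lambda>x. Fmap U (inv_arr D (\<alpha> x)) \<cdot>\<^bsub>C\<^esub> \<eta> x)"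
  define \<epsilon>' where "\<epsilon>' = (\<lambda>y. \<epsilon> y \<cdot>\<^bsub>D\<^esub> \<alpha> (Fobj U y))"
  have 1: "nat_trans C C id_ftor (U \<circ>\<^sub>F F) \<eta>'"
    unfolding \<eta>'_def
    by (rule nat_trans_comp[OF assms(1,1) adjunctionD(3)[OF adj] nat_trans_whisker_left[OF \<beta> U assms(1)]])
  have 2: "nat_trans D D (F \<circ>\<^sub>F U) id_ftor \<epsilon>'"
    unfolding \<epsilon>'_def
    by (rule nat_trans_comp[OF assms(2,2) nat_trans_whisker_right[OF \<alpha>(1) U assms(2)] adjunctionD(4)[OF adj]])
  have 3: "\<epsilon>' (Fobj F x) \<cdot>\<^bsub>D\<^esub> Fmap F (\<eta>' x) = Id D (Fobj F x)" if [simp]: "x \<in> Obj C" for x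
  proof -
    have "\<alpha> (Fobj U (Fobj F x)) \<cdot>\<^bsub>D\<^esub> Fmap F (\<eta>' x) =
        Fmap F' (Fmap U (inv_arr D (\<alpha> x)) \<cdot>\<^bsub>C\<^esub> \<eta> x) \<cdot>\<^bsub>D\<^esub> \<alpha> x"
      unfolding \<eta>'_def by (rule nat_trans_natural[OF \<alpha>(1)]) simp_all
    then have "\<epsilon>' (Fobj F x) \<cdot>\<^bsub>D\<^esub> Fmap F (\<eta>' x) =
        (\<epsilon> (Fobj F x) \<cdot>\<^bsub>D\<^esub> Fmap F' (Fmap U (inv_arr D (\<alpha> x)))) \<cdot>\<^bsub>D\<^esub> (Fmap F' (\<eta> x) \<cdot>\<^bsub>D\<^esub> \<alpha> x)"
      by (simp add: \<epsilon>'_def \<eta>'_def)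
    also have "\<dots> = inv_arr D (\<alpha> x) \<cdot>\<^bsub>D\<^esub> ((\<epsilon> (Fobj F' x) \<cdot>\<^bsub>D\<^esub> Fmap F' (\<eta> x)) \<cdot>\<^bsub>D\<^esub> \<alpha> x)"
      by (subst adjunction_natural(2)[OF adj _ refl]) simp_all
    also have "\<dots> = Id D (Fobj F x)"
      by (subst adjunctionD(5)[OF adj]) simp_all
    finally show ?thesis .
  qed
  have 4: "Fmap U (\<epsilon>' y) \<cdot>\<^bsub>C\<^esub> \<eta>' (Fobj U y) = Id C (Fobj U y)" if [simp]: "y \<in> Obj D" for y
  proof -
    \<comment> \<open>The pair \<alpha> and its inverse is split over two images under
      \<open>U\<close> on one side and adjacent on the other. Cancellation is switched off so that
      the two sides can still be matched.\<close>
    have "Fmap U (\<epsilon>' y) \<cdot>\<^bsub>C\<^esub> \<eta>' (Fobj U y) =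
        Fmap U (\<epsilon> y \<cdot>\<^bsub>D\<^esub> (\<alpha> (Fobj U y) \<cdot>\<^bsub>D\<^esub> inv_arr D (\<alpha> (Fobj U y)))) \<cdot>\<^bsub>C\<^esub> \<eta> (Fobj U y)"
      unfolding \<epsilon>'_def \<eta>'_def by (simp del: D.inv_simps D.inv_assoc add: D.inv_simps(1-3))
    also have "\<dots> = Id C (Fobj U y)"
      by (simp add: adjunctionD(6)[OF adj])
    finally show ?thesis .
  qed
  have "adjunction C D F U \<eta>' \<epsilon>'"
    unfolding adjunction_def using F U 1 2 3 4 by simp
  then show ?thesis by blast
qed

text \<open>The two factors are the canonical comparisons between right adjoints of the same
  \<open>F\<close>. The statement is symmetric in the two adjunctions, so a second use with their
  roles exchanged shows that the comparisons are mutually inverse.\<close>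

lemma right_adjoint_comparison:
  assumes "category C" "category D"
    and adj: "adjunction C D F U \<eta> \<epsilon>" and adj': "adjunction C D F U' \<eta>' \<epsilon>'" and [simp]: "y \<in> Obj D"
  shows "(Fmap U (\<epsilon>' y) \<cdot>\<^bsub>C\<^esub> \<eta> (Fobj U' y)) \<cdot>\<^bsub>C\<^esub> (Fmap U' (\<epsilon> y) \<cdot>\<^bsub>C\<^esub> \<eta>' (Fobj U y)) = Id C (Fobj U y)"
proof -
  interpret C: category C by fact
  interpret D: category D by fact
  note [simp] = functor_simps[OF adjunctionD(1)[OF adj]] functor_simps[OF adjunctionD(2)[OF adj]]
    functor_simps[OF adjunctionD(2)[OF adj']] adjunction_simps[OF adj] adjunction_simps[OF adj']
  let ?k = "Fmap U' (\<epsilon> y) \<cdot>\<^bsub>C\<^esub> \<eta>' (Fobj U y)"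
  have "(Fmap U (\<epsilon>' y) \<cdot>\<^bsub>C\<^esub> \<eta> (Fobj U' y)) \<cdot>\<^bsub>C\<^esub> ?k = Fmap U (\<epsilon>' y) \<cdot>\<^bsub>C\<^esub> (\<eta> (Fobj U' y) \<cdot>\<^bsub>C\<^esub> ?k)"
    by (rule C.assoc) simp_all
  also have "\<eta> (Fobj U' y) \<cdot>\<^bsub>C\<^esub> ?k = Fmap U (Fmap F ?k) \<cdot>\<^bsub>C\<^esub> \<eta> (Fobj U y)"
    by (rule adjunction_natural(1)[OF adj]) simp_all
  also have "Fmap U (\<epsilon>' y) \<cdot>\<^bsub>C\<^esub> \<dots> =
      Fmap U ((\<epsilon>' y \<cdot>\<^bsub>D\<^esub> Fmap F (Fmap U' (\<epsilon> y))) \<cdot>\<^bsub>D\<^esub> Fmap F (\<eta>' (Fobj U y))) \<cdot>\<^bsub>C\<^esub> \<eta> (Fobj U y)"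
    by simp
  also have "\<dots> = Fmap U (\<epsilon> y \<cdot>\<^bsub>D\<^esub> (\<epsilon>' (Fobj F (Fobj U y)) \<cdot>\<^bsub>D\<^esub> Fmap F (\<eta>' (Fobj U y)))) \<cdot>\<^bsub>C\<^esub> \<eta> (Fobj U y)"
    by (subst adjunction_natural(2)[OF adj' _ refl]) simp_all
  also have "\<dots> = Id C (Fobj U y)"
    by (simp add: adjunctionD(5)[OF adj'] adjunctionD(6)[OF adj])
  finally show ?thesis .
qed

lemma right_adjoint_unique:
  assumes "category C" "category D"
    and adj: "adjunction C D F U \<eta> \<epsilon>" and adj': "adjunction C D F U' \<eta>' \<epsilon>'"
  shows "nat_isomorphic D C U U'"
proof -
  interpret C: category C by fact
  interpret D: category D by fact
  note [simp] = functor_simps[OF adjunctionD(1)[OF adj]] functor_simps[OF adjunctionD(2)[OF adj]]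
    functor_simps[OF adjunctionD(2)[OF adj']] adjunction_simps[OF adj] adjunction_simps[OF adj']
  note U = adjunctionD(2)[OF adj] and U' = adjunctionD(2)[OF adj']
  have "nat_trans D C U U' (\<lambda>y. Fmap U' (\<epsilon> y) \<cdot>\<^bsub>C\<^esub> \<eta>' (Fobj U y))"
    using nat_trans_comp[OF assms(2,1) nat_trans_whisker_right[OF adjunctionD(3)[OF adj'] U assms(2)],
        OF nat_trans_whisker_left[OF adjunctionD(4)[OF adj] U' assms(2), folded fcomp_assoc], simplified]
    by (simp add: fcomp_assoc)
  moreover have "is_iso C (Fmap U' (\<epsilon> y) \<cdot>\<^bsub>C\<^esub> \<eta>' (Fobj U y))" if [simp]: "y \<in> Obj D" for y
    by (rule C.is_isoI[OF _ _ right_adjoint_comparison[OF assms that]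
          right_adjoint_comparison[OF assms(1,2) adj' adj that]])
      (simp_all add: hom_def)
  ultimately show ?thesis unfolding nat_isomorphic_def by blast
qed

lemma right_adjoints_isomorphic:
  assumes "category C" "category D" "\<exists>\<eta> \<epsilon>. adjunction C D F U \<eta> \<epsilon>" "\<exists>\<eta> \<epsilon>. adjunction C D F' U' \<eta> \<epsilon>"
    and "nat_isomorphic C D F F'"
  shows "nat_isomorphic D C U U'"
  using assms(3) adjunction_iso_left[OF assms(1,2) _ assms(5)] assms(4)
    right_adjoint_unique[OF assms(1,2)] by blast

lemma left_adjoints_isomorphic:
  assumes "category C" "category D" "\<exists>\<eta> \<epsilon>. adjunction C D F U \<eta> \<epsilon>" "\<exists>\<eta> \<epsilon>. adjunction C D F' U' \<eta> \<epsilon>"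
    and "nat_isomorphic D C U U'"
  shows "nat_isomorphic C D F F'"
proof -
  have "nat_isomorphic (opc C) (opc D) F F'"
    by (rule right_adjoints_isomorphic[of "opc D" "opc C" U _ U'])
      (use assms nat_isomorphic_sym[OF assms(2,1,5)] in auto)
  then show ?thesis using nat_isomorphic_sym[OF assms(1,2)] by simp
qed

section \<open>Model categories and duality\<close>

definition opm :: "('o, 'm, 'z) model_cat_scheme \<Rightarrow> ('o, 'm, 'z) model_cat_scheme" where
  "opm M = (opc M)\<lparr>Cof := Fib M, Fib := Cof M\<rparr>"

lemma opm_simps [simp]:
  "Obj (opm M) = Obj M" "Arr (opm M) = Arr M" "Dom (opm M) = Cod M" "Cod (opm M) = Dom M"
  "Id (opm M) = Id M" "g \<cdot>\<^bsub>opm M\<^esub> f = f \<cdot>\<^bsub>M\<^esub> g" "hom (opm M) x y = hom M y x"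
  "Weq (opm M) = Weq M" "Cof (opm M) = Fib M" "Fib (opm M) = Cof M"
  by (auto simp: opm_def opc_def hom_def)

lemma opm_opm [simp]: "opm (opm M) = M"
  by (cases M) (auto simp: opm_def opc_def)

lemma category_opm: "category M \<Longrightarrow> category (opm M)"
  using category_opc[of M] by (simp add: category_def)

lemma is_functor_opm:
  "is_functor (opm M) (opc E) F \<longleftrightarrow> is_functor M E F"
  "is_functor (opm M) (opm N) F \<longleftrightarrow> is_functor M N F"
  by (simp_all add: is_functor_def) blast+

lemma nat_trans_opm:
  "nat_trans (opm M) (opc E) F G \<eta> \<longleftrightarrow> nat_trans M E G F \<eta>"
  "nat_trans (opm M) (opm N) F G \<eta> \<longleftrightarrow> nat_trans M N G F \<eta>"
  by (simp_all add: nat_trans_def is_functor_opm) metis+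

lemma adjunction_opm:
  "adjunction (opm N) (opm M) U F \<epsilon> \<eta> \<longleftrightarrow> adjunction M N F U \<eta> \<epsilon>"
  by (auto simp: adjunction_def is_functor_opm nat_trans_opm)

lemma is_functor_op_index: "is_functor J (opm M) D \<Longrightarrow> is_functor (opc J) M D"
  by (simp add: is_functor_def)

text \<open>A diagram of shape \<open>J\<close> in \<open>opm M\<close> is a diagram of shape
  \<open>opc J\<close> in \<open>M\<close>, so the index category is reversed along with the model
  category.\<close>

lemma has_finite_limits_op:
  assumes "has_finite_colimits M"
  shows "has_finite_limits (opm M)"
  unfolding has_finite_limits_def
proof (intro allI impI, elim conjE)
  fix J D assume J: "finite_index_cat J" and D: "is_functor J (opm M) D"
  have "finite_index_cat (opc J)" using J by (simp add: finite_index_cat_def)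
  moreover have "is_functor (opc J) M D"
    using D by (rule is_functor_op_index)
  ultimately obtain x l where "is_colimit (opc J) M D x l"
    using assms unfolding has_finite_colimits_def by blast
  then have "is_limit J (opm M) D x l"
    by (auto simp: is_limit_def is_colimit_def is_cone_def is_cocone_def)
  then show "\<exists>x l. is_limit J (opm M) D x l" by blast
qed

lemma has_finite_colimits_op:
  assumes "has_finite_limits M"
  shows "has_finite_colimits (opm M)"
  unfolding has_finite_colimits_def
proof (intro allI impI, elim conjE)
  fix J D assume J: "finite_index_cat J" and D: "is_functor J (opm M) D"
  have "finite_index_cat (opc J)" using J by (simp add: finite_index_cat_def)
  moreover have "is_functor (opc J) M D"
    using D by (rule is_functor_op_index)
  ultimately obtain x l where "is_limit (opc J) M D x l"
    using assms unfolding has_finite_limits_def by blast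
  then have "is_colimit J (opm M) D x l"
    by (auto simp: is_limit_def is_colimit_def is_cone_def is_cocone_def)
  then show "\<exists>x l. is_colimit J (opm M) D x l" by blast
qed

lemma is_subcategory_op: "is_subcategory M S \<Longrightarrow> is_subcategory (opm M) S"
  by (auto simp: is_subcategory_def)

lemma is_retractI:
  assumes "f \<in> Arr M" "g \<in> Arr M" "a \<in> hom M (Dom M f) (Dom M g)"
    "b \<in> hom M (Dom M g) (Dom M f)" "c \<in> hom M (Cod M f) (Cod M g)" "d \<in> hom M (Cod M g) (Cod M f)"
    "b \<cdot>\<^bsub>M\<^esub> a = Id M (Dom M f)" "d \<cdot>\<^bsub>M\<^esub> c = Id M (Cod M f)"
    "g \<cdot>\<^bsub>M\<^esub> a = c \<cdot>\<^bsub>M\<^esub> f" "f \<cdot>\<^bsub>M\<^esub> b = d \<cdot>\<^bsub>M\<^esub> g"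
  shows "is_retract M f g"
  unfolding is_retract_def
  by (intro conjI assms(1,2) bexI[OF _ assms(3)] bexI[OF _ assms(4)] bexI[OF _ assms(5)]
    bexI[OF _ assms(6)] assms(7-10))

lemma is_retract_op:
  assumes "is_retract (opm M) f g"
  shows "is_retract M f g"
proof -
  obtain a b c d where *: "f \<in> Arr (opm M)" "g \<in> Arr (opm M)" "a \<in> hom (opm M) (Dom (opm M) f) (Dom (opm M) g)"
    "b \<in> hom (opm M) (Dom (opm M) g) (Dom (opm M) f)"
    "c \<in> hom (opm M) (Cod (opm M) f) (Cod (opm M) g)" "d \<in> hom (opm M) (Cod (opm M) g) (Cod (opm M) f)"
    "b \<cdot>\<^bsub>opm M\<^esub> a = Id (opm M) (Dom (opm M) f)" "d \<cdot>\<^bsub>opm M\<^esub> c = Id (opm M) (Cod (opm M) f)"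
    "g \<cdot>\<^bsub>opm M\<^esub> a = c \<cdot>\<^bsub>opm M\<^esub> f" "f \<cdot>\<^bsub>opm M\<^esub> b = d \<cdot>\<^bsub>opm M\<^esub> g"
    using assms unfolding is_retract_def by blast
  show ?thesis
    by (rule is_retractI[of _ _ _ d c b a]) (use * in simp_all)
qed

lemma has_lifting_op:
  assumes "has_lifting M p i"
  shows "has_lifting (opm M) i p"
  unfolding has_lifting_def
proof (intro ballI impI, simp)
  fix f g assume "f \<in> hom M (Cod M p) (Cod M i)" "g \<in> hom M (Dom M p) (Dom M i)"
    and "f \<cdot>\<^bsub>M\<^esub> p = i \<cdot>\<^bsub>M\<^esub> g"
  then show "\<exists>h \<in> hom M (Cod M p) (Dom M i). i \<cdot>\<^bsub>M\<^esub> h = f \<and> h \<cdot>\<^bsub>M\<^esub> p = g"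
    using assms unfolding has_lifting_def by metis
qed

lemma model_category_opm:
  assumes "model_category M"
  shows "model_category (opm M)"
proof -
  interpret model_category M by fact
  show ?thesis
  proof (intro model_category.intro model_category_axioms.intro)
    show "category (opm M)" by (rule category_opm) unfold_locales
    show "has_finite_limits (opm M)" using finite_colimits by (rule has_finite_limits_op)
    show "has_finite_colimits (opm M)" using finite_limits by (rule has_finite_colimits_op)
    show "is_subcategory (opm M) (Weq (opm M))" "is_subcategory (opm M) (Cof (opm M))"
      "is_subcategory (opm M) (Fib (opm M))"
      by (auto intro: is_subcategory_op weq_subcategory cof_subcategory fib_subcategory)
    show "f \<in> Weq (opm M)" if "f \<in> hom (opm M) x y" "g \<in> hom (opm M) y z"
        "g \<in> Weq (opm M)" "g \<cdot>\<^bsub>opm M\<^esub> f \<in> Weq (opm M)" for f g x y z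
      using that two_of_three_right[of g z y f x] by simp
    show "g \<in> Weq (opm M)" if "f \<in> hom (opm M) x y" "g \<in> hom (opm M) y z"
        "f \<in> Weq (opm M)" "g \<cdot>\<^bsub>opm M\<^esub> f \<in> Weq (opm M)" for f g x y z
      using that two_of_three_left[of g z y f x] by simp
    show "f \<in> Weq (opm M)" if "is_retract (opm M) f g" "g \<in> Weq (opm M)" for f g
      using that is_retract_op[of M f g] weq_retract by simp
    show "f \<in> Cof (opm M)" if "is_retract (opm M) f g" "g \<in> Cof (opm M)" for f g
      using that is_retract_op[of M f g] fib_retract by simp
    show "f \<in> Fib (opm M)" if "is_retract (opm M) f g" "g \<in> Fib (opm M)" for f g
      using that is_retract_op[of M f g] cof_retract by simp
    show "has_lifting (opm M) i p" if "i \<in> Cof (opm M)" "p \<in> Fib (opm M) \<inter> Weq (opm M)" for i p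
      using that lift_acyclic_cof by (intro has_lifting_op) simp
    show "has_lifting (opm M) i p" if "i \<in> Cof (opm M) \<inter> Weq (opm M)" "p \<in> Fib (opm M)" for i p
      using that lift_acyclic_fib by (intro has_lifting_op) simp
    show "\<exists>i \<in> Cof (opm M). \<exists>p \<in> Fib (opm M) \<inter> Weq (opm M).
        Cod (opm M) i = Dom (opm M) p \<and> f = p \<cdot>\<^bsub>opm M\<^esub> i" if "f \<in> Arr (opm M)" for f
      using factor_acyclic_cof[of f] that by simp metis
    show "\<exists>i \<in> Cof (opm M) \<inter> Weq (opm M). \<exists>p \<in> Fib (opm M).
        Cod (opm M) i = Dom (opm M) p \<and> f = p \<cdot>\<^bsub>opm M\<^esub> i" if "f \<in> Arr (opm M)" for f
      using factor_acyclic_fib[of f] that by simp metis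
  qed
qed

lemma cofibrant_opm [simp]: "cofibrant (opm M) x \<longleftrightarrow> fibrant M x"
  by (simp add: cofibrant_def fibrant_def is_initial_def is_terminal_def)

lemma fibrant_opm [simp]: "fibrant (opm M) x \<longleftrightarrow> cofibrant M x"
  by (simp add: cofibrant_def fibrant_def is_initial_def is_terminal_def)

section \<open>Cofibrant objects\<close>

context model_category
begin

lemma weq_arr [simp]: "f \<in> Weq M \<Longrightarrow> f \<in> Arr M"
  and cof_arr [simp]: "f \<in> Cof M \<Longrightarrow> f \<in> Arr M"
  and fib_arr [simp]: "f \<in> Fib M \<Longrightarrow> f \<in> Arr M"
  using weq_subcategory cof_subcategory fib_subcategory by (auto simp: is_subcategory_def)

lemma weq_comp: "f \<in> Weq M \<Longrightarrow> g \<in> Weq M \<Longrightarrow> Cod M f = Dom M g \<Longrightarrow> g \<cdot> f \<in> Weq M"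
  and cof_comp: "f \<in> Cof M \<Longrightarrow> g \<in> Cof M \<Longrightarrow> Cod M f = Dom M g \<Longrightarrow> g \<cdot> f \<in> Cof M"
  using weq_subcategory cof_subcategory by (auto simp: is_subcategory_def)

lemma weq_id: "x \<in> Obj M \<Longrightarrow> Id M x \<in> Weq M"
  using weq_subcategory by (auto simp: is_subcategory_def)

lemma weq_right_factor:
  "f \<in> Arr M \<Longrightarrow> g \<in> Arr M \<Longrightarrow> Cod M f = Dom M g \<Longrightarrow> g \<in> Weq M \<Longrightarrow> g \<cdot> f \<in> Weq M \<Longrightarrow> f \<in> Weq M"
  by (rule two_of_three_left[of f "Dom M f" "Cod M f" g "Cod M g"]) (auto simp: hom_def)

section \<open>Initial objects and binary coproducts from finite colimits\<close>

lemma initial_exists: "\<exists>i. is_initial M i"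
proof -
  define J :: "(nat, nat) cat" where
    "J = \<lparr>Obj = {}, Arr = {}, Dom = \<lambda>_. 0, Cod = \<lambda>_. 0, Id = \<lambda>_. 0, Comp = \<lambda>_ _. 0\<rparr>"
  have [simp]: "Obj J = {}" "hom J x y = {}" for x y by (auto simp: J_def hom_def)
  have "finite_index_cat J"
    unfolding finite_index_cat_def by (auto simp: J_def hom_def intro!: category.intro)
  moreover have "is_functor J M D" for D
    by (simp add: is_functor_def)
  ultimately obtain D :: "(nat, nat, 'o, 'm) ftor" and x l where "is_colimit J M D x l"
    using finite_colimits unfolding has_finite_colimits_def by blast
  then have "is_initial M x"
    by (auto simp: is_colimit_def is_cocone_def is_initial_def)
  then show ?thesis ..
qed

text \<open>The shape is the discrete category on two objects; only equal identities are composable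
  there, so projecting to one argument is a valid composition. Existence and uniqueness of the
  copairing are separated because the lifting arguments use them at different places.\<close>

lemma coproduct_exists:
  assumes [simp]: "a \<in> Obj M" "b \<in> Obj M"
  shows "\<exists>s i j. i \<in> hom M a s \<and> j \<in> hom M b s \<and>
    (\<forall>c f g. f \<in> hom M a c \<and> g \<in> hom M b c \<longrightarrow> (\<exists>h \<in> hom M s c. h \<cdot> i = f \<and> h \<cdot> j = g)) \<and>
    (\<forall>c. \<forall>h \<in> hom M s c. \<forall>k \<in> hom M s c. h \<cdot> i = k \<cdot> i \<and> h \<cdot> j = k \<cdot> j \<longrightarrow> h = k)"
proof -
  define J :: "(nat, nat) cat" where
    "J = \<lparr>Obj = {0, 1}, Arr = {0, 1}, Dom = \<lambda>x. x, Cod = \<lambda>x. x, Id = \<lambda>x. x, Comp = \<lambda>g f. f\<rparr>"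
  have [simp]: "Obj J = {0, 1}" "Arr J = {0, 1}" "Dom J x = x" "Cod J x = x"
    "Id J x = x" "Comp J x y = y" for x y
    by (simp_all add: J_def)
  have hom_J [simp]: "f \<in> hom J x y \<longleftrightarrow> f = x \<and> f = y \<and> f \<in> {0, 1}" for f x y
    by (auto simp: hom_def)
  have "category J" by (rule category.intro) auto
  then have "finite_index_cat J"
    by (simp add: finite_index_cat_def)
  moreover define D where "D = \<lparr>Fobj = \<lambda>n::nat. if n = 0 then a else b,
    Fmap = \<lambda>n::nat. Id M (if n = 0 then a else b)\<rparr>"
  have [simp]: "Fobj D n = (if n = 0 then a else b)" "Fmap D n = Id M (if n = 0 then a else b)" for n
    by (auto simp: D_def)
  have "is_functor J M D"
    by (auto simp: is_functor_def id_in)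
  ultimately obtain s l where sl: "is_colimit J M D s l"
    using finite_colimits unfolding has_finite_colimits_def by blast
  have cocone: "is_cocone J M D c k \<longleftrightarrow> k 0 \<in> hom M a c \<and> k 1 \<in> hom M b c" for c k
    using hom_objs[of _ a c] comp_id_right[of _ a c] comp_id_right[of _ b c]
    by (auto simp: is_cocone_def)
  have ex1: "\<exists>!h. h \<in> hom M s c \<and> h \<cdot> l 0 = k 0 \<and> h \<cdot> l 1 = k 1" if "is_cocone J M D c k" for c k
    using sl that unfolding is_colimit_def by simp
  have l: "l 0 \<in> hom M a s" "l 1 \<in> hom M b s"
    using sl cocone unfolding is_colimit_def by blast+
  have 1: "\<exists>h \<in> hom M s c. h \<cdot> l 0 = f \<and> h \<cdot> l 1 = g" if "f \<in> hom M a c" "g \<in> hom M b c" for c f g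
    using ex1[of c "\<lambda>n. if n = 0 then f else g"] that by (auto simp: cocone)
  have 2: "h = k" if "h \<in> hom M s c" "k \<in> hom M s c" "h \<cdot> l 0 = k \<cdot> l 0" "h \<cdot> l 1 = k \<cdot> l 1" for c h k
  proof -
    have "is_cocone J M D c (\<lambda>n. k \<cdot> l n)"
      using comp_in[OF l(1) that(2)] comp_in[OF l(2) that(2)] by (simp add: cocone)
    from ex1[OF this] show ?thesis using that by blast
  qed
  show ?thesis
    using l 1 2 by blast
qed

section \<open>Cofibrations and cofibrant objects through lifting properties\<close>

lemma retract_argument:
  assumes "has_lifting M i p" "j \<in> Arr M" "p \<in> Arr M" "Cod M j = Dom M p" "i = p \<cdot> j"
  shows "is_retract M i j"
proof -
  have [simp]: "i \<in> Arr M" "Dom M i = Dom M j" "Cod M i = Cod M p" using assms by auto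
  \<comment> \<open>Lifting in the square with top \<open>j\<close> and bottom an identity produces
    a section \<open>h\<close> of \<open>p\<close>, and \<open>h\<close> together with
    \<open>p\<close> exhibits \<open>i\<close> as a retract of \<open>j\<close>.\<close>
  have "j \<in> hom M (Dom M i) (Dom M p)" "Id M (Cod M p) \<in> hom M (Cod M i) (Cod M p)"
    "p \<cdot> j = Id M (Cod M p) \<cdot> i"
    using assms(2-4) by (auto simp: hom_def assms(5))
  then obtain h where "h \<in> hom M (Cod M i) (Dom M p)" "h \<cdot> i = j" "p \<cdot> h = Id M (Cod M p)"
    using assms(1) unfolding has_lifting_def by blast
  then show ?thesis
    using assms(2-4)
    by (intro is_retractI[of _ _ _ "Id M (Dom M j)" "Id M (Dom M j)" h p]) (auto simp: hom_def assms(5))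
qed

text \<open>Recognizing cofibrations by lifting takes the place of stability under pushout:
  coproduct inclusions are treated through their lifting problems, and, in the opposite category, so
  are the images of fibrations under a right adjoint.\<close>

lemma cof_if_lifting:
  assumes "i \<in> Arr M" "\<And>p. p \<in> Fib M \<inter> Weq M \<Longrightarrow> has_lifting M i p"
  shows "i \<in> Cof M"
  using factor_acyclic_fib[OF assms(1)] retract_argument assms(2) cof_retract
  by (metis IntD1 cof_arr fib_arr)

lemma acyclic_cof_if_lifting:
  assumes "i \<in> Arr M" "\<And>p. p \<in> Fib M \<Longrightarrow> has_lifting M i p"
  shows "i \<in> Cof M \<inter> Weq M"
  using factor_acyclic_cof[OF assms(1)] retract_argument assms(2) cof_retract weq_retract
  by (metis IntE IntI cof_arr fib_arr)

lemma cofibrant_lift: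
  assumes "cofibrant M x" "p \<in> Fib M \<inter> Weq M" "g \<in> hom M x (Cod M p)"
  shows "\<exists>h \<in> hom M x (Dom M p). p \<cdot> h = g"
proof -
  obtain i f where i: "is_initial M i" and f: "f \<in> hom M i x" "f \<in> Cof M"
    using assms(1) unfolding cofibrant_def by blast
  have p: "p \<in> hom M (Dom M p) (Cod M p)" using assms(2) by (auto intro: in_homI)
  obtain u where u: "u \<in> hom M i (Dom M p)" using i hom_objs[OF p] unfolding is_initial_def by blast
  have "p \<cdot> u = g \<cdot> f"
    using i comp_in[OF u p] comp_in[OF f(1) assms(3)] hom_objs[OF p] unfolding is_initial_def by blast
  moreover have "Dom M f = i" "Cod M f = x" using f by (auto simp: hom_def)
  ultimately show ?thesis
    using lift_acyclic_fib[OF f(2) assms(2)] u assms(3) unfolding has_lifting_def by metis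
qed

text \<open>With an initial object in the corner, the square and the upper triangle of a lifting
  problem commute automatically, so only the lower triangle remains to be solved. The criterion
  makes it possible to show that \<open>F x\<close> is cofibrant without first showing that
  \<open>F\<close> preserves initial objects.\<close>

lemma cofibrantI:
  assumes "x \<in> Obj M"
    and "\<And>p g. p \<in> Fib M \<inter> Weq M \<Longrightarrow> g \<in> hom M x (Cod M p) \<Longrightarrow> \<exists>h \<in> hom M x (Dom M p). p \<cdot> h = g"
  shows "cofibrant M x"
proof -
  obtain i where i: "is_initial M i" using initial_exists ..
  then obtain f where f: "f \<in> hom M i x" using assms(1) unfolding is_initial_def by blast
  have "f \<in> Cof M"
  proof (rule cof_if_lifting)
    fix p assume p: "p \<in> Fib M \<inter> Weq M"
    show "has_lifting M f p"
      unfolding has_lifting_def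
    proof (intro ballI impI)
      fix u g assume u: "u \<in> hom M (Dom M f) (Dom M p)" and g: "g \<in> hom M (Cod M f) (Cod M p)"
      obtain h where h: "h \<in> hom M x (Dom M p)" "p \<cdot> h = g" using assms(2)[OF p, of g] f g by (auto simp: hom_def)
      have "h \<cdot> f = u"
        using i comp_in[OF f h(1)] u hom_objs[OF h(1)] f unfolding is_initial_def by (auto simp: hom_def)
      then show "\<exists>h \<in> hom M (Cod M f) (Dom M p). h \<cdot> f = u \<and> p \<cdot> h = g"
        using h f by (auto simp: hom_def)
    qed
  qed (use f in \<open>auto simp: hom_def\<close>)
  then show ?thesis unfolding cofibrant_def using i f assms(1) by blast
qed

lemma cofibrant_cof:
  assumes "f \<in> Cof M" "cofibrant M (Dom M f)"
  shows "cofibrant M (Cod M f)"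
proof -
  obtain i g where i: "is_initial M i" and g: "g \<in> hom M i (Dom M f)" "g \<in> Cof M"
    using assms(2) unfolding cofibrant_def by blast
  have "f \<cdot> g \<in> hom M i (Cod M f)" "f \<cdot> g \<in> Cof M"
    using g assms(1) by (auto simp: hom_def intro: cof_comp)
  then show ?thesis unfolding cofibrant_def using i assms(1) by auto
qed

lemma cofibrant_obj: "cofibrant M x \<Longrightarrow> x \<in> Obj M"
  by (simp add: cofibrant_def)

text \<open>Factor the arrow from an initial object. The replacement is an acyclic fibration and not
  merely a weak equivalence, because maps out of cofibrant objects have to lift through it.\<close>

lemma cofibrant_replacement_exists:
  assumes "x \<in> Obj M"
  shows "\<exists>q. q \<in> Fib M \<and> q \<in> Weq M \<and> Cod M q = x \<and> cofibrant M (Dom M q)"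
proof -
  obtain i where i: "is_initial M i" using initial_exists ..
  then obtain f where f: "f \<in> hom M i x" using assms unfolding is_initial_def by blast
  obtain j p where jp: "j \<in> Cof M" "p \<in> Fib M" "p \<in> Weq M" "Cod M j = Dom M p" "f = p \<cdot> j"
    using factor_acyclic_fib[OF arrI[OF f]] by auto
  then have "j \<in> hom M i (Dom M p)" "Cod M p = x"
    using f by (auto simp: hom_def)
  then have "cofibrant M (Dom M p)"
    unfolding cofibrant_def using i jp by auto
  then show ?thesis using jp \<open>Cod M p = x\<close> by blast
qed

text \<open>The inclusion is a pushout of the initial arrow to \<open>b\<close>. In terms of
  lifting: the solution is prescribed on \<open>a\<close>, cofibrancy of \<open>b\<close> supplies
  it on \<open>b\<close>, and the two are glued by the copairing.\<close>

lemma cof_coproduct_inclusion: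
  assumes i: "i \<in> hom M a s" and j: "j \<in> hom M b s" and "cofibrant M b"
    and ex: "\<And>c f g. f \<in> hom M a c \<Longrightarrow> g \<in> hom M b c \<Longrightarrow> \<exists>h \<in> hom M s c. h \<cdot> i = f \<and> h \<cdot> j = g"
    and uniq: "\<And>c h k. h \<in> hom M s c \<Longrightarrow> k \<in> hom M s c \<Longrightarrow> h \<cdot> i = k \<cdot> i \<Longrightarrow> h \<cdot> j = k \<cdot> j \<Longrightarrow> h = k"
  shows "i \<in> Cof M"
proof (rule cof_if_lifting)
  show "i \<in> Arr M" using i by (rule arrI)
  fix p assume p: "p \<in> Fib M \<inter> Weq M"
  then have p': "p \<in> hom M (Dom M p) (Cod M p)" by (auto intro: in_homI)
  have [simp]: "Dom M i = a" "Cod M i = s" using i by (auto simp: hom_def)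
  show "has_lifting M i p"
    unfolding has_lifting_def
  proof (intro ballI impI)
    fix f g assume f: "f \<in> hom M (Dom M i) (Dom M p)" and g: "g \<in> hom M (Cod M i) (Cod M p)"
      and fg: "p \<cdot> f = g \<cdot> i"
    have g': "g \<in> hom M s (Cod M p)" using g by simp
    obtain k where k: "k \<in> hom M b (Dom M p)" "p \<cdot> k = g \<cdot> j"
      using cofibrant_lift[OF assms(3) p comp_in[OF j g']] by blast
    obtain h where h: "h \<in> hom M s (Dom M p)" "h \<cdot> i = f" "h \<cdot> j = k"
      using ex[of f "Dom M p" k] f k by auto
    have "p \<cdot> h = g"
      using uniq[OF comp_in[OF h(1) p'] g'] comp_assoc[OF i h(1) p'] comp_assoc[OF j h(1) p'] h k fg by simp
    then show "\<exists>h \<in> hom M (Cod M i) (Dom M p). h \<cdot> i = f \<and> p \<cdot> h = g" using h by auto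
  qed
qed

text \<open>Both Ken Brown's lemma and the uniqueness of lifts up to homotopy only need this factorization
  of the pair of maps \<open>f, g\<close> out of cofibrant objects.\<close>

lemma mapping_cylinder:
  assumes a: "cofibrant M a" and b: "cofibrant M b" and f: "f \<in> hom M a c" and g: "g \<in> hom M b c"
  obtains s i j k p where "i \<in> hom M a s" "j \<in> hom M b s"
    "\<And>c f g. f \<in> hom M a c \<Longrightarrow> g \<in> hom M b c \<Longrightarrow> \<exists>h \<in> hom M s c. h \<cdot> i = f \<and> h \<cdot> j = g"
    "\<And>c h k. h \<in> hom M s c \<Longrightarrow> k \<in> hom M s c \<Longrightarrow> h \<cdot> i = k \<cdot> i \<Longrightarrow> h \<cdot> j = k \<cdot> j \<Longrightarrow> h = k"
    "k \<in> Cof M" "p \<in> Fib M" "p \<in> Weq M" "k \<in> hom M s (Dom M p)" "Cod M p = c"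
    "k \<cdot> i \<in> Cof M" "k \<cdot> j \<in> Cof M" "p \<cdot> (k \<cdot> i) = f" "p \<cdot> (k \<cdot> j) = g"
proof -
  obtain s i j where i: "i \<in> hom M a s" and j: "j \<in> hom M b s"
    and ex: "\<And>c f g. f \<in> hom M a c \<Longrightarrow> g \<in> hom M b c \<Longrightarrow> \<exists>h \<in> hom M s c. h \<cdot> i = f \<and> h \<cdot> j = g"
    and uniq: "\<And>c h k. h \<in> hom M s c \<Longrightarrow> k \<in> hom M s c \<Longrightarrow> h \<cdot> i = k \<cdot> i \<Longrightarrow> h \<cdot> j = k \<cdot> j \<Longrightarrow> h = k"
    using coproduct_exists[OF cofibrant_obj[OF a] cofibrant_obj[OF b]] by blast
  \<comment> \<open>The copairing of \<open>f\<close> and \<open>g\<close> is factored as a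
    cofibration followed by an acyclic fibration. For \<open>g\<close> an identity this gives the
    mapping cylinder of \<open>f\<close>, and for two identities a cylinder object.\<close>
  obtain h where h: "h \<in> hom M s c" "h \<cdot> i = f" "h \<cdot> j = g" using ex[OF f g] by blast
  obtain k p where kp: "k \<in> Cof M" "p \<in> Fib M" "p \<in> Weq M" "Cod M k = Dom M p" "h = p \<cdot> k"
    using factor_acyclic_fib[OF arrI[OF h(1)]] by auto
  then have k: "k \<in> hom M s (Dom M p)" "Cod M p = c" using h(1) by (auto simp: hom_def)
  have "i \<in> Cof M" by (rule cof_coproduct_inclusion[OF i j b ex uniq])
  moreover have "j \<in> Cof M"
    by (rule cof_coproduct_inclusion[OF j i a]) (use ex uniq in blast)+
  ultimately have kij: "k \<cdot> i \<in> Cof M" "k \<cdot> j \<in> Cof M"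
    using kp i j k by (auto intro!: cof_comp simp: hom_def)
  have pk: "p \<cdot> (k \<cdot> i) = f" "p \<cdot> (k \<cdot> j) = g"
    using h i j k kp by (auto simp: hom_def)
  show thesis
    by (rule that) (fact i j ex uniq kp(1-3) k kij pk)+
qed

end

section \<open>Functors that invert acyclic cofibrations\<close>

text \<open>The intended \<Phi> is a left Quillen functor followed by the projection to a homotopy
  category. The target is kept arbitrary so that an opposite category can be inserted when the
  right-hand case is derived by duality.\<close>

locale inverts_acyclic_cof = model_category M + E: category E
  for M :: "('o, 'm, 'z) model_cat_scheme" (structure) and E :: "('p, 'n, 'y) cat_scheme" +
  fixes \<Phi> :: "('o, 'm, 'p, 'n) ftor"
  assumes ftor: "is_functor M E \<Phi>"
    and inverts: "f \<in> Cof M \<Longrightarrow> f \<in> Weq M \<Longrightarrow> is_iso E (Fmap \<Phi> f)"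
begin

lemmas [simp] = functor_simps[OF ftor]

text \<open>In the cylinder factorization of \<open>f\<close> and the identity, two-out-of-three
  makes both inclusions acyclic cofibrations, hence inverted. Then \<open>p\<close> is inverted,
  since it becomes a left inverse of an isomorphism, and \<open>f\<close> is \<open>p\<close> after
  the other inclusion.\<close>

lemma ken_brown:
  assumes "f \<in> Weq M" "cofibrant M (Dom M f)" "cofibrant M (Cod M f)"
  shows "is_iso E (Fmap \<Phi> f)"
proof -
  let ?b = "Cod M f"
  have f: "f \<in> hom M (Dom M f) ?b" using assms by (auto intro: in_homI)
  have b: "Id M ?b \<in> hom M ?b ?b" using assms by (intro id_in) auto
  obtain s i j k p where *: "i \<in> hom M (Dom M f) s" "j \<in> hom M ?b s"
    "p \<in> Weq M" "k \<in> hom M s (Dom M p)" "Cod M p = ?b"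
    "k \<cdot> i \<in> Cof M" "k \<cdot> j \<in> Cof M" "p \<cdot> (k \<cdot> i) = f" "p \<cdot> (k \<cdot> j) = Id M ?b"
    by (rule mapping_cylinder[OF assms(2,3) f b]) blast
  then have [simp]: "p \<in> Arr M" "k \<cdot> i \<in> Arr M" "k \<cdot> j \<in> Arr M" "Cod M (k \<cdot> i) = Dom M p"
    "Cod M (k \<cdot> j) = Dom M p" "Dom M (k \<cdot> j) = ?b" "Dom M (k \<cdot> i) = Dom M f"
    by (auto simp: hom_def)
  have obj: "?b \<in> Obj M" using assms by simp
  have "k \<cdot> i \<in> Weq M" "k \<cdot> j \<in> Weq M"
    using weq_right_factor[of "k \<cdot> i" p] weq_right_factor[of "k \<cdot> j" p] * assms(1) weq_id[OF obj] by auto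
  then have ij: "is_iso E (Fmap \<Phi> (k \<cdot> i))" "is_iso E (Fmap \<Phi> (k \<cdot> j))"
    using * inverts by blast+
  have "Fmap \<Phi> p \<cdot>\<^bsub>E\<^esub> Fmap \<Phi> (k \<cdot> j) = Id E (Fobj \<Phi> ?b)"
    using *(9) obj by (simp flip: functor_simps(6)[OF ftor])
  then have "is_iso E (Fmap \<Phi> p)"
    using ij(2) obj by (intro E.is_iso_left_factor[of "Fmap \<Phi> p" "Fmap \<Phi> (k \<cdot> j)"]) (auto simp: E.is_iso_id)
  then have "is_iso E (Fmap \<Phi> p \<cdot>\<^bsub>E\<^esub> Fmap \<Phi> (k \<cdot> i))"
    using ij(1) by (intro E.is_iso_comp) auto
  moreover have "Fmap \<Phi> p \<cdot>\<^bsub>E\<^esub> Fmap \<Phi> (k \<cdot> i) = Fmap \<Phi> f"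
    using *(8) by (simp flip: functor_simps(6)[OF ftor])
  ultimately show ?thesis by simp
qed

text \<open>Two lifts of one map are left homotopic, because the constant homotopy below lifts
  through the acyclic fibration \<open>p\<close> with prescribed ends. A functor that inverts the
  projection \<sigma> of the cylinder cannot distinguish its two ends, and hence identifies the
  lifts.\<close>

lemma lifts_identified:
  assumes a: "cofibrant M a" and p: "p \<in> Fib M" "p \<in> Weq M"
    and f: "f \<in> hom M a (Dom M p)" and g: "g \<in> hom M a (Dom M p)" and fg: "p \<cdot> f = p \<cdot> g"
  shows "Fmap \<Phi> f = Fmap \<Phi> g"
proof -
  have p': "p \<in> hom M (Dom M p) (Cod M p)" using p by (auto intro: in_homI)
  have obj: "a \<in> Obj M" by (rule cofibrant_obj[OF a])
  have id: "Id M a \<in> hom M a a" by (rule id_in[OF obj])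
  obtain s i j k \<sigma> where i: "i \<in> hom M a s" and j: "j \<in> hom M a s"
    and ex: "\<And>c f g. f \<in> hom M a c \<Longrightarrow> g \<in> hom M a c \<Longrightarrow> \<exists>h \<in> hom M s c. h \<cdot> i = f \<and> h \<cdot> j = g"
    and uniq: "\<And>c h k. h \<in> hom M s c \<Longrightarrow> k \<in> hom M s c \<Longrightarrow> h \<cdot> i = k \<cdot> i \<Longrightarrow> h \<cdot> j = k \<cdot> j \<Longrightarrow> h = k"
    and k: "k \<in> Cof M" "k \<in> hom M s (Dom M \<sigma>)" and \<sigma>: "\<sigma> \<in> Weq M" "Cod M \<sigma> = a"
    and ki: "k \<cdot> i \<in> Cof M" "k \<cdot> j \<in> Cof M" "\<sigma> \<cdot> (k \<cdot> i) = Id M a" "\<sigma> \<cdot> (k \<cdot> j) = Id M a"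
    by (rule mapping_cylinder[OF a a id id]) blast
  \<comment> \<open>The cylinder is cofibrant as the codomain of a cofibration out of
    \<open>a\<close>. This is what allows Ken Brown's lemma to be applied to \<sigma>.\<close>
  have cyl: "cofibrant M (Dom M \<sigma>)"
    using cofibrant_cof[OF ki(1)] i k a by (auto simp: hom_def)
  have [simp]: "\<sigma> \<in> Arr M" "k \<in> Arr M" "Dom M k = s" "Cod M k = Dom M \<sigma>" "i \<in> Arr M" "j \<in> Arr M"
    "Dom M i = a" "Dom M j = a" "Cod M i = s" "Cod M j = s" "Cod M \<sigma> = a"
    using \<sigma> k i j by (auto simp: hom_def)
  have [simp]: "p \<in> Arr M" "f \<in> Arr M" "Dom M f = a" "Cod M f = Dom M p" "g \<in> Arr M" "Dom M g = a" "Cod M g = Dom M p"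
    using p f g by (auto simp: hom_def)
  obtain h where h: "h \<in> hom M s (Dom M p)" "h \<cdot> i = f" "h \<cdot> j = g" using ex[OF f g] by blast
  then have [simp]: "h \<in> Arr M" "Dom M h = s" "Cod M h = Dom M p" by (auto simp: hom_def)
  \<comment> \<open>The lifting square for the homotopy \<open>H\<close>: the copairing
    \<open>h\<close> of the two lifts on top, the constant homotopy through \<sigma> below. Its
    commutativity is tested on the two summands.\<close>
  have "p \<cdot> h = (p \<cdot> (f \<cdot> \<sigma>)) \<cdot> k"
  proof (rule uniq)
    have "(p \<cdot> (f \<cdot> \<sigma>)) \<cdot> k \<cdot> i = (p \<cdot> f) \<cdot> (\<sigma> \<cdot> (k \<cdot> i))" by simp
    then show "(p \<cdot> h) \<cdot> i = ((p \<cdot> (f \<cdot> \<sigma>)) \<cdot> k) \<cdot> i" using obj by (simp add: ki h)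
    have "(p \<cdot> (f \<cdot> \<sigma>)) \<cdot> k \<cdot> j = (p \<cdot> f) \<cdot> (\<sigma> \<cdot> (k \<cdot> j))" by simp
    then show "(p \<cdot> h) \<cdot> j = ((p \<cdot> (f \<cdot> \<sigma>)) \<cdot> k) \<cdot> j" using obj by (simp add: ki h fg)
  qed (auto simp: hom_def)
  moreover have "h \<in> hom M (Dom M k) (Dom M p)" "p \<cdot> (f \<cdot> \<sigma>) \<in> hom M (Cod M k) (Cod M p)"
    by (simp_all add: hom_def)
  moreover have "has_lifting M k p" using lift_acyclic_fib[OF k(1)] p by blast
  ultimately obtain H where H: "H \<in> hom M (Cod M k) (Dom M p)" "H \<cdot> k = h"
    unfolding has_lifting_def by blast
  then have [simp]: "H \<in> Arr M" "Dom M H = Dom M \<sigma>" "Cod M H = Dom M p" by (auto simp: hom_def)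
  have iso: "is_iso E (Fmap \<Phi> \<sigma>)" using ken_brown[OF \<sigma>(1)] cyl a by simp
  \<comment> \<open>Both ends are sections of \<sigma>, which becomes invertible under
    \<Phi>.\<close>
  have "Fmap \<Phi> (k \<cdot> i) = Fmap \<Phi> (k \<cdot> j)"
  proof (rule E.iso_cancel_left[OF iso])
    have "Fmap \<Phi> \<sigma> \<cdot>\<^bsub>E\<^esub> Fmap \<Phi> (k \<cdot> i) = Fmap \<Phi> (\<sigma> \<cdot> (k \<cdot> i))"
      "Fmap \<Phi> \<sigma> \<cdot>\<^bsub>E\<^esub> Fmap \<Phi> (k \<cdot> j) = Fmap \<Phi> (\<sigma> \<cdot> (k \<cdot> j))" by simp_all
    then show "Fmap \<Phi> \<sigma> \<cdot>\<^bsub>E\<^esub> Fmap \<Phi> (k \<cdot> i) = Fmap \<Phi> \<sigma> \<cdot>\<^bsub>E\<^esub> Fmap \<Phi> (k \<cdot> j)" by (simp only: ki)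
  qed simp_all
  moreover have "f = H \<cdot> (k \<cdot> i)" "g = H \<cdot> (k \<cdot> j)"
    using h H(2) by (simp_all flip: assoc)
  ultimately show ?thesis by simp
qed

end

section \<open>Derived functors before localization\<close>

definition inverts_weq ::
  "('o, 'm, 'y) model_cat_scheme \<Rightarrow> ('p, 'n, 'z) cat_scheme \<Rightarrow> ('o, 'm, 'p, 'n) ftor \<Rightarrow> bool" where
  "inverts_weq M E A \<longleftrightarrow> is_functor M E A \<and> (\<forall>w \<in> Weq M. is_iso E (Fmap A w))"

text \<open>\<open>A\<close> plays the role of the left derived functor of \<open>\<Phi>\<close>, precomposed with the projection to the
  homotopy category. At this level the notion can be dualized by passing to opposite categories.\<close>

definition left_approx ::
  "('o, 'm, 'y) model_cat_scheme \<Rightarrow> ('p, 'n, 'z) cat_scheme \<Rightarrow> ('o, 'm, 'p, 'n) ftor \<Rightarrow>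
   ('o, 'm, 'p, 'n) ftor \<Rightarrow> ('o \<Rightarrow> 'n) \<Rightarrow> bool" where
  "left_approx M E \<Phi> A t \<longleftrightarrow> inverts_weq M E A \<and> nat_trans M E A \<Phi> t \<and>
     (\<forall>x. cofibrant M x \<longrightarrow> is_iso E (t x))"

definition right_approx ::
  "('o, 'm, 'y) model_cat_scheme \<Rightarrow> ('p, 'n, 'z) cat_scheme \<Rightarrow> ('o, 'm, 'p, 'n) ftor \<Rightarrow>
   ('o, 'm, 'p, 'n) ftor \<Rightarrow> ('o \<Rightarrow> 'n) \<Rightarrow> bool" where
  "right_approx M E \<Phi> A t \<longleftrightarrow> inverts_weq M E A \<and> nat_trans M E \<Phi> A t \<and>
     (\<forall>x. fibrant M x \<longrightarrow> is_iso E (t x))"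

lemma inverts_weq_op [simp]: "inverts_weq (opm M) (opc E) A \<longleftrightarrow> inverts_weq M E A"
  by (simp add: inverts_weq_def is_functor_opm)

lemma left_approx_op: "left_approx (opm M) (opc E) \<Phi> A t \<longleftrightarrow> right_approx M E \<Phi> A t"
  by (simp add: left_approx_def right_approx_def nat_trans_opm)

section \<open>Chosen cofibrant replacements and approximations of functors\<close>

context model_category
begin

definition cofrep :: "'o \<Rightarrow> 'm" where
  "cofrep x = (SOME q. q \<in> Fib M \<and> q \<in> Weq M \<and> Cod M q = x \<and> cofibrant M (Dom M q))"

lemma cofrep:
  assumes "x \<in> Obj M"
  shows "cofrep x \<in> Fib M" "cofrep x \<in> Weq M" "Cod M (cofrep x) = x" "cofibrant M (Dom M (cofrep x))"
  using someI_ex[OF cofibrant_replacement_exists[OF assms], folded cofrep_def] by auto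

definition cofrep_map :: "'m \<Rightarrow> 'm" where
  "cofrep_map f = (SOME h. h \<in> hom M (Dom M (cofrep (Dom M f))) (Dom M (cofrep (Cod M f))) \<and>
     cofrep (Cod M f) \<cdot> h = f \<cdot> cofrep (Dom M f))"

lemma cofrep_map:
  assumes "f \<in> Arr M"
  shows "cofrep_map f \<in> hom M (Dom M (cofrep (Dom M f))) (Dom M (cofrep (Cod M f)))"
    "cofrep (Cod M f) \<cdot> cofrep_map f = f \<cdot> cofrep (Dom M f)"
proof -
  have "\<exists>h \<in> hom M (Dom M (cofrep (Dom M f))) (Dom M (cofrep (Cod M f))).
      cofrep (Cod M f) \<cdot> h = f \<cdot> cofrep (Dom M f)"
    using assms cofrep[of "Dom M f"] cofrep[of "Cod M f"]
    by (intro cofibrant_lift) (auto simp: hom_def)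
  then show "cofrep_map f \<in> hom M (Dom M (cofrep (Dom M f))) (Dom M (cofrep (Cod M f)))"
    "cofrep (Cod M f) \<cdot> cofrep_map f = f \<cdot> cofrep (Dom M f)"
    using someI_ex[of "\<lambda>h. h \<in> hom M (Dom M (cofrep (Dom M f))) (Dom M (cofrep (Cod M f))) \<and>
     cofrep (Cod M f) \<cdot> h = f \<cdot> cofrep (Dom M f)", folded cofrep_map_def] by blast+
qed

lemma cofrep_simps [simp]:
  "x \<in> Obj M \<Longrightarrow> cofrep x \<in> Arr M"
  "x \<in> Obj M \<Longrightarrow> Cod M (cofrep x) = x"
  "f \<in> Arr M \<Longrightarrow> cofrep_map f \<in> Arr M"
  "f \<in> Arr M \<Longrightarrow> Dom M (cofrep_map f) = Dom M (cofrep (Dom M f))"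
  "f \<in> Arr M \<Longrightarrow> Cod M (cofrep_map f) = Dom M (cofrep (Cod M f))"
  using cofrep_map(1) cofrep by (auto simp: hom_def)

end

lemma (in inverts_acyclic_cof) left_approx_exists: "\<exists>A t. left_approx M E \<Phi> A t"
proof -
  define A where "A = \<lparr>Fobj = \<lambda>x. Fobj \<Phi> (Dom M (cofrep x)), Fmap = \<lambda>f. Fmap \<Phi> (cofrep_map f)\<rparr>"
  have [simp]: "Fobj A x = Fobj \<Phi> (Dom M (cofrep x))" "Fmap A f = Fmap \<Phi> (cofrep_map f)" for x f
    by (simp_all add: A_def)
  \<comment> \<open>Under \<Phi>, maps between replacements may be compared after composing with
    \<open>cofrep y\<close>. Both functor laws for \<open>A\<close> reduce to this, since the chosen
    lifts respect identities and composites only up to homotopy.\<close>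
  have ident: "Fmap \<Phi> h = Fmap \<Phi> k"
    if "x \<in> Obj M" "y \<in> Obj M" "h \<in> hom M (Dom M (cofrep x)) (Dom M (cofrep y))"
      "k \<in> hom M (Dom M (cofrep x)) (Dom M (cofrep y))" "cofrep y \<cdot> h = cofrep y \<cdot> k" for x y h k
    using that cofrep by (intro lifts_identified[of "Dom M (cofrep x)" "cofrep y"]) auto
  have A: "is_functor M E A"
  proof (rule is_functorI)
    fix x assume [simp]: "x \<in> Obj M"
    have "Fmap \<Phi> (cofrep_map (Id M x)) = Fmap \<Phi> (Id M (Dom M (cofrep x)))"
      using cofrep_map(2)[of "Id M x"] by (intro ident[of x x]) (auto simp: hom_def)
    then show "Fmap A (Id M x) = Id E (Fobj A x)" by simp
  next
    fix f g assume [simp]: "f \<in> Arr M" "g \<in> Arr M" "Cod M f = Dom M g"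
    have "cofrep (Cod M g) \<cdot> (cofrep_map g \<cdot> cofrep_map f) = (cofrep (Cod M g) \<cdot> cofrep_map g) \<cdot> cofrep_map f"
      by simp
    also have "\<dots> = g \<cdot> (cofrep (Cod M f) \<cdot> cofrep_map f)"
      by (subst cofrep_map(2)) simp_all
    also have "\<dots> = cofrep (Cod M g) \<cdot> cofrep_map (g \<cdot> f)"
      using cofrep_map(2)[of f] cofrep_map(2)[of "g \<cdot> f"] by simp
    finally have "Fmap \<Phi> (cofrep_map (g \<cdot> f)) = Fmap \<Phi> (cofrep_map g \<cdot> cofrep_map f)"
      by (intro ident[of "Dom M f" "Cod M g"]) (auto simp: hom_def)
    then show "Fmap A (g \<cdot> f) = Fmap A g \<cdot>\<^bsub>E\<^esub> Fmap A f" by simp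
  qed (auto simp: hom_def)
  moreover have "is_iso E (Fmap A w)" if w: "w \<in> Weq M" for w
  proof -
    have "cofrep (Cod M w) \<cdot> cofrep_map w \<in> Weq M"
      using w cofrep by (auto simp: cofrep_map(2) intro: weq_comp)
    then have "cofrep_map w \<in> Weq M"
      using w cofrep by (auto intro: weq_right_factor[of _ "cofrep (Cod M w)"])
    then show ?thesis using ken_brown[of "cofrep_map w"] w cofrep by simp
  qed
  moreover have "nat_trans M E A \<Phi> (\<lambda>x. Fmap \<Phi> (cofrep x))"
    by (rule nat_transI) (use A ftor cofrep_map(2) in \<open>auto simp: hom_def simp flip: functor_simps(6)[OF ftor]\<close>)
  moreover have "is_iso E (Fmap \<Phi> (cofrep x))" if "cofibrant M x" for x
    using that cofibrant_obj[OF that] cofrep by (intro ken_brown) auto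
  ultimately show ?thesis unfolding left_approx_def inverts_weq_def by blast
qed

text \<open>The extension is \<open>B q \<cdot> \<eta> (Q x) \<cdot> (A q)\<^sup>-\<^sup>1\<close> for a cofibrant replacement \<open>q : Q x \<rightarrow> x\<close>.\<close>

lemma (in model_category) extend_from_cofibrant:
  assumes "category E" "inverts_weq M E A" "is_functor M E B"
    and \<eta>: "\<And>x. cofibrant M x \<Longrightarrow> \<eta> x \<in> hom E (Fobj A x) (Fobj B x)"
    and nat: "\<And>f. f \<in> Arr M \<Longrightarrow> cofibrant M (Dom M f) \<Longrightarrow> cofibrant M (Cod M f) \<Longrightarrow>
      \<eta> (Cod M f) \<cdot>\<^bsub>E\<^esub> Fmap A f = Fmap B f \<cdot>\<^bsub>E\<^esub> \<eta> (Dom M f)"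
  shows "\<exists>\<eta>'. nat_trans M E A B \<eta>' \<and> (\<forall>x. cofibrant M x \<longrightarrow> \<eta>' x = \<eta> x)"
proof -
  interpret E: category E by fact
  have A: "is_functor M E A" using assms by (simp add: inverts_weq_def)
  note [simp] = functor_simps[OF A] functor_simps[OF assms(3)]
  have iso [simp]: "is_iso E (Fmap A (cofrep x))" if "x \<in> Obj M" for x
    using assms(2) cofrep that by (simp add: inverts_weq_def)
  have [simp]: "\<eta> x \<in> Arr E" "Dom E (\<eta> x) = Fobj A x" "Cod E (\<eta> x) = Fobj B x" if "cofibrant M x" for x
    using \<eta>[OF that] by (auto simp: hom_def)
  note [simp] = cofrep(4)
  define \<eta>' where "\<eta>' x = Fmap B (cofrep x) \<cdot>\<^bsub>E\<^esub> (\<eta> (Dom M (cofrep x)) \<cdot>\<^bsub>E\<^esub> inv_arr E (Fmap A (cofrep x)))" for x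
  have [simp]: "\<eta>' x \<in> Arr E" "Dom E (\<eta>' x) = Fobj A x" "Cod E (\<eta>' x) = Fobj B x" if "x \<in> Obj M" for x
    using that by (simp_all add: \<eta>'_def)
  have \<eta>'q: "\<eta>' x \<cdot>\<^bsub>E\<^esub> Fmap A (cofrep x) = Fmap B (cofrep x) \<cdot>\<^bsub>E\<^esub> \<eta> (Dom M (cofrep x))"
    if "x \<in> Obj M" for x
    using that by (simp add: \<eta>'_def)
  have "nat_trans M E A B \<eta>'"
  proof (rule nat_transI[OF A assms(3)])
    fix f assume f [simp]: "f \<in> Arr M"
    let ?p = "cofrep (Dom M f)" and ?q = "cofrep (Cod M f)"
    \<comment> \<open>Precomposition with the invertible \<open>Fmap A ?p\<close> moves the square
      for \<open>f\<close> to the square for the lifted map between replacements, where the given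
      naturality applies.\<close>
    show "\<eta>' (Cod M f) \<cdot>\<^bsub>E\<^esub> Fmap A f = Fmap B f \<cdot>\<^bsub>E\<^esub> \<eta>' (Dom M f)"
    proof (rule E.iso_cancel_right[OF iso[of "Dom M f"]])
      have "(\<eta>' (Cod M f) \<cdot>\<^bsub>E\<^esub> Fmap A f) \<cdot>\<^bsub>E\<^esub> Fmap A ?p = \<eta>' (Cod M f) \<cdot>\<^bsub>E\<^esub> Fmap A (f \<cdot> ?p)"
        by simp
      also have "\<dots> = (\<eta>' (Cod M f) \<cdot>\<^bsub>E\<^esub> Fmap A ?q) \<cdot>\<^bsub>E\<^esub> Fmap A (cofrep_map f)"
        by (simp flip: cofrep_map(2))
      also have "\<dots> = Fmap B ?q \<cdot>\<^bsub>E\<^esub> (\<eta> (Cod M (cofrep_map f)) \<cdot>\<^bsub>E\<^esub> Fmap A (cofrep_map f))"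
        by (simp add: \<eta>'q)
      also have "\<dots> = Fmap B (?q \<cdot> cofrep_map f) \<cdot>\<^bsub>E\<^esub> \<eta> (Dom M ?p)"
        by (subst nat) simp_all
      also have "\<dots> = Fmap B f \<cdot>\<^bsub>E\<^esub> (\<eta>' (Dom M f) \<cdot>\<^bsub>E\<^esub> Fmap A ?p)"
        by (simp add: cofrep_map(2) \<eta>'q)
      finally show "(\<eta>' (Cod M f) \<cdot>\<^bsub>E\<^esub> Fmap A f) \<cdot>\<^bsub>E\<^esub> Fmap A ?p =
          (Fmap B f \<cdot>\<^bsub>E\<^esub> \<eta>' (Dom M f)) \<cdot>\<^bsub>E\<^esub> Fmap A ?p"
        by simp
    qed simp_all
  qed (simp add: hom_def)
  \<comment> \<open>For cofibrant \<open>x\<close> the replacement \<open>cofrep x\<close> is itself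
    an arrow between cofibrant objects, so the given naturality at this arrow shows that nothing has
    been changed.\<close>
  moreover have "\<eta>' x = \<eta> x" if x [simp]: "cofibrant M x" for x
  proof (rule E.iso_cancel_right[OF iso])
    show [simp]: "x \<in> Obj M" by (rule cofibrant_obj[OF x])
    show "\<eta>' x \<cdot>\<^bsub>E\<^esub> Fmap A (cofrep x) = \<eta> x \<cdot>\<^bsub>E\<^esub> Fmap A (cofrep x)"
      using nat[of "cofrep x"] by (simp add: \<eta>'q)
  qed (simp_all add: cofibrant_obj)
  ultimately show ?thesis by blast
qed

text \<open>Naturality at a cofibrant replacement determines the component at \<open>x\<close>,
  because \<open>A\<close> inverts the replacement. The condition concerns the source, so
  \<open>B\<close> may be the functor \<Phi> being derived.\<close>

lemma (in model_category) eq_if_eq_on_cofibrant: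
  assumes "category E" "inverts_weq M E A" "nat_trans M E A B \<eta>" "nat_trans M E A B \<mu>"
    and eq: "\<And>x. cofibrant M x \<Longrightarrow> \<eta> x = \<mu> x" and [simp]: "x \<in> Obj M"
  shows "\<eta> x = \<mu> x"
proof -
  interpret E: category E by fact
  note [simp] = nat_trans_simps[OF assms(3)] nat_trans_simps[OF assms(4)]
    functor_simps[OF nat_trans_functor(1)[OF assms(3)]]
  have "is_iso E (Fmap A (cofrep x))"
    using assms(2) cofrep[of x] by (simp add: inverts_weq_def)
  then show ?thesis
  proof (rule E.iso_cancel_right)
    show "\<eta> x \<cdot>\<^bsub>E\<^esub> Fmap A (cofrep x) = \<mu> x \<cdot>\<^bsub>E\<^esub> Fmap A (cofrep x)"
      by (simp add: nat_trans_natural[OF assms(3) _ refl] nat_trans_natural[OF assms(4) _ refl]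
        eq cofrep)
  qed simp_all
qed

lemma (in model_category) iso_if_iso_on_cofibrant:
  assumes "category E" "inverts_weq M E A" "inverts_weq M E B" "nat_trans M E A B \<eta>"
    and iso: "\<And>x. cofibrant M x \<Longrightarrow> is_iso E (\<eta> x)" and [simp]: "x \<in> Obj M"
  shows "is_iso E (\<eta> x)"
proof -
  interpret E: category E by fact
  note [simp] = nat_trans_simps[OF assms(4)]
    functor_simps[OF nat_trans_functor(1)[OF assms(4)]] functor_simps[OF nat_trans_functor(2)[OF assms(4)]]
  have q: "is_iso E (Fmap A (cofrep x))" "is_iso E (Fmap B (cofrep x))"
    using assms(2,3) cofrep[of x] by (simp_all add: inverts_weq_def)
  have "\<eta> x \<cdot>\<^bsub>E\<^esub> Fmap A (cofrep x) = Fmap B (cofrep x) \<cdot>\<^bsub>E\<^esub> \<eta> (Dom M (cofrep x))"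
    by (rule nat_trans_natural[OF assms(4)]) simp_all
  moreover have "is_iso E (Fmap B (cofrep x) \<cdot>\<^bsub>E\<^esub> \<eta> (Dom M (cofrep x)))"
    by (rule E.is_iso_comp[OF iso q(2)]) (simp_all add: cofrep)
  ultimately have "is_iso E (\<eta> x \<cdot>\<^bsub>E\<^esub> Fmap A (cofrep x))" by (simp only:)
  then show ?thesis by (rule E.is_iso_left_factor[OF _ q(1)]) simp_all
qed

text \<open>At cofibrant objects \<open>t\<close> is invertible, so the component of
  \<open>r\<close> there can only be the inverse of \<open>t\<close> followed after
  \<open>s\<close>. The extension to all objects satisfies the required equation because both sides
  are transformations out of \<open>G\<close>, which inverts weak equivalences.\<close>

lemma (in model_category) left_approx_universal:
  assumes "category E" "left_approx M E \<Phi> A t" "inverts_weq M E G" "nat_trans M E G \<Phi> s"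
  shows "\<exists>r. nat_trans M E G A r \<and> (\<forall>x \<in> Obj M. t x \<cdot>\<^bsub>E\<^esub> r x = s x)"
proof -
  interpret E: category E by fact
  have t: "nat_trans M E A \<Phi> t" and iso: "\<And>x. cofibrant M x \<Longrightarrow> is_iso E (t x)"
    and A: "is_functor M E A"
    using assms(2) by (auto simp: left_approx_def inverts_weq_def)
  note [simp] = nat_trans_simps[OF t] nat_trans_simps[OF assms(4)] functor_simps[OF A]
    functor_simps[OF nat_trans_functor(1)[OF assms(4)]] functor_simps[OF nat_trans_functor(2)[OF t]]
    iso cofibrant_obj
  have "\<exists>r. nat_trans M E G A r \<and> (\<forall>x. cofibrant M x \<longrightarrow> r x = inv_arr E (t x) \<cdot>\<^bsub>E\<^esub> s x)"
  proof (rule extend_from_cofibrant[OF assms(1,3) A])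
    fix f assume f [simp]: "f \<in> Arr M" and [simp]: "cofibrant M (Dom M f)" "cofibrant M (Cod M f)"
    show "(inv_arr E (t (Cod M f)) \<cdot>\<^bsub>E\<^esub> s (Cod M f)) \<cdot>\<^bsub>E\<^esub> Fmap G f =
        Fmap A f \<cdot>\<^bsub>E\<^esub> (inv_arr E (t (Dom M f)) \<cdot>\<^bsub>E\<^esub> s (Dom M f))"
    proof (rule E.iso_cancel_left[OF iso])
      show "t (Cod M f) \<cdot>\<^bsub>E\<^esub> ((inv_arr E (t (Cod M f)) \<cdot>\<^bsub>E\<^esub> s (Cod M f)) \<cdot>\<^bsub>E\<^esub> Fmap G f) =
          t (Cod M f) \<cdot>\<^bsub>E\<^esub> (Fmap A f \<cdot>\<^bsub>E\<^esub> (inv_arr E (t (Dom M f)) \<cdot>\<^bsub>E\<^esub> s (Dom M f)))"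
        by (simp add: nat_trans_natural[OF assms(4) f] nat_trans_natural_assoc[OF _ assms(1) t f]
          category_axioms)
    qed simp_all
  qed (simp add: hom_def)
  then obtain r where r: "nat_trans M E G A r" "\<And>x. cofibrant M x \<Longrightarrow> r x = inv_arr E (t x) \<cdot>\<^bsub>E\<^esub> s x"
    by blast
  have "t x \<cdot>\<^bsub>E\<^esub> r x = s x" if "x \<in> Obj M" for x
    by (rule eq_if_eq_on_cofibrant[OF assms(1,3) nat_trans_comp[OF category_axioms assms(1) r(1) t] assms(4) _ that])
      (simp add: r(2))
  then show ?thesis using r(1) by blast
qed

lemma (in model_category) left_approx_unique:
  assumes "category E" "left_approx M E \<Phi> A t" "inverts_weq M E G"
    and "nat_trans M E G A r" "nat_trans M E G A r'"
    and eq: "\<And>x. x \<in> Obj M \<Longrightarrow> t x \<cdot>\<^bsub>E\<^esub> r x = t x \<cdot>\<^bsub>E\<^esub> r' x" and "x \<in> Obj M"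
  shows "r x = r' x"
proof (rule eq_if_eq_on_cofibrant[OF assms(1,3-5) _ assms(7)])
  fix x assume x: "cofibrant M x"
  then have [simp]: "x \<in> Obj M" by (rule cofibrant_obj)
  have t: "nat_trans M E A \<Phi> t" "is_iso E (t x)" using assms(2) x by (auto simp: left_approx_def)
  show "r x = r' x"
    by (rule category.iso_cancel_left[OF assms(1) t(2) eq])
      (simp_all add: nat_trans_simps[OF t(1)] nat_trans_simps[OF assms(4)] nat_trans_simps[OF assms(5)])
qed

text \<open>The transformation \<tau> induces a map of approximations through the universal property
  of \<open>B\<close>. At cofibrant objects the other three sides of the comparison square are
  invertible, which is why a weak equivalence on cofibrant objects suffices in (a) and (c).\<close>

lemma (in model_category) left_approx_compare:
  assumes "category E" "left_approx M E \<Phi> A t" "left_approx M E \<Psi> B u"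
    and \<tau>: "nat_trans M E \<Phi> \<Psi> \<tau>" "\<And>x. cofibrant M x \<Longrightarrow> is_iso E (\<tau> x)"
  shows "nat_isomorphic M E A B"
proof -
  interpret E: category E by fact
  have t: "nat_trans M E A \<Phi> t" "inverts_weq M E A" "\<And>x. cofibrant M x \<Longrightarrow> is_iso E (t x)"
    using assms(2) by (auto simp: left_approx_def)
  have u: "nat_trans M E B \<Psi> u" "inverts_weq M E B" "\<And>x. cofibrant M x \<Longrightarrow> is_iso E (u x)"
    using assms(3) by (auto simp: left_approx_def)
  obtain r where r: "nat_trans M E A B r" "\<And>x. x \<in> Obj M \<Longrightarrow> u x \<cdot>\<^bsub>E\<^esub> r x = \<tau> x \<cdot>\<^bsub>E\<^esub> t x"
    using left_approx_universal[OF assms(1,3) t(2) nat_trans_comp[OF category_axioms assms(1) t(1) \<tau>(1)]]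
    by blast
  have "is_iso E (r x)" if x: "cofibrant M x" for x
  proof -
    note [simp] = cofibrant_obj[OF x] nat_trans_simps[OF t(1)] nat_trans_simps[OF u(1)]
      nat_trans_simps[OF r(1)] nat_trans_simps[OF \<tau>(1)]
    have "is_iso E (\<tau> x \<cdot>\<^bsub>E\<^esub> t x)" by (rule E.is_iso_comp) (simp_all add: t \<tau> x)
    then have "is_iso E (u x \<cdot>\<^bsub>E\<^esub> r x)" by (simp add: r(2))
    then show ?thesis by (rule E.is_iso_right_factor[OF _ u(3)[OF x]]) simp_all
  qed
  then show ?thesis
    unfolding nat_isomorphic_def
    using r(1) iso_if_iso_on_cofibrant[OF assms(1) t(2) u(2) r(1)] by blast
qed

section \<open>Dual statements at fibrant objects\<close>

context model_category
begin

lemma opposite: "model_category (opm M)"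
  by (rule model_category_opm) unfold_locales

lemma fibrant_replacement_exists:
  assumes "x \<in> Obj M"
  shows "\<exists>j. j \<in> Weq M \<and> Dom M j = x \<and> fibrant M (Cod M j)"
  using model_category.cofibrant_replacement_exists[OF opposite, of x] assms by auto

text \<open>Dualizing reverses the transformation, so \<open>A\<close> and \<open>B\<close> change
  places and the condition of inverting weak equivalences moves to the target.\<close>

lemma eq_if_eq_on_fibrant:
  assumes "category E" "inverts_weq M E B" "nat_trans M E A B \<eta>" "nat_trans M E A B \<mu>"
    and "\<And>x. fibrant M x \<Longrightarrow> \<eta> x = \<mu> x" and "x \<in> Obj M"
  shows "\<eta> x = \<mu> x"
  using model_category.eq_if_eq_on_cofibrant[OF opposite, of "opc E" B A \<eta> \<mu> x] assms
  by (simp add: nat_trans_opm)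

lemma iso_if_iso_on_fibrant:
  assumes "category E" "inverts_weq M E A" "inverts_weq M E B" "nat_trans M E A B \<eta>"
    and "\<And>x. fibrant M x \<Longrightarrow> is_iso E (\<eta> x)" and "x \<in> Obj M"
  shows "is_iso E (\<eta> x)"
  using model_category.iso_if_iso_on_cofibrant[OF opposite, of "opc E" B A \<eta> x] assms
  by (simp add: nat_trans_opm)

lemma right_approx_universal:
  assumes "category E" "right_approx M E \<Phi> A t" "inverts_weq M E G" "nat_trans M E \<Phi> G s"
  shows "\<exists>r. nat_trans M E A G r \<and> (\<forall>x \<in> Obj M. r x \<cdot>\<^bsub>E\<^esub> t x = s x)"
  using model_category.left_approx_universal[OF opposite, of "opc E" \<Phi> A t G s] assms
  by (simp add: nat_trans_opm left_approx_op)

lemma right_approx_unique: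
  assumes "category E" "right_approx M E \<Phi> A t" "inverts_weq M E G"
    and "nat_trans M E A G r" "nat_trans M E A G r'"
    and "\<And>x. x \<in> Obj M \<Longrightarrow> r x \<cdot>\<^bsub>E\<^esub> t x = r' x \<cdot>\<^bsub>E\<^esub> t x" and "x \<in> Obj M"
  shows "r x = r' x"
  using model_category.left_approx_unique[OF opposite, of "opc E" \<Phi> A t G r r' x] assms
  by (simp add: nat_trans_opm left_approx_op)

lemma right_approx_compare:
  assumes "category E" "right_approx M E \<Phi> A t" "right_approx M E \<Psi> B u"
    and "nat_trans M E \<Phi> \<Psi> \<tau>" "\<And>x. fibrant M x \<Longrightarrow> is_iso E (\<tau> x)"
  shows "nat_isomorphic M E A B"
proof -
  have "nat_isomorphic (opm M) (opc E) B A"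
    using model_category.left_approx_compare[OF opposite, of "opc E" \<Psi> B u \<Phi> A t \<tau>] assms
    by (simp add: nat_trans_opm left_approx_op)
  then show ?thesis by (simp add: nat_isomorphic_def nat_trans_opm)
qed

lemma right_approx_exists:
  assumes "category E" "is_functor M E \<Phi>"
    and "\<And>f. f \<in> Fib M \<Longrightarrow> f \<in> Weq M \<Longrightarrow> is_iso E (Fmap \<Phi> f)"
  shows "\<exists>A t. right_approx M E \<Phi> A t"
proof -
  have "inverts_acyclic_cof (opm M) (opc E) \<Phi>"
    using assms
    by (intro inverts_acyclic_cof.intro opposite inverts_acyclic_cof_axioms.intro)
      (simp_all add: is_functor_opm)
  from inverts_acyclic_cof.left_approx_exists[OF this] show ?thesis by (simp add: left_approx_op)
qed

end

section \<open>The homotopy category\<close>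

lemma zigzag_simps [simp]:
  "zigzag M x [] y \<longleftrightarrow> x = y \<and> x \<in> Obj M"
  "zigzag M x (Fwd f # p) y \<longleftrightarrow> f \<in> Arr M \<and> x = Dom M f \<and> zigzag M (Cod M f) p y"
  "zigzag M x (Bwd f # p) y \<longleftrightarrow> f \<in> Weq M \<and> x = Cod M f \<and> zigzag M (Dom M f) p y"
  by (auto elim: zigzag.cases intro: zigzag.intros)

lemma zigzag_append:
  "zigzag M x p y \<Longrightarrow> zigzag M y q z \<Longrightarrow> zigzag M x (p @ q) z"
  by (induction rule: zigzag.induct) auto

lemma zigzag_target_unique: "zigzag M x p y \<Longrightarrow> zigzag M x p y' \<Longrightarrow> y = y'"
  by (induction rule: zigzag.induct) auto

lemma zigzag_source_unique: "zigzag M x p y \<Longrightarrow> zigzag M x' p y \<Longrightarrow> x = x'"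
  by (induction rule: zigzag.induct) auto

section \<open>The localization as a category, and transformations on it\<close>

context model_category
begin

lemma zigzag_ends: "zigzag M x p y \<Longrightarrow> x \<in> Obj M \<and> y \<in> Obj M"
  by (induction rule: zigzag.induct) auto

lemma zigzag_appendE:
  assumes "zigzag M x (p @ q) z"
  obtains y where "zigzag M x p y" "zigzag M y q z"
proof -
  have "\<exists>y. zigzag M x p y \<and> zigzag M y q z"
    using assms
  proof (induction p arbitrary: x)
    case Nil
    then show ?case using zigzag_ends by auto
  next
    case (Cons l p)
    then show ?case by (cases l) auto
  qed
  then show thesis using that by blast
qed

lemma zigzag_eq_zigzag:
  "zigzag_eq M x y p q \<Longrightarrow> zigzag M x p y \<and> zigzag M x q y"
  by (induction rule: zigzag_eq.induct) auto

lemma zigzag_eq_context: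
  assumes "zigzag_eq M x y p q" "zigzag M x' u x" "zigzag M y v y'"
  shows "zigzag_eq M x' y' (u @ p @ v) (u @ q @ v)"
  using assms(1)
proof (induction rule: zigzag_eq.induct)
  case (eq_step u' p v' q)
  have "zigzag M x' (u @ (u' @ p @ v') @ v) y'" "zigzag M x' (u @ (u' @ q @ v') @ v) y'"
    using eq_step assms by (blast intro: zigzag_append)+
  then have "zigzag_eq M x' y' ((u @ u') @ p @ (v' @ v)) ((u @ u') @ q @ (v' @ v))"
    using eq_step by (intro zigzag_eq.eq_step) auto
  then show ?case by simp
next
  case (eq_refl p)
  then show ?case using assms by (blast intro: zigzag_append zigzag_eq.eq_refl)
qed (blast intro: zigzag_eq.eq_sym zigzag_eq.eq_trans)+

lemma zigzag_eq_append:
  assumes "zigzag_eq M x y p p'" "zigzag_eq M y z q q'"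
  shows "zigzag_eq M x z (p @ q) (p' @ q')"
proof -
  note ends = zigzag_eq_zigzag[OF assms(1)] zigzag_eq_zigzag[OF assms(2)]
  have "zigzag_eq M x z ([] @ p @ q) ([] @ p' @ q)"
    using ends zigzag_ends by (intro zigzag_eq_context[OF assms(1)]) auto
  moreover have "zigzag_eq M x z (p' @ q @ []) (p' @ q' @ [])"
    using ends zigzag_ends by (intro zigzag_eq_context[OF assms(2)]) auto
  ultimately show ?thesis by (auto intro: zigzag_eq.eq_trans)
qed

lemma zigzag_class_eq_iff:
  assumes "zigzag M x p y"
  shows "zigzag_class M x y p = zigzag_class M x y q \<longleftrightarrow> zigzag_eq M x y p q"
proof
  assume "zigzag_class M x y p = zigzag_class M x y q"
  then have "zigzag_eq M x y q p"
    using zigzag_eq.eq_refl[OF assms] by (auto simp: zigzag_class_def)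
  then show "zigzag_eq M x y p q" by (rule zigzag_eq.eq_sym)
qed (auto simp: zigzag_class_def intro: zigzag_eq.eq_sym zigzag_eq.eq_trans)

lemma zigzag_class_rel:
  assumes "zigzag_rel M p q" "zigzag M x p y" "zigzag M x q y"
  shows "zigzag_class M x y p = zigzag_class M x y q"
  using zigzag_eq.eq_step[of M x "[]" p "[]" y q] assms by (simp add: zigzag_class_eq_iff)

lemma Ho_simps [simp]:
  "Obj (Ho M) = Obj M" "Dom (Ho M) (zigzag_class M x y p) = x"
  "Cod (Ho M) (zigzag_class M x y p) = y" "Id (Ho M) x = zigzag_class M x x []"
  by (auto simp: Ho_def zigzag_class_def)

lemma Ho_arr: "zigzag M x p y \<Longrightarrow> zigzag_class M x y p \<in> Arr (Ho M)"
  by (auto simp: Ho_def)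

lemma Ho_arrE:
  assumes "a \<in> Arr (Ho M)"
  obtains p where "a = zigzag_class M (Dom (Ho M) a) (Cod (Ho M) a) p"
    "zigzag M (Dom (Ho M) a) p (Cod (Ho M) a)"
  using assms by (auto simp: Ho_def zigzag_class_def)

lemma Ho_comp:
  assumes "zigzag M x p y" "zigzag M y q z"
  shows "zigzag_class M y z q \<cdot>\<^bsub>Ho M\<^esub> zigzag_class M x y p = zigzag_class M x z (p @ q)"
proof -
  have "(\<exists>p'. zigzag_eq M x y p p' \<and> (\<exists>q'. zigzag_eq M y z q q' \<and> zigzag_eq M x z (p' @ q') r)) \<longleftrightarrow>
      zigzag_eq M x z (p @ q) r" for r
    using zigzag_eq.eq_refl[OF assms(1)] zigzag_eq.eq_refl[OF assms(2)]
    by (blast intro: zigzag_eq_append zigzag_eq.eq_trans)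
  then show ?thesis by (simp add: Ho_def zigzag_class_def)
qed

lemma category_Ho: "category (Ho M)"
proof
  fix f x y z w g h
  show "f \<in> Arr (Ho M) \<Longrightarrow> Dom (Ho M) f \<in> Obj (Ho M)" "f \<in> Arr (Ho M) \<Longrightarrow> Cod (Ho M) f \<in> Obj (Ho M)"
    using zigzag_ends by (auto elim: Ho_arrE)
  show "x \<in> Obj (Ho M) \<Longrightarrow> Id (Ho M) x \<in> hom (Ho M) x x"
    by (auto simp: hom_def intro: Ho_arr)
  have E: "\<exists>p. f = zigzag_class M x y p \<and> zigzag M x p y" if "f \<in> hom (Ho M) x y" for f x y
    using that by (auto simp: hom_def elim: Ho_arrE)
  show "g \<cdot>\<^bsub>Ho M\<^esub> f \<in> hom (Ho M) x z" if "f \<in> hom (Ho M) x y" "g \<in> hom (Ho M) y z"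
    using E[OF that(1)] E[OF that(2)] by (auto simp: Ho_comp hom_def intro!: Ho_arr zigzag_append)
  show "f \<cdot>\<^bsub>Ho M\<^esub> Id (Ho M) x = f" "Id (Ho M) y \<cdot>\<^bsub>Ho M\<^esub> f = f" if f: "f \<in> hom (Ho M) x y"
  proof -
    obtain p where p: "f = zigzag_class M x y p" "zigzag M x p y" using E[OF f] by blast
    then have "zigzag M x [] x" "zigzag M y [] y" using zigzag_ends by auto
    then show "f \<cdot>\<^bsub>Ho M\<^esub> Id (Ho M) x = f" "Id (Ho M) y \<cdot>\<^bsub>Ho M\<^esub> f = f"
      using Ho_comp[of x "[]" x p y] Ho_comp[of x p y "[]" y] p by auto
  qed
  show "(h \<cdot>\<^bsub>Ho M\<^esub> g) \<cdot>\<^bsub>Ho M\<^esub> f = h \<cdot>\<^bsub>Ho M\<^esub> (g \<cdot>\<^bsub>Ho M\<^esub> f)"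
    if "f \<in> hom (Ho M) w x" "g \<in> hom (Ho M) x y" "h \<in> hom (Ho M) y z"
    using E[OF that(1)] E[OF that(2)] E[OF that(3)]
    by (auto simp: Ho_comp zigzag_append)
qed

lemma ho_proj_simps [simp]:
  "Fobj (ho_proj M) x = x" "Fmap (ho_proj M) f = zigzag_class M (Dom M f) (Cod M f) [Fwd f]"
  by (simp_all add: ho_proj_def)

lemma is_functor_ho_proj: "is_functor M (Ho M) (ho_proj M)"
proof (rule is_functorI)
  fix f g assume "f \<in> Arr M" "g \<in> Arr M" "Cod M f = Dom M g"
  then have "zigzag_rel M [Fwd f, Fwd g] [Fwd (g \<cdot> f)]"
    by (intro zigzag_rel.rel_comp[of f M "Dom M f" "Cod M f" g "Cod M g"]) (auto simp: hom_def)
  then show "Fmap (ho_proj M) (g \<cdot> f) = Fmap (ho_proj M) g \<cdot>\<^bsub>Ho M\<^esub> Fmap (ho_proj M) f"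
    using \<open>f \<in> Arr M\<close> \<open>g \<in> Arr M\<close> \<open>Cod M f = Dom M g\<close>
    by (simp add: Ho_comp zigzag_class_rel)
qed (auto simp: hom_def intro!: Ho_arr zigzag_class_rel zigzag_rel.rel_id)

lemma Ho_inverse:
  assumes "w \<in> Weq M"
  defines "b \<equiv> zigzag_class M (Cod M w) (Dom M w) [Bwd w]"
  shows "b \<in> hom (Ho M) (Cod M w) (Dom M w)"
    "b \<cdot>\<^bsub>Ho M\<^esub> Fmap (ho_proj M) w = Id (Ho M) (Dom M w)"
    "Fmap (ho_proj M) w \<cdot>\<^bsub>Ho M\<^esub> b = Id (Ho M) (Cod M w)"
  using assms(1)
  by (auto simp: b_def hom_def Ho_comp intro!: Ho_arr zigzag_class_rel zigzag_rel.intros)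

text \<open>From here on the projection and the identities should stay folded, so that functor and
  category laws apply instead of computations with words.\<close>

declare ho_proj_simps(2) [simp del]
declare Ho_simps(4) [simp del]

lemma inverts_weq_ho_proj: "inverts_weq M (Ho M) (ho_proj M)"
  unfolding inverts_weq_def
proof (intro conjI ballI is_functor_ho_proj)
  interpret Ho: category "Ho M" by (rule category_Ho)
  fix w assume w: "w \<in> Weq M"
  show "is_iso (Ho M) (Fmap (ho_proj M) w)"
    by (rule Ho.is_isoI[OF _ Ho_inverse[OF w]])
      (use w functor_simps[OF is_functor_ho_proj] in \<open>auto simp: hom_def\<close>)
qed

lemma is_iso_ho_proj: "w \<in> Weq M \<Longrightarrow> is_iso (Ho M) (Fmap (ho_proj M) w)"
  using inverts_weq_ho_proj by (simp add: inverts_weq_def)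

lemma inv_ho_proj:
  assumes "w \<in> Weq M"
  shows "inv_arr (Ho M) (Fmap (ho_proj M) w) = zigzag_class M (Cod M w) (Dom M w) [Bwd w]"
proof -
  interpret Ho: category "Ho M" by (rule category_Ho)
  show ?thesis
    by (rule Ho.iso_cancel_left[OF is_iso_ho_proj[OF assms]])
      (use assms Ho_inverse[OF assms] is_iso_ho_proj[OF assms] functor_simps[OF is_functor_ho_proj]
       in \<open>auto simp: hom_def\<close>)
qed

text \<open>Arrows of the homotopy category are composites of images of arrows and of inverses of
  images of weak equivalences. This recursion is the form in which the induction over words in
  \<open>nat_trans_Ho\<close> uses that fact.\<close>

lemma zigzag_class_Cons:
  "zigzag M x (Fwd f # p) y \<Longrightarrow> zigzag_class M x y (Fwd f # p) =
     zigzag_class M (Cod M f) y p \<cdot>\<^bsub>Ho M\<^esub> Fmap (ho_proj M) f"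
  "zigzag M x (Bwd w # p) y \<Longrightarrow> zigzag_class M x y (Bwd w # p) =
     zigzag_class M (Dom M w) y p \<cdot>\<^bsub>Ho M\<^esub> inv_arr (Ho M) (Fmap (ho_proj M) w)"
  using Ho_comp[of "Dom M f" "[Fwd f]" "Cod M f" p y]
  by (auto simp: ho_proj_simps(2))
    (use Ho_comp[of "Cod M w" "[Bwd w]" "Dom M w" p y] in \<open>auto simp: inv_ho_proj simp flip: ho_proj_simps(2)\<close>)

text \<open>The objects of \<open>Ho M\<close> are those of \<open>M\<close>, so the components stay
  the same. The arrows for which the naturality square commutes are closed under composition and
  under inversion, and hence include every word.\<close>

lemma nat_trans_Ho:
  assumes "category E" "is_functor (Ho M) E A" "is_functor (Ho M) E B"
    and "nat_trans M E (A \<circ>\<^sub>F ho_proj M) (B \<circ>\<^sub>F ho_proj M) \<eta>"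
  shows "nat_trans (Ho M) E A B \<eta>"
proof (rule nat_transI[OF assms(2,3)])
  interpret E: category E by fact
  interpret Ho: category "Ho M" by (rule category_Ho)
  note [simp] = functor_simps[OF assms(2)] functor_simps[OF assms(3)] Ho_arr
    functor_simps[OF is_functor_ho_proj]
  have \<eta> [simp]: "\<eta> x \<in> Arr E" "Dom E (\<eta> x) = Fobj A x" "Cod E (\<eta> x) = Fobj B x" if "x \<in> Obj M" for x
    using nat_trans_simps[OF assms(4) that] by auto
  show "x \<in> Obj (Ho M) \<Longrightarrow> \<eta> x \<in> hom E (Fobj A x) (Fobj B x)" for x
    by (simp add: hom_def)
  have nat: "\<eta> (Cod M f) \<cdot>\<^bsub>E\<^esub> Fmap A (Fmap (ho_proj M) f) = Fmap B (Fmap (ho_proj M) f) \<cdot>\<^bsub>E\<^esub> \<eta> (Dom M f)"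
    if "f \<in> Arr M" for f
    using nat_trans_natural[OF assms(4) that] by simp
  \<comment> \<open>The square for a backward letter is the square for \<open>w\<close> with the
    inverses of both vertical images composed onto it.\<close>
  have nat_inv: "\<eta> (Dom M w) \<cdot>\<^bsub>E\<^esub> Fmap A (inv_arr (Ho M) (Fmap (ho_proj M) w)) =
      Fmap B (inv_arr (Ho M) (Fmap (ho_proj M) w)) \<cdot>\<^bsub>E\<^esub> \<eta> (Cod M w)"
    if w: "w \<in> Weq M" for w
  proof -
    note iso [simp] = is_iso_ho_proj[OF w]
    note A = functor_is_iso[OF category_Ho assms(1,2) iso] and B = functor_is_iso[OF category_Ho assms(1,3) iso]
    have [simp]: "w \<in> Arr M" using w by simp
    show ?thesis
    proof (rule E.iso_cancel_left[OF B(1)])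
      have "(Fmap B (Fmap (ho_proj M) w) \<cdot>\<^bsub>E\<^esub> \<eta> (Dom M w)) \<cdot>\<^bsub>E\<^esub> inv_arr E (Fmap A (Fmap (ho_proj M) w)) =
          (\<eta> (Cod M w) \<cdot>\<^bsub>E\<^esub> Fmap A (Fmap (ho_proj M) w)) \<cdot>\<^bsub>E\<^esub> inv_arr E (Fmap A (Fmap (ho_proj M) w))"
        by (simp only: nat \<open>w \<in> Arr M\<close>)
      then show "Fmap B (Fmap (ho_proj M) w) \<cdot>\<^bsub>E\<^esub> (\<eta> (Dom M w) \<cdot>\<^bsub>E\<^esub> Fmap A (inv_arr (Ho M) (Fmap (ho_proj M) w))) =
          Fmap B (Fmap (ho_proj M) w) \<cdot>\<^bsub>E\<^esub> (Fmap B (inv_arr (Ho M) (Fmap (ho_proj M) w)) \<cdot>\<^bsub>E\<^esub> \<eta> (Cod M w))"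
        by (simp add: A(1) B(1) flip: A(2) B(2))
    qed simp_all
  qed
  have "\<eta> y \<cdot>\<^bsub>E\<^esub> Fmap A (zigzag_class M x y p) = Fmap B (zigzag_class M x y p) \<cdot>\<^bsub>E\<^esub> \<eta> x"
    if "zigzag M x p y" for x y p
    using that
  proof (induction rule: zigzag.induct)
    case (zigzag_Nil x)
    then show ?case by (simp flip: Ho_simps(4))
  next
    case (zigzag_Fwd f p y)
    note [simp] = \<open>f \<in> Arr M\<close> zigzag_ends[OF zigzag_Fwd(2)] Ho_arr[OF zigzag_Fwd(2)]
    show ?case
      using zigzag_Fwd nat E.reassoc[OF zigzag_Fwd(3), of "Fmap A (Fmap (ho_proj M) f)"]
      by (simp add: zigzag_class_Cons)
  next
    case (zigzag_Bwd w p y)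
    note [simp] = \<open>w \<in> Weq M\<close> zigzag_ends[OF zigzag_Bwd(2)] Ho_arr[OF zigzag_Bwd(2)]
      is_iso_ho_proj[OF \<open>w \<in> Weq M\<close>]
    show ?case
      using zigzag_Bwd nat_inv
        E.reassoc[OF zigzag_Bwd(3), of "Fmap A (inv_arr (Ho M) (Fmap (ho_proj M) w))"]
      by (simp add: zigzag_class_Cons)
  qed
  then show "\<eta> (Cod (Ho M) a) \<cdot>\<^bsub>E\<^esub> Fmap A a = Fmap B a \<cdot>\<^bsub>E\<^esub> \<eta> (Dom (Ho M) a)" if "a \<in> Arr (Ho M)" for a
    using that by (metis Ho_arrE)
qed

end

text \<open>The value of a word under the functor induced by \<open>A\<close>. The starting object
  is an argument because the empty word does not record it.\<close>

primrec zigzag_map ::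
  "('o, 'm, 'y) model_cat_scheme \<Rightarrow> ('p, 'n, 'z) cat_scheme \<Rightarrow> ('o, 'm, 'p, 'n) ftor \<Rightarrow>
   'm letter list \<Rightarrow> 'o \<Rightarrow> 'n" where
  "zigzag_map M E A [] x = Id E (Fobj A x)"
| "zigzag_map M E A (l # p) x = (case l of
     Fwd f \<Rightarrow> zigzag_map M E A p (Cod M f) \<cdot>\<^bsub>E\<^esub> Fmap A f
   | Bwd w \<Rightarrow> zigzag_map M E A p (Dom M w) \<cdot>\<^bsub>E\<^esub> inv_arr E (Fmap A w))"

text \<open>The existence half of the universal property of localization: evaluating words respects
  concatenation and the four generating relations, hence the congruence they generate.\<close>

lemma (in model_category) extend_to_Ho:
  assumes "category E" "inverts_weq M E A"
  shows "\<exists>L. is_functor (Ho M) E L \<and> (\<forall>x. Fobj L x = Fobj A x) \<and>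
    (\<forall>f \<in> Arr M. Fmap L (Fmap (ho_proj M) f) = Fmap A f)"
proof -
  interpret E: category E by fact
  have A: "is_functor M E A" and [simp]: "\<And>w. w \<in> Weq M \<Longrightarrow> is_iso E (Fmap A w)"
    using assms(2) by (auto simp: inverts_weq_def)
  note [simp] = functor_simps[OF A]
  let ?m = "zigzag_map M E A"
  have hom: "?m p x \<in> Arr E \<and> Dom E (?m p x) = Fobj A x \<and> Cod E (?m p x) = Fobj A y"
    if "zigzag M x p y" for x p y
    using that by (induction rule: zigzag.induct) auto
  note [simp] = conjunct1[OF hom] conjunct1[OF conjunct2[OF hom]] conjunct2[OF conjunct2[OF hom]]
  have append: "?m (p @ q) x = ?m q y \<cdot>\<^bsub>E\<^esub> ?m p x" if "zigzag M x p y" "zigzag M y q z" for x p y q z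
    using that
  proof (induction rule: zigzag.induct)
    case (zigzag_Nil x)
    then show ?case using hom[OF zigzag_Nil(2)] by simp
  next
    case (zigzag_Fwd f p y)
    then show ?case using hom[OF zigzag_Fwd(2)] hom[OF zigzag_Fwd(4)] by simp
  next
    case (zigzag_Bwd w p y)
    then show ?case using hom[OF zigzag_Bwd(2)] hom[OF zigzag_Bwd(4)] by simp
  qed
  have rel: "?m p x = ?m q x" if "zigzag_rel M p q" "zigzag M x p y" "zigzag M x q y" for x p q y
    using that
  proof (induction rule: zigzag_rel.induct)
    case (rel_comp f x y g z)
    then show ?case by (auto simp: hom_def)
  qed auto
  have eq: "?m p x = ?m q x" if "zigzag_eq M x y p q" for x p q y
    using that
  proof (induction rule: zigzag_eq.induct)
    case (eq_step u p v q)
    \<comment> \<open>Both words pass through the same intermediate objects, since \<open>u\<close>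
      determines where \<open>p\<close> and \<open>q\<close> start and \<open>v\<close> determines
      where they end. The generating relation can then be evaluated in isolation.\<close>
    obtain a where a: "zigzag M x u a" "zigzag M a (p @ v) y" using eq_step(1) by (rule zigzag_appendE)
    obtain b where b: "zigzag M a p b" "zigzag M b v y" using a(2) by (rule zigzag_appendE)
    obtain a' where a': "zigzag M x u a'" "zigzag M a' (q @ v) y" using eq_step(2) by (rule zigzag_appendE)
    obtain b' where b': "zigzag M a' q b'" "zigzag M b' v y" using a'(2) by (rule zigzag_appendE)
    have [simp]: "a' = a" "b' = b"
      using zigzag_target_unique[OF a'(1) a(1)] zigzag_source_unique[OF b'(2) b(2)] by auto
    have "?m p a = ?m q a" using rel[OF eq_step(3) b(1)] b' by simp
    then show ?case
      using append[OF a(1) a(2)] append[OF b] append[OF a'(1) a'(2)] append[OF b'] by simp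
  qed auto
  \<comment> \<open>For a triple \<open>a\<close> the component \<open>fst a\<close> is the source
    and \<open>snd (snd a)\<close> the equivalence class. The value does not depend on the selected
    representative, by \<open>eq\<close>.\<close>
  define L :: "('o, ('o, 'm) ho_arr, _, _) ftor" where
    "L = \<lparr>Fobj = Fobj A, Fmap = \<lambda>a. ?m (SOME p. p \<in> snd (snd a)) (fst a)\<rparr>"
  have Lm: "Fmap L (zigzag_class M x y p) = ?m p x" if "zigzag M x p y" for x y p
  proof -
    have "zigzag_eq M x y p (SOME q. zigzag_eq M x y p q)"
      by (rule someI) (rule zigzag_eq.eq_refl[OF that])
    then show ?thesis using eq by (simp add: L_def zigzag_class_def)
  qed
  have [simp]: "Fobj L x = Fobj A x" for x by (simp add: L_def)
  have "is_functor (Ho M) E L"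
  proof (rule is_functorI)
    fix a assume "a \<in> Arr (Ho M)"
    then obtain p where "a = zigzag_class M (Dom (Ho M) a) (Cod (Ho M) a) p"
      "zigzag M (Dom (Ho M) a) p (Cod (Ho M) a)" by (rule Ho_arrE)
    then show "Fmap L a \<in> hom E (Fobj L (Dom (Ho M) a)) (Fobj L (Cod (Ho M) a))"
      using Lm hom by (metis (mono_tags, lifting) E.in_homI \<open>\<And>x. Fobj L x = Fobj A x\<close>)
  next
    fix a b assume ab: "a \<in> Arr (Ho M)" "b \<in> Arr (Ho M)" "Cod (Ho M) a = Dom (Ho M) b"
    obtain p where p: "a = zigzag_class M (Dom (Ho M) a) (Cod (Ho M) a) p"
      "zigzag M (Dom (Ho M) a) p (Cod (Ho M) a)" using ab(1) by (rule Ho_arrE)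
    obtain q where q: "b = zigzag_class M (Cod (Ho M) a) (Cod (Ho M) b) q"
      "zigzag M (Cod (Ho M) a) q (Cod (Ho M) b)" using ab(2) ab(3) Ho_arrE by metis
    have "b \<cdot>\<^bsub>Ho M\<^esub> a = zigzag_class M (Dom (Ho M) a) (Cod (Ho M) b) (p @ q)"
      using Ho_comp[OF p(2) q(2)] p(1) q(1) by simp
    then show "Fmap L (b \<cdot>\<^bsub>Ho M\<^esub> a) = Fmap L b \<cdot>\<^bsub>E\<^esub> Fmap L a"
      using Lm[OF zigzag_append[OF p(2) q(2)]] Lm[OF p(2)] Lm[OF q(2)] p(1) q(1) append[OF p(2) q(2)] by simp
  qed (auto simp: Lm Ho_simps(4))
  moreover have "Fmap L (Fmap (ho_proj M) f) = Fmap A f" if "f \<in> Arr M" for f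
    using that by (simp add: ho_proj_simps(2) Lm)
  ultimately show ?thesis by (intro exI[of _ L]) simp
qed

section \<open>Total derived functors\<close>

lemma nat_trans_cong:
  assumes "nat_trans C D F G \<eta>" "is_functor C D F'"
    and "\<And>x. x \<in> Obj C \<Longrightarrow> Fobj F' x = Fobj F x" "\<And>f. f \<in> Arr C \<Longrightarrow> Fmap F' f = Fmap F f"
  shows "nat_trans C D F' G \<eta>"
  using assms by (auto simp: nat_trans_def hom_def)

lemma nat_trans_cong_target:
  assumes "nat_trans C D F G \<eta>" "is_functor C D G'"
    and "\<And>x. x \<in> Obj C \<Longrightarrow> Fobj G' x = Fobj G x" "\<And>f. f \<in> Arr C \<Longrightarrow> Fmap G' f = Fmap G f"
  shows "nat_trans C D F G' \<eta>"
  using assms by (auto simp: nat_trans_def hom_def)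

lemma inverts_weq_fcomp:
  assumes "category D" "category E" "inverts_weq M D A" "is_functor D E H"
  shows "inverts_weq M E (H \<circ>\<^sub>F A)"
  using assms functor_is_iso(1)[OF assms(1,2,4)] is_functor_fcomp[of M D A E H]
  by (auto simp: inverts_weq_def)

text \<open>Any functor preserves isomorphisms, so the approximation survives postcomposition:
  derived functors of this kind are absolute Kan extensions. The unit of the derived adjunction and
  the composition of derived functors both rest on this.\<close>

lemma left_approx_fcomp:
  assumes "category M" "category D" "category E" "left_approx M D \<Phi> A t" "is_functor D E H"
  shows "left_approx M E (H \<circ>\<^sub>F \<Phi>) (H \<circ>\<^sub>F A) (\<lambda>x. Fmap H (t x))"
  using assms inverts_weq_fcomp[OF assms(2,3) _ assms(5)] functor_is_iso(1)[OF assms(2,3,5)]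
    nat_trans_whisker_left[OF _ assms(5,1)]
  unfolding left_approx_def by blast

lemma right_approx_fcomp:
  assumes "category M" "category D" "category E" "right_approx M D \<Phi> A t" "is_functor D E H"
  shows "right_approx M E (H \<circ>\<^sub>F \<Phi>) (H \<circ>\<^sub>F A) (\<lambda>x. Fmap H (t x))"
  using assms inverts_weq_fcomp[OF assms(2,3) _ assms(5)] functor_is_iso(1)[OF assms(2,3,5)]
    nat_trans_whisker_left[OF _ assms(5,1)]
  unfolding right_approx_def by blast

lemma (in model_category) inverts_weq_Ho:
  assumes "category E" "is_functor (Ho M) E L"
  shows "inverts_weq M E (L \<circ>\<^sub>F ho_proj M)"
  by (rule inverts_weq_fcomp[OF category_Ho assms(1) inverts_weq_ho_proj assms(2)])

lemma (in model_category) nat_isomorphic_Ho: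
  assumes "category E" "is_functor (Ho M) E A" "is_functor (Ho M) E B"
    and "nat_isomorphic M E (A \<circ>\<^sub>F ho_proj M) (B \<circ>\<^sub>F ho_proj M)"
  shows "nat_isomorphic (Ho M) E A B"
  using assms(4) nat_trans_Ho[OF assms(1-3)] unfolding nat_isomorphic_def by auto

section \<open>Derived functors and invertibility at cofibrant or fibrant objects\<close>

locale model_pair = M: model_category M + N: model_category N
  for M :: "('o, 'm, 'y) model_cat_scheme" and N :: "('p, 'n, 'z) model_cat_scheme"
begin

text \<open>By \<open>nat_trans_Ho\<close>, transformations between functors on \<open>Ho M\<close>
  are the same as transformations between their composites with the projection, so the universal
  property of an approximation is that of the derived functor.\<close>

lemma left_derived_if_approx:
  assumes L: "is_functor (Ho M) (Ho N) L"
    and t: "left_approx M (Ho N) (ho_proj N \<circ>\<^sub>F F) (L \<circ>\<^sub>F ho_proj M) t"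
  shows "is_left_derived M N F L t"
  unfolding is_left_derived_def
proof (intro conjI allI impI, goal_cases)
  case 2
  show ?case using t by (simp add: left_approx_def)
next
  case (3 G s)
  then have G: "is_functor (Ho M) (Ho N) G"
    and s: "nat_trans M (Ho N) (G \<circ>\<^sub>F ho_proj M) (ho_proj N \<circ>\<^sub>F F) s" by blast+
  note iw = M.inverts_weq_Ho[OF N.category_Ho G]
  obtain r where r: "nat_trans M (Ho N) (G \<circ>\<^sub>F ho_proj M) (L \<circ>\<^sub>F ho_proj M) r"
    "\<forall>x \<in> Obj M. t x \<cdot>\<^bsub>Ho N\<^esub> r x = s x"
    using M.left_approx_universal[OF N.category_Ho t iw s] by blast
  have "r' x = r x" if r': "nat_trans (Ho M) (Ho N) G L r'" "\<forall>x \<in> Obj M. t x \<cdot>\<^bsub>Ho N\<^esub> r' x = s x"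
    and x: "x \<in> Obj M" for r' x
  proof -
    have "nat_trans M (Ho N) (G \<circ>\<^sub>F ho_proj M) (L \<circ>\<^sub>F ho_proj M) r'"
      using nat_trans_whisker_right[OF r'(1) M.is_functor_ho_proj M.category_axioms] by simp
    from M.left_approx_unique[OF N.category_Ho t iw this r(1) _ x] show ?thesis
      using r(2) r'(2) by simp
  qed
  then show ?case
    using M.nat_trans_Ho[OF N.category_Ho G L r(1)] r(2) by blast
qed (rule L)

text \<open>Argued in parallel with the left case and not by duality, because the opposite of
  \<open>Ho M\<close> is not literally \<open>Ho (opm M)\<close>.\<close>

lemma right_derived_if_approx:
  assumes R: "is_functor (Ho M) (Ho N) R"
    and t: "right_approx M (Ho N) (ho_proj N \<circ>\<^sub>F F) (R \<circ>\<^sub>F ho_proj M) t"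
  shows "is_right_derived M N F R t"
  unfolding is_right_derived_def
proof (intro conjI allI impI, goal_cases)
  case 2
  show ?case using t by (simp add: right_approx_def)
next
  case (3 G s)
  then have G: "is_functor (Ho M) (Ho N) G"
    and s: "nat_trans M (Ho N) (ho_proj N \<circ>\<^sub>F F) (G \<circ>\<^sub>F ho_proj M) s" by blast+
  note iw = M.inverts_weq_Ho[OF N.category_Ho G]
  obtain r where r: "nat_trans M (Ho N) (R \<circ>\<^sub>F ho_proj M) (G \<circ>\<^sub>F ho_proj M) r"
    "\<forall>x \<in> Obj M. r x \<cdot>\<^bsub>Ho N\<^esub> t x = s x"
    using M.right_approx_universal[OF N.category_Ho t iw s] by blast
  have "r' x = r x" if r': "nat_trans (Ho M) (Ho N) R G r'" "\<forall>x \<in> Obj M. r' x \<cdot>\<^bsub>Ho N\<^esub> t x = s x"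
    and x: "x \<in> Obj M" for r' x
  proof -
    have "nat_trans M (Ho N) (R \<circ>\<^sub>F ho_proj M) (G \<circ>\<^sub>F ho_proj M) r'"
      using nat_trans_whisker_right[OF r'(1) M.is_functor_ho_proj M.category_axioms] by simp
    from M.right_approx_unique[OF N.category_Ho t iw this r(1) _ x] show ?thesis
      using r(2) r'(2) by simp
  qed
  then show ?case
    using M.nat_trans_Ho[OF N.category_Ho R G r(1)] r(2) by blast
qed (rule R)

lemma approx_if_left_derived:
  assumes L\<^sub>0: "is_functor (Ho M) (Ho N) L\<^sub>0"
    and t\<^sub>0: "left_approx M (Ho N) (ho_proj N \<circ>\<^sub>F F) (L\<^sub>0 \<circ>\<^sub>F ho_proj M) t\<^sub>0"
    and Lt: "is_left_derived M N F L t"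
  shows "left_approx M (Ho N) (ho_proj N \<circ>\<^sub>F F) (L \<circ>\<^sub>F ho_proj M) t"
proof -
  interpret HN: category "Ho N" by (rule N.category_Ho)
  note cats = M.category_Ho N.category_Ho
  have L: "is_functor (Ho M) (Ho N) L"
    and t: "nat_trans M (Ho N) (L \<circ>\<^sub>F ho_proj M) (ho_proj N \<circ>\<^sub>F F) t"
    and ex: "\<And>G s. is_functor (Ho M) (Ho N) G \<Longrightarrow>
        nat_trans M (Ho N) (G \<circ>\<^sub>F ho_proj M) (ho_proj N \<circ>\<^sub>F F) s \<Longrightarrow>
        \<exists>r. nat_trans (Ho M) (Ho N) G L r \<and> (\<forall>x \<in> Obj M. t x \<cdot>\<^bsub>Ho N\<^esub> r x = s x) \<and>
           (\<forall>r'. nat_trans (Ho M) (Ho N) G L r' \<and> (\<forall>x \<in> Obj M. t x \<cdot>\<^bsub>Ho N\<^esub> r' x = s x) \<longrightarrow>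
              (\<forall>x \<in> Obj M. r' x = r x))"
    using Lt unfolding is_left_derived_def by blast+
  have t\<^sub>0': "nat_trans M (Ho N) (L\<^sub>0 \<circ>\<^sub>F ho_proj M) (ho_proj N \<circ>\<^sub>F F) t\<^sub>0"
    using t\<^sub>0 by (simp add: left_approx_def)
  note iw = M.inverts_weq_Ho[OF cats(2) L] and iw\<^sub>0 = M.inverts_weq_Ho[OF cats(2) L\<^sub>0]
  obtain r where r: "nat_trans (Ho M) (Ho N) L\<^sub>0 L r" "\<And>x. x \<in> Obj M \<Longrightarrow> t x \<cdot>\<^bsub>Ho N\<^esub> r x = t\<^sub>0 x"
    using ex[OF L\<^sub>0 t\<^sub>0'] by blast
  obtain r\<^sub>0 where r\<^sub>0': "nat_trans M (Ho N) (L \<circ>\<^sub>F ho_proj M) (L\<^sub>0 \<circ>\<^sub>F ho_proj M) r\<^sub>0"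
    and tr\<^sub>0: "\<And>x. x \<in> Obj M \<Longrightarrow> t\<^sub>0 x \<cdot>\<^bsub>Ho N\<^esub> r\<^sub>0 x = t x"
    using M.left_approx_universal[OF cats(2) t\<^sub>0 iw t] by blast
  note r\<^sub>0 = M.nat_trans_Ho[OF cats(2) L L\<^sub>0 r\<^sub>0']
  note r' = nat_trans_whisker_right[OF r(1) M.is_functor_ho_proj M.category_axioms]
  note [simp] = nat_trans_simps[OF r(1)] nat_trans_simps[OF r\<^sub>0] nat_trans_simps[OF t] nat_trans_simps[OF t\<^sub>0']
    functor_simps[OF L] functor_simps[OF L\<^sub>0]
  have 1: "r\<^sub>0 x \<cdot>\<^bsub>Ho N\<^esub> r x = Id (Ho N) (Fobj L\<^sub>0 x)" if x: "x \<in> Obj M" for x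
  proof (rule M.left_approx_unique[OF cats(2) t\<^sub>0 iw\<^sub>0 _ _ _ x,
      where r = "\<lambda>x. r\<^sub>0 x \<cdot>\<^bsub>Ho N\<^esub> r x" and r' = "\<lambda>x. Id (Ho N) (Fobj L\<^sub>0 x)"])
    show "nat_trans M (Ho N) (L\<^sub>0 \<circ>\<^sub>F ho_proj M) (L\<^sub>0 \<circ>\<^sub>F ho_proj M) (\<lambda>x. r\<^sub>0 x \<cdot>\<^bsub>Ho N\<^esub> r x)"
      using nat_trans_comp[OF M.category_axioms cats(2) r' r\<^sub>0'] by simp
    show "nat_trans M (Ho N) (L\<^sub>0 \<circ>\<^sub>F ho_proj M) (L\<^sub>0 \<circ>\<^sub>F ho_proj M) (\<lambda>x. Id (Ho N) (Fobj L\<^sub>0 x))"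
      using nat_trans_id[OF M.category_axioms cats(2) nat_trans_functor(1)[OF t\<^sub>0']] by simp
    show "t\<^sub>0 x \<cdot>\<^bsub>Ho N\<^esub> (r\<^sub>0 x \<cdot>\<^bsub>Ho N\<^esub> r x) = t\<^sub>0 x \<cdot>\<^bsub>Ho N\<^esub> Id (Ho N) (Fobj L\<^sub>0 x)" if "x \<in> Obj M" for x
      using that HN.reassoc[OF tr\<^sub>0[OF that], of "r x"] by (simp add: r(2))
  qed
  have 2: "r x \<cdot>\<^bsub>Ho N\<^esub> r\<^sub>0 x = Id (Ho N) (Fobj L x)" if x: "x \<in> Obj M" for x
  proof -
    \<comment> \<open>Universality of \<open>L\<close> against itself: the composite of the two
      comparisons and the identity both lie over \<open>t\<close>, so both agree with the same
      \<open>k\<close>.\<close>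
    obtain k where k: "\<And>r'. nat_trans (Ho M) (Ho N) L L r' \<Longrightarrow> \<forall>x \<in> Obj M. t x \<cdot>\<^bsub>Ho N\<^esub> r' x = t x \<Longrightarrow>
        \<forall>x \<in> Obj M. r' x = k x"
      using ex[OF L t] by blast
    have "\<forall>x \<in> Obj M. t x \<cdot>\<^bsub>Ho N\<^esub> (r x \<cdot>\<^bsub>Ho N\<^esub> r\<^sub>0 x) = t x"
    proof
      fix x assume x: "x \<in> Obj M"
      then show "t x \<cdot>\<^bsub>Ho N\<^esub> (r x \<cdot>\<^bsub>Ho N\<^esub> r\<^sub>0 x) = t x"
        using HN.reassoc[OF r(2)[OF x], of "r\<^sub>0 x"] by (simp add: tr\<^sub>0)
    qed
    from k[OF nat_trans_comp[OF cats r\<^sub>0 r(1)] this] k[OF nat_trans_id[OF cats L]]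
    show ?thesis using x by simp
  qed
  have "is_iso (Ho N) (t x)" if x: "cofibrant M x" for x
  proof -
    note [simp] = M.cofibrant_obj[OF x]
    have "is_iso (Ho N) (r\<^sub>0 x)"
      by (rule HN.is_isoI[OF _ _ 2 1]) (simp_all add: hom_def)
    then have "is_iso (Ho N) (t\<^sub>0 x \<cdot>\<^bsub>Ho N\<^esub> r\<^sub>0 x)"
      using t\<^sub>0 x by (intro HN.is_iso_comp) (auto simp: left_approx_def)
    then show ?thesis by (simp add: tr\<^sub>0)
  qed
  then show ?thesis using iw t by (simp add: left_approx_def)
qed

lemma approx_if_right_derived:
  assumes R\<^sub>0: "is_functor (Ho M) (Ho N) R\<^sub>0"
    and t\<^sub>0: "right_approx M (Ho N) (ho_proj N \<circ>\<^sub>F F) (R\<^sub>0 \<circ>\<^sub>F ho_proj M) t\<^sub>0"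
    and Rt: "is_right_derived M N F R t"
  shows "right_approx M (Ho N) (ho_proj N \<circ>\<^sub>F F) (R \<circ>\<^sub>F ho_proj M) t"
proof -
  interpret HN: category "Ho N" by (rule N.category_Ho)
  note cats = M.category_Ho N.category_Ho
  have R: "is_functor (Ho M) (Ho N) R"
    and t: "nat_trans M (Ho N) (ho_proj N \<circ>\<^sub>F F) (R \<circ>\<^sub>F ho_proj M) t"
    and ex: "\<And>G s. is_functor (Ho M) (Ho N) G \<Longrightarrow>
        nat_trans M (Ho N) (ho_proj N \<circ>\<^sub>F F) (G \<circ>\<^sub>F ho_proj M) s \<Longrightarrow>
        \<exists>r. nat_trans (Ho M) (Ho N) R G r \<and> (\<forall>x \<in> Obj M. r x \<cdot>\<^bsub>Ho N\<^esub> t x = s x) \<and>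
           (\<forall>r'. nat_trans (Ho M) (Ho N) R G r' \<and> (\<forall>x \<in> Obj M. r' x \<cdot>\<^bsub>Ho N\<^esub> t x = s x) \<longrightarrow>
              (\<forall>x \<in> Obj M. r' x = r x))"
    using Rt unfolding is_right_derived_def by blast+
  have t\<^sub>0': "nat_trans M (Ho N) (ho_proj N \<circ>\<^sub>F F) (R\<^sub>0 \<circ>\<^sub>F ho_proj M) t\<^sub>0"
    using t\<^sub>0 by (simp add: right_approx_def)
  note iw = M.inverts_weq_Ho[OF cats(2) R] and iw\<^sub>0 = M.inverts_weq_Ho[OF cats(2) R\<^sub>0]
  obtain r where r: "nat_trans (Ho M) (Ho N) R R\<^sub>0 r" "\<And>x. x \<in> Obj M \<Longrightarrow> r x \<cdot>\<^bsub>Ho N\<^esub> t x = t\<^sub>0 x"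
    using ex[OF R\<^sub>0 t\<^sub>0'] by blast
  obtain r\<^sub>0 where r\<^sub>0': "nat_trans M (Ho N) (R\<^sub>0 \<circ>\<^sub>F ho_proj M) (R \<circ>\<^sub>F ho_proj M) r\<^sub>0"
    and tr\<^sub>0: "\<And>x. x \<in> Obj M \<Longrightarrow> r\<^sub>0 x \<cdot>\<^bsub>Ho N\<^esub> t\<^sub>0 x = t x"
    using M.right_approx_universal[OF cats(2) t\<^sub>0 iw t] by blast
  note r\<^sub>0 = M.nat_trans_Ho[OF cats(2) R\<^sub>0 R r\<^sub>0']
  note r' = nat_trans_whisker_right[OF r(1) M.is_functor_ho_proj M.category_axioms]
  note [simp] = nat_trans_simps[OF r(1)] nat_trans_simps[OF r\<^sub>0] nat_trans_simps[OF t] nat_trans_simps[OF t\<^sub>0']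
    functor_simps[OF R] functor_simps[OF R\<^sub>0]
  have 1: "r x \<cdot>\<^bsub>Ho N\<^esub> r\<^sub>0 x = Id (Ho N) (Fobj R\<^sub>0 x)" if x: "x \<in> Obj M" for x
  proof (rule M.right_approx_unique[OF cats(2) t\<^sub>0 iw\<^sub>0 _ _ _ x,
      where r = "\<lambda>x. r x \<cdot>\<^bsub>Ho N\<^esub> r\<^sub>0 x" and r' = "\<lambda>x. Id (Ho N) (Fobj R\<^sub>0 x)"])
    show "nat_trans M (Ho N) (R\<^sub>0 \<circ>\<^sub>F ho_proj M) (R\<^sub>0 \<circ>\<^sub>F ho_proj M) (\<lambda>x. r x \<cdot>\<^bsub>Ho N\<^esub> r\<^sub>0 x)"
      using nat_trans_comp[OF M.category_axioms cats(2) r\<^sub>0' r'] by simp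
    show "nat_trans M (Ho N) (R\<^sub>0 \<circ>\<^sub>F ho_proj M) (R\<^sub>0 \<circ>\<^sub>F ho_proj M) (\<lambda>x. Id (Ho N) (Fobj R\<^sub>0 x))"
      using nat_trans_id[OF M.category_axioms cats(2) nat_trans_functor(2)[OF t\<^sub>0']] by simp
    show "(r x \<cdot>\<^bsub>Ho N\<^esub> r\<^sub>0 x) \<cdot>\<^bsub>Ho N\<^esub> t\<^sub>0 x = Id (Ho N) (Fobj R\<^sub>0 x) \<cdot>\<^bsub>Ho N\<^esub> t\<^sub>0 x" if "x \<in> Obj M" for x
      using that by (simp add: r(2) tr\<^sub>0)
  qed
  have 2: "r\<^sub>0 x \<cdot>\<^bsub>Ho N\<^esub> r x = Id (Ho N) (Fobj R x)" if x: "x \<in> Obj M" for x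
  proof -
    obtain k where k: "\<And>r'. nat_trans (Ho M) (Ho N) R R r' \<Longrightarrow> \<forall>x \<in> Obj M. r' x \<cdot>\<^bsub>Ho N\<^esub> t x = t x \<Longrightarrow>
        \<forall>x \<in> Obj M. r' x = k x"
      using ex[OF R t] by blast
    have "\<forall>x \<in> Obj M. (r\<^sub>0 x \<cdot>\<^bsub>Ho N\<^esub> r x) \<cdot>\<^bsub>Ho N\<^esub> t x = t x"
      by (simp add: tr\<^sub>0 r(2))
    from k[OF nat_trans_comp[OF cats r(1) r\<^sub>0] this] k[OF nat_trans_id[OF cats R]]
    show ?thesis using x by simp
  qed
  have "is_iso (Ho N) (t x)" if x: "fibrant M x" for x
  proof -
    have [simp]: "x \<in> Obj M" using x by (simp add: fibrant_def)
    have "is_iso (Ho N) (r\<^sub>0 x)"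
      by (rule HN.is_isoI[OF _ _ 1 2]) (simp_all add: hom_def)
    then have "is_iso (Ho N) (r\<^sub>0 x \<cdot>\<^bsub>Ho N\<^esub> t\<^sub>0 x)"
      using t\<^sub>0 x by (intro HN.is_iso_comp) (auto simp: right_approx_def)
    then show ?thesis by (simp add: tr\<^sub>0)
  qed
  then show ?thesis using iw t by (simp add: right_approx_def)
qed

text \<open>Existence comes first, since only then does the choice in \<open>Lder\<close> satisfy
  the universal property; the chosen functor is afterwards compared with the constructed
  one.\<close>

lemma Lder_approx:
  assumes "is_functor M N F" "preserves_cofibrations M N F"
  shows "is_functor (Ho M) (Ho N) (Lder M N F)"
    "\<exists>t. left_approx M (Ho N) (ho_proj N \<circ>\<^sub>F F) (Lder M N F \<circ>\<^sub>F ho_proj M) t"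
proof -
  note \<Phi> = is_functor_fcomp[OF assms(1) N.is_functor_ho_proj]
  have "inverts_acyclic_cof M (Ho N) (ho_proj N \<circ>\<^sub>F F)"
    using assms(2) N.is_iso_ho_proj
    by (intro inverts_acyclic_cof.intro inverts_acyclic_cof_axioms.intro M.model_category_axioms
        N.category_Ho \<Phi>) (auto simp: preserves_cofibrations_def)
  then obtain A t where At: "left_approx M (Ho N) (ho_proj N \<circ>\<^sub>F F) A t"
    using inverts_acyclic_cof.left_approx_exists by blast
  then have A: "inverts_weq M (Ho N) A" and t: "nat_trans M (Ho N) A (ho_proj N \<circ>\<^sub>F F) t"
    by (simp_all add: left_approx_def)
  obtain L\<^sub>0 where L\<^sub>0: "is_functor (Ho M) (Ho N) L\<^sub>0" "\<And>x. Fobj L\<^sub>0 x = Fobj A x"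
    "\<And>f. f \<in> Arr M \<Longrightarrow> Fmap L\<^sub>0 (Fmap (ho_proj M) f) = Fmap A f"
    using M.extend_to_Ho[OF N.category_Ho A] by blast
  have "nat_trans M (Ho N) (L\<^sub>0 \<circ>\<^sub>F ho_proj M) (ho_proj N \<circ>\<^sub>F F) t"
    by (rule nat_trans_cong[OF t is_functor_fcomp[OF M.is_functor_ho_proj L\<^sub>0(1)]]) (simp_all add: L\<^sub>0)
  then have t\<^sub>0: "left_approx M (Ho N) (ho_proj N \<circ>\<^sub>F F) (L\<^sub>0 \<circ>\<^sub>F ho_proj M) t"
    using At M.inverts_weq_Ho[OF N.category_Ho L\<^sub>0(1)] by (simp add: left_approx_def)
  have "\<exists>L t. is_left_derived M N F L t"
    using left_derived_if_approx[OF L\<^sub>0(1) t\<^sub>0] by blast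
  from someI_ex[OF this, folded Lder_def]
  obtain t' where t': "is_left_derived M N F (Lder M N F) t'" by blast
  then show "is_functor (Ho M) (Ho N) (Lder M N F)" by (simp add: is_left_derived_def)
  show "\<exists>t. left_approx M (Ho N) (ho_proj N \<circ>\<^sub>F F) (Lder M N F \<circ>\<^sub>F ho_proj M) t"
    using approx_if_left_derived[OF L\<^sub>0(1) t\<^sub>0 t'] by blast
qed

text \<open>Over the opposite model structures \<open>preserves_cofibrations\<close> says that
  \<open>F\<close> preserves fibrations and acyclic fibrations.\<close>

lemma Rder_approx:
  assumes "is_functor M N F" "preserves_cofibrations (opm M) (opm N) F"
  shows "is_functor (Ho M) (Ho N) (Rder M N F)"
    "\<exists>t. right_approx M (Ho N) (ho_proj N \<circ>\<^sub>F F) (Rder M N F \<circ>\<^sub>F ho_proj M) t"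
proof -
  note \<Phi> = is_functor_fcomp[OF assms(1) N.is_functor_ho_proj]
  obtain A t where At: "right_approx M (Ho N) (ho_proj N \<circ>\<^sub>F F) A t"
    using M.right_approx_exists[OF N.category_Ho \<Phi>] assms(2) N.is_iso_ho_proj
    by (auto simp: preserves_cofibrations_def)
  then have A: "inverts_weq M (Ho N) A" and t: "nat_trans M (Ho N) (ho_proj N \<circ>\<^sub>F F) A t"
    by (simp_all add: right_approx_def)
  obtain R\<^sub>0 where R\<^sub>0: "is_functor (Ho M) (Ho N) R\<^sub>0" "\<And>x. Fobj R\<^sub>0 x = Fobj A x"
    "\<And>f. f \<in> Arr M \<Longrightarrow> Fmap R\<^sub>0 (Fmap (ho_proj M) f) = Fmap A f"
    using M.extend_to_Ho[OF N.category_Ho A] by blast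
  have "nat_trans M (Ho N) (ho_proj N \<circ>\<^sub>F F) (R\<^sub>0 \<circ>\<^sub>F ho_proj M) t"
    by (rule nat_trans_cong_target[OF t is_functor_fcomp[OF M.is_functor_ho_proj R\<^sub>0(1)]]) (simp_all add: R\<^sub>0)
  then have t\<^sub>0: "right_approx M (Ho N) (ho_proj N \<circ>\<^sub>F F) (R\<^sub>0 \<circ>\<^sub>F ho_proj M) t"
    using At M.inverts_weq_Ho[OF N.category_Ho R\<^sub>0(1)] by (simp add: right_approx_def)
  have "\<exists>R t. is_right_derived M N F R t"
    using right_derived_if_approx[OF R\<^sub>0(1) t\<^sub>0] by blast
  from someI_ex[OF this, folded Rder_def]
  obtain t' where t': "is_right_derived M N F (Rder M N F) t'" by blast
  then show "is_functor (Ho M) (Ho N) (Rder M N F)" by (simp add: is_right_derived_def)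
  show "\<exists>t. right_approx M (Ho N) (ho_proj N \<circ>\<^sub>F F) (Rder M N F \<circ>\<^sub>F ho_proj M) t"
    using approx_if_right_derived[OF R\<^sub>0(1) t\<^sub>0 t'] by blast
qed

end

section \<open>Quillen adjunctions\<close>

text \<open>The square is transposed along the counit, solved in \<open>N\<close>, and its solution
  is transposed back along the unit.\<close>

lemma has_lifting_transpose:
  assumes "category M" "category N" and adj: "adjunction M N F U \<eta> \<epsilon>"
    and [simp]: "i \<in> Arr M" "p \<in> Arr N" and lift: "has_lifting N (Fmap F i) p"
  shows "has_lifting M i (Fmap U p)"
  unfolding has_lifting_def
proof (intro ballI impI)
  interpret M: category M by fact
  interpret N: category N by fact
  note [simp] = functor_simps[OF adjunctionD(1)[OF adj]] functor_simps[OF adjunctionD(2)[OF adj]]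
    adjunction_simps[OF adj]
  fix f g assume f: "f \<in> hom M (Dom M i) (Dom M (Fmap U p))" and g: "g \<in> hom M (Cod M i) (Cod M (Fmap U p))"
    and fg: "Fmap U p \<cdot>\<^bsub>M\<^esub> f = g \<cdot>\<^bsub>M\<^esub> i"
  have [simp]: "f \<in> Arr M" "Dom M f = Dom M i" "Cod M f = Fobj U (Dom N p)"
    "g \<in> Arr M" "Dom M g = Cod M i" "Cod M g = Fobj U (Cod N p)"
    using f g by (simp_all add: hom_def)
  let ?f = "\<epsilon> (Dom N p) \<cdot>\<^bsub>N\<^esub> Fmap F f" and ?g = "\<epsilon> (Cod N p) \<cdot>\<^bsub>N\<^esub> Fmap F g"
  have "p \<cdot>\<^bsub>N\<^esub> ?f = (p \<cdot>\<^bsub>N\<^esub> \<epsilon> (Dom N p)) \<cdot>\<^bsub>N\<^esub> Fmap F f" by simp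
  also have "\<dots> = \<epsilon> (Cod N p) \<cdot>\<^bsub>N\<^esub> Fmap F (Fmap U p \<cdot>\<^bsub>M\<^esub> f)"
    by (subst adjunction_natural(2)[OF adj _ _ refl, symmetric]) simp_all
  also have "\<dots> = ?g \<cdot>\<^bsub>N\<^esub> Fmap F i" by (simp add: fg)
  finally obtain h where h: "h \<in> hom N (Fobj F (Cod M i)) (Dom N p)"
    and hf: "h \<cdot>\<^bsub>N\<^esub> Fmap F i = ?f" and hg: "p \<cdot>\<^bsub>N\<^esub> h = ?g"
    using lift unfolding has_lifting_def by (fastforce simp: hom_def)
  have [simp]: "h \<in> Arr N" "Dom N h = Fobj F (Cod M i)" "Cod N h = Dom N p"
    using h by (simp_all add: hom_def)
  \<comment> \<open>Transposing twice returns the original arrow. This turns each of the two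
    triangles in \<open>N\<close> into the corresponding triangle in \<open>M\<close>.\<close>
  have transpose: "Fmap U (\<epsilon> y \<cdot>\<^bsub>N\<^esub> Fmap F k) \<cdot>\<^bsub>M\<^esub> \<eta> x = k"
    if [simp]: "k \<in> Arr M" "Dom M k = x" "Cod M k = Fobj U y" "y \<in> Obj N" for k x y
  proof -
    have [simp]: "x \<in> Obj M" using that(1,2) M.dom_in by blast
    have "Fmap U (\<epsilon> y \<cdot>\<^bsub>N\<^esub> Fmap F k) \<cdot>\<^bsub>M\<^esub> \<eta> x = Fmap U (\<epsilon> y) \<cdot>\<^bsub>M\<^esub> (Fmap U (Fmap F k) \<cdot>\<^bsub>M\<^esub> \<eta> x)"
      by simp
    also have "\<dots> = Fmap U (\<epsilon> y) \<cdot>\<^bsub>M\<^esub> (\<eta> (Fobj U y) \<cdot>\<^bsub>M\<^esub> k)"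
      using adjunction_natural(1)[OF adj, of k x "Fobj U y"] by simp
    also have "\<dots> = k"
      by (subst M.reassoc[OF adjunctionD(6)[OF adj]]) simp_all
    finally show ?thesis .
  qed
  have "(Fmap U h \<cdot>\<^bsub>M\<^esub> \<eta> (Cod M i)) \<cdot>\<^bsub>M\<^esub> i = Fmap U h \<cdot>\<^bsub>M\<^esub> (\<eta> (Cod M i) \<cdot>\<^bsub>M\<^esub> i)"
    by simp
  also have "\<dots> = Fmap U (h \<cdot>\<^bsub>N\<^esub> Fmap F i) \<cdot>\<^bsub>M\<^esub> \<eta> (Dom M i)"
    using adjunction_natural(1)[OF adj, of i "Dom M i" "Cod M i"] by simp
  also have "\<dots> = f" unfolding hf by (rule transpose) simp_all
  finally have 1: "(Fmap U h \<cdot>\<^bsub>M\<^esub> \<eta> (Cod M i)) \<cdot>\<^bsub>M\<^esub> i = f" .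
  have "Fmap U p \<cdot>\<^bsub>M\<^esub> (Fmap U h \<cdot>\<^bsub>M\<^esub> \<eta> (Cod M i)) = Fmap U (p \<cdot>\<^bsub>N\<^esub> h) \<cdot>\<^bsub>M\<^esub> \<eta> (Cod M i)"
    by simp
  also have "\<dots> = g" unfolding hg by (rule transpose) simp_all
  finally have 2: "Fmap U p \<cdot>\<^bsub>M\<^esub> (Fmap U h \<cdot>\<^bsub>M\<^esub> \<eta> (Cod M i)) = g" .
  show "\<exists>h \<in> hom M (Cod M i) (Dom M (Fmap U p)). h \<cdot>\<^bsub>M\<^esub> i = f \<and> Fmap U p \<cdot>\<^bsub>M\<^esub> h = g"
    by (rule bexI[of _ "Fmap U h \<cdot>\<^bsub>M\<^esub> \<eta> (Cod M i)"]) (simp_all only: 1 2, simp add: hom_def)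
qed

text \<open>The definition mentions only the left adjoint. Fibrations and acyclic fibrations are
  recognized by lifting against acyclic cofibrations and cofibrations, and these lifting problems
  transpose, so the notion is self-dual.\<close>

lemma quillen_adjunction_op:
  assumes "model_category M" "model_category N" "quillen_adjunction M N F U"
  shows "quillen_adjunction (opm N) (opm M) U F"
proof -
  interpret M: model_category M by fact
  interpret N: model_category N by fact
  interpret M': model_category "opm M" by (rule M.opposite)
  obtain \<eta> \<epsilon> where adj: "adjunction M N F U \<eta> \<epsilon>" and F: "preserves_cofibrations M N F"
    using assms(3) by (auto simp: quillen_adjunction_def)
  note [simp] = functor_simps[OF adjunctionD(2)[OF adj]]
  have "Fmap U p \<in> Fib M" if p: "p \<in> Fib N" for p
  proof -
    have "has_lifting (opm M) (Fmap U p) i" if "i \<in> Cof M \<inter> Weq M" for i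
      using p that F
      by (intro has_lifting_op has_lifting_transpose[OF M.category_axioms N.category_axioms adj]
          N.lift_acyclic_cof) (auto simp: preserves_cofibrations_def)
    then show ?thesis using M'.cof_if_lifting[of "Fmap U p"] p by simp
  qed
  moreover have "Fmap U p \<in> Fib M \<inter> Weq M" if p: "p \<in> Fib N \<inter> Weq N" for p
  proof -
    have "has_lifting (opm M) (Fmap U p) i" if "i \<in> Cof M" for i
      using p that F
      by (intro has_lifting_op has_lifting_transpose[OF M.category_axioms N.category_axioms adj]
          N.lift_acyclic_fib) (auto simp: preserves_cofibrations_def)
    then show ?thesis using M'.acyclic_cof_if_lifting[of "Fmap U p"] p by simp
  qed
  ultimately have "preserves_cofibrations (opm N) (opm M) U"
    by (simp add: preserves_cofibrations_def)
  then show ?thesis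
    using adj unfolding quillen_adjunction_def adjunction_opm by blast
qed

text \<open>A lifting problem out of \<open>F x\<close> is transposed to one out of \<open>x\<close>
  against the image of an acyclic fibration under \<open>U\<close>, which is again an acyclic
  fibration.\<close>

lemma quillen_preserves_cofibrant:
  assumes "model_category M" "model_category N" "quillen_adjunction M N F U" "cofibrant M x"
  shows "cofibrant N (Fobj F x)"
proof -
  interpret M: model_category M by fact
  interpret N: model_category N by fact
  obtain \<eta> \<epsilon> where adj: "adjunction M N F U \<eta> \<epsilon>"
    using assms(3) by (auto simp: quillen_adjunction_def)
  have U: "preserves_cofibrations (opm N) (opm M) U"
    using quillen_adjunction_op[OF assms(1-3)] by (simp add: quillen_adjunction_def)
  note [simp] = functor_simps[OF adjunctionD(1)[OF adj]] functor_simps[OF adjunctionD(2)[OF adj]]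
    adjunction_simps[OF adj] M.cofibrant_obj[OF assms(4)]
  show ?thesis
  proof (rule N.cofibrantI)
    fix p g assume p: "p \<in> Fib N \<inter> Weq N" and g: "g \<in> hom N (Fobj F x) (Cod N p)"
    have [simp]: "p \<in> Arr N" "g \<in> Arr N" "Dom N g = Fobj F x" "Cod N g = Cod N p"
      using p g by (auto simp: hom_def)
    have "Fmap U g \<cdot>\<^bsub>M\<^esub> \<eta> x \<in> hom M x (Cod M (Fmap U p))"
      by (simp add: hom_def)
    moreover have "Fmap U p \<in> Fib M \<inter> Weq M"
      using U p by (simp add: preserves_cofibrations_def)
    ultimately obtain h where h: "h \<in> hom M x (Dom M (Fmap U p))" "Fmap U p \<cdot>\<^bsub>M\<^esub> h = Fmap U g \<cdot>\<^bsub>M\<^esub> \<eta> x"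
      using M.cofibrant_lift[OF assms(4)] by blast
    have [simp]: "h \<in> Arr M" "Dom M h = x" "Cod M h = Fobj U (Dom N p)"
      using h by (auto simp: hom_def)
    have "p \<cdot>\<^bsub>N\<^esub> (\<epsilon> (Dom N p) \<cdot>\<^bsub>N\<^esub> Fmap F h) = (\<epsilon> (Cod N p) \<cdot>\<^bsub>N\<^esub> Fmap F (Fmap U p)) \<cdot>\<^bsub>N\<^esub> Fmap F h"
      by (subst adjunction_natural(2)[OF adj _ refl]) simp_all
    also have "\<dots> = \<epsilon> (Cod N p) \<cdot>\<^bsub>N\<^esub> Fmap F (Fmap U p \<cdot>\<^bsub>M\<^esub> h)" by simp
    also have "\<dots> = (\<epsilon> (Cod N p) \<cdot>\<^bsub>N\<^esub> Fmap F (Fmap U g)) \<cdot>\<^bsub>N\<^esub> Fmap F (\<eta> x)"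
      unfolding h(2) by simp
    also have "\<dots> = g \<cdot>\<^bsub>N\<^esub> (\<epsilon> (Fobj F x) \<cdot>\<^bsub>N\<^esub> Fmap F (\<eta> x))"
      using adjunction_natural(2)[OF adj, of g "Fobj F x" "Cod N p"] by simp
    also have "\<dots> = g" by (simp add: adjunctionD(5)[OF adj])
    finally show "\<exists>h \<in> hom N (Fobj F x) (Dom N p). p \<cdot>\<^bsub>N\<^esub> h = g"
      by (rule bexI[of _ "\<epsilon> (Dom N p) \<cdot>\<^bsub>N\<^esub> Fmap F h"]) (simp add: hom_def)
  qed simp
qed

lemma quillen_preserves_fibrant:
  assumes "model_category M" "model_category N" "quillen_adjunction M N F U" "fibrant N y"
  shows "fibrant M (Fobj U y)"
  using quillen_preserves_cofibrant[OF model_category_opm[OF assms(2)] model_category_opm[OF assms(1)]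
      quillen_adjunction_op[OF assms(1-3)], of y] assms(4)
  by simp

lemma quillen_adjunctionD:
  assumes "model_category M" "model_category N" "quillen_adjunction M N F U"
  shows "is_functor M N F" "is_functor N M U" "preserves_cofibrations M N F"
    "preserves_cofibrations (opm N) (opm M) U"
  using assms(3) quillen_adjunction_op[OF assms] by (auto simp: quillen_adjunction_def adjunction_def)

lemma Lder_Quillen:
  assumes "model_category M" "model_category N" "quillen_adjunction M N F U"
  shows "is_functor (Ho M) (Ho N) (Lder M N F)"
    "\<exists>t. left_approx M (Ho N) (ho_proj N \<circ>\<^sub>F F) (Lder M N F \<circ>\<^sub>F ho_proj M) t"
  using model_pair.Lder_approx[OF model_pair.intro[OF assms(1,2)] quillen_adjunctionD(1,3)[OF assms]] .

lemma Rder_Quillen: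
  assumes "model_category M" "model_category N" "quillen_adjunction M N F U"
  shows "is_functor (Ho N) (Ho M) (Rder N M U)"
    "\<exists>s. right_approx N (Ho M) (ho_proj M \<circ>\<^sub>F U) (Rder N M U \<circ>\<^sub>F ho_proj N) s"
  using model_pair.Rder_approx[OF model_pair.intro[OF assms(2,1)] quillen_adjunctionD(2,4)[OF assms]] .

section \<open>The derived adjunction\<close>

text \<open>The equations \<open>unit\<close> and \<open>counit\<close> say that \<open>e\<close>
  and \<open>c\<close> lie over \<eta> and \<epsilon> along \<open>t\<close> and \<open>s\<close>.
  Together with naturality they replace explicit formulas through replacements in the proofs of the
  triangle identities.\<close>

locale derived_pair = model_pair M N
  for M :: "('o, 'm, 'y) model_cat_scheme" and N :: "('p, 'n, 'z) model_cat_scheme" +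
  fixes F U \<eta> \<epsilon> L R t s e c
  assumes adj: "adjunction M N F U \<eta> \<epsilon>"
    and L: "is_functor (Ho M) (Ho N) L" and R: "is_functor (Ho N) (Ho M) R"
    and t: "left_approx M (Ho N) (ho_proj N \<circ>\<^sub>F F) (L \<circ>\<^sub>F ho_proj M) t"
    and s: "right_approx N (Ho M) (ho_proj M \<circ>\<^sub>F U) (R \<circ>\<^sub>F ho_proj N) s"
    and e: "nat_trans (Ho M) (Ho M) id_ftor (R \<circ>\<^sub>F L) e"
    and c: "nat_trans (Ho N) (Ho N) (L \<circ>\<^sub>F R) id_ftor c"
    and unit: "x \<in> Obj M \<Longrightarrow> Fmap R (t x) \<cdot>\<^bsub>Ho M\<^esub> e x = s (Fobj F x) \<cdot>\<^bsub>Ho M\<^esub> Fmap (ho_proj M) (\<eta> x)"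
    and counit: "y \<in> Obj N \<Longrightarrow> c y \<cdot>\<^bsub>Ho N\<^esub> Fmap L (s y) = Fmap (ho_proj N) (\<epsilon> y) \<cdot>\<^bsub>Ho N\<^esub> t (Fobj U y)"

lemma derived_pair_exists:
  assumes "model_pair M N" and adj: "adjunction M N F U \<eta> \<epsilon>"
    and L: "is_functor (Ho M) (Ho N) L" and R: "is_functor (Ho N) (Ho M) R"
    and t: "left_approx M (Ho N) (ho_proj N \<circ>\<^sub>F F) (L \<circ>\<^sub>F ho_proj M) t"
    and s: "right_approx N (Ho M) (ho_proj M \<circ>\<^sub>F U) (R \<circ>\<^sub>F ho_proj N) s"
  shows "\<exists>e c. derived_pair M N F U \<eta> \<epsilon> L R t s e c"
proof -
  interpret model_pair M N by fact
  note cats = M.category_Ho N.category_Ho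
  have F: "is_functor M N F" and U: "is_functor N M U"
    using adjunctionD(1,2)[OF adj] .
  have t': "nat_trans M (Ho N) (L \<circ>\<^sub>F ho_proj M) (ho_proj N \<circ>\<^sub>F F) t"
    using t by (simp add: left_approx_def)
  have s': "nat_trans N (Ho M) (ho_proj M \<circ>\<^sub>F U) (R \<circ>\<^sub>F ho_proj N) s"
    using s by (simp add: right_approx_def)
  \<comment> \<open>By \<open>left_approx_fcomp\<close>, \<open>R \<circ>\<^sub>F L\<close> is
    universal over \<open>R \<circ>\<^sub>F (ho_proj N \<circ>\<^sub>F F)\<close>. The unit is
    obtained by factoring this transformation, whose source \<open>ho_proj M\<close> inverts weak
    equivalences; the counit arises dually.\<close>
  have "nat_trans M (Ho M) (ho_proj M) (R \<circ>\<^sub>F (ho_proj N \<circ>\<^sub>F F))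
      (\<lambda>x. s (Fobj F x) \<cdot>\<^bsub>Ho M\<^esub> Fmap (ho_proj M) (\<eta> x))"
    using nat_trans_comp[OF M.category_axioms cats(1)
        nat_trans_whisker_left[OF adjunctionD(3)[OF adj] M.is_functor_ho_proj M.category_axioms, folded fcomp_assoc]
        nat_trans_whisker_right[OF s' F M.category_axioms]]
    by (simp add: fcomp_assoc)
  from M.left_approx_universal[OF cats(1)
      left_approx_fcomp[OF M.category_axioms cats(2,1) t R] M.inverts_weq_ho_proj this]
  obtain e where e: "nat_trans M (Ho M) (ho_proj M) (R \<circ>\<^sub>F (L \<circ>\<^sub>F ho_proj M)) e"
    "\<And>x. x \<in> Obj M \<Longrightarrow> Fmap R (t x) \<cdot>\<^bsub>Ho M\<^esub> e x = s (Fobj F x) \<cdot>\<^bsub>Ho M\<^esub> Fmap (ho_proj M) (\<eta> x)"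
    by blast
  have "nat_trans N (Ho N) (L \<circ>\<^sub>F (ho_proj M \<circ>\<^sub>F U)) (ho_proj N)
      (\<lambda>y. Fmap (ho_proj N) (\<epsilon> y) \<cdot>\<^bsub>Ho N\<^esub> t (Fobj U y))"
    using nat_trans_comp[OF N.category_axioms cats(2)
        nat_trans_whisker_right[OF t' U N.category_axioms, unfolded fcomp_assoc]
        nat_trans_whisker_left[OF adjunctionD(4)[OF adj] N.is_functor_ho_proj N.category_axioms]]
    by (simp add: fcomp_assoc)
  from N.right_approx_universal[OF cats(2)
      right_approx_fcomp[OF N.category_axioms cats s L] N.inverts_weq_ho_proj this]
  obtain c where c: "nat_trans N (Ho N) (L \<circ>\<^sub>F (R \<circ>\<^sub>F ho_proj N)) (ho_proj N) c"
    "\<And>y. y \<in> Obj N \<Longrightarrow> c y \<cdot>\<^bsub>Ho N\<^esub> Fmap L (s y) = Fmap (ho_proj N) (\<epsilon> y) \<cdot>\<^bsub>Ho N\<^esub> t (Fobj U y)"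
    by blast
  have "nat_trans (Ho M) (Ho M) id_ftor (R \<circ>\<^sub>F L) e"
    by (rule M.nat_trans_Ho[OF cats(1) is_functor_id is_functor_fcomp[OF L R]])
      (use e(1) in \<open>simp add: fcomp_assoc\<close>)
  moreover have "nat_trans (Ho N) (Ho N) (L \<circ>\<^sub>F R) id_ftor c"
    by (rule N.nat_trans_Ho[OF cats(2) is_functor_fcomp[OF R L] is_functor_id])
      (use c(1) in \<open>simp add: fcomp_assoc\<close>)
  ultimately show ?thesis
    using derived_pair.intro[OF assms(1)] derived_pair_axioms.intro[OF adj L R t s, of e c] e(2) c(2) by blast
qed

context derived_pair
begin

lemma t_nat: "nat_trans M (Ho N) (L \<circ>\<^sub>F ho_proj M) (ho_proj N \<circ>\<^sub>F F) t"
  and t_iso: "cofibrant M x \<Longrightarrow> is_iso (Ho N) (t x)"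
  using t by (auto simp: left_approx_def)

lemma s_nat: "nat_trans N (Ho M) (ho_proj M \<circ>\<^sub>F U) (R \<circ>\<^sub>F ho_proj N) s"
  and s_iso: "fibrant N y \<Longrightarrow> is_iso (Ho M) (s y)"
  using s by (auto simp: right_approx_def)

lemmas arrow_simps = functor_simps[OF L, unfolded M.Ho_simps(1) N.Ho_simps(1)]
  functor_simps[OF R, unfolded M.Ho_simps(1) N.Ho_simps(1)] functor_simps[OF M.is_functor_ho_proj]
  functor_simps[OF N.is_functor_ho_proj] functor_simps[OF adjunctionD(1)[OF adj]]
  functor_simps[OF adjunctionD(2)[OF adj]] adjunction_simps[OF adj]
  nat_trans_simps[OF t_nat] nat_trans_simps[OF s_nat] nat_trans_simps[OF e] nat_trans_simps[OF c]

text \<open>At a cofibrant object \<open>t x\<close> may be cancelled. Naturality of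
  \<open>c\<close> and of \<open>t\<close>, together with \<open>unit\<close> and
  \<open>counit\<close>, then carries the identity back to the triangle identity of the original
  adjunction.\<close>

lemma triangle_left:
  assumes "x \<in> Obj M"
  shows "c (Fobj L x) \<cdot>\<^bsub>Ho N\<^esub> Fmap L (e x) = Id (Ho N) (Fobj L x)"
proof -
  interpret HM: category "Ho M" by (rule M.category_Ho)
  interpret HN: category "Ho N" by (rule N.category_Ho)
  note [simp] = arrow_simps
  note cats = M.category_Ho N.category_Ho
  show ?thesis
  proof (rule M.eq_if_eq_on_cofibrant[OF cats(2) M.inverts_weq_Ho[OF cats(2) L] _ _ _ assms,
        where \<eta> = "\<lambda>x. c (Fobj L x) \<cdot>\<^bsub>Ho N\<^esub> Fmap L (e x)" and \<mu> = "\<lambda>x. Id (Ho N) (Fobj L x)"])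
    have "nat_trans (Ho M) (Ho N) L L (\<lambda>x. c (Fobj L x) \<cdot>\<^bsub>Ho N\<^esub> Fmap L (e x))"
      using nat_trans_comp[OF cats nat_trans_whisker_left[OF e L cats(1)]
          nat_trans_whisker_right[OF c L cats(1), unfolded fcomp_assoc]] by simp
    from nat_trans_whisker_right[OF this M.is_functor_ho_proj M.category_axioms]
    show "nat_trans M (Ho N) (L \<circ>\<^sub>F ho_proj M) (L \<circ>\<^sub>F ho_proj M) (\<lambda>x. c (Fobj L x) \<cdot>\<^bsub>Ho N\<^esub> Fmap L (e x))"
      by simp
    from nat_trans_whisker_right[OF nat_trans_id[OF cats L] M.is_functor_ho_proj M.category_axioms]
    show "nat_trans M (Ho N) (L \<circ>\<^sub>F ho_proj M) (L \<circ>\<^sub>F ho_proj M) (\<lambda>x. Id (Ho N) (Fobj L x))"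
      by simp
    fix x assume x: "cofibrant M x"
    have [simp]: "x \<in> Obj M" by (rule M.cofibrant_obj[OF x])
    show "c (Fobj L x) \<cdot>\<^bsub>Ho N\<^esub> Fmap L (e x) = Id (Ho N) (Fobj L x)"
    proof (rule HN.iso_cancel_left[OF t_iso[OF x]])
      have "t x \<cdot>\<^bsub>Ho N\<^esub> (c (Fobj L x) \<cdot>\<^bsub>Ho N\<^esub> Fmap L (e x)) =
          (t x \<cdot>\<^bsub>Ho N\<^esub> c (Fobj L x)) \<cdot>\<^bsub>Ho N\<^esub> Fmap L (e x)"
        by simp
      also have "t x \<cdot>\<^bsub>Ho N\<^esub> c (Fobj L x) = c (Fobj F x) \<cdot>\<^bsub>Ho N\<^esub> Fmap L (Fmap R (t x))"
        using nat_trans_natural[OF c, of "t x"] by simp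
      also have "(c (Fobj F x) \<cdot>\<^bsub>Ho N\<^esub> Fmap L (Fmap R (t x))) \<cdot>\<^bsub>Ho N\<^esub> Fmap L (e x) =
          c (Fobj F x) \<cdot>\<^bsub>Ho N\<^esub> Fmap L (Fmap R (t x) \<cdot>\<^bsub>Ho M\<^esub> e x)"
        by simp
      also have "\<dots> = (c (Fobj F x) \<cdot>\<^bsub>Ho N\<^esub> Fmap L (s (Fobj F x))) \<cdot>\<^bsub>Ho N\<^esub> Fmap L (Fmap (ho_proj M) (\<eta> x))"
        by (simp add: unit)
      also have "\<dots> = Fmap (ho_proj N) (\<epsilon> (Fobj F x)) \<cdot>\<^bsub>Ho N\<^esub>
          (t (Fobj U (Fobj F x)) \<cdot>\<^bsub>Ho N\<^esub> Fmap L (Fmap (ho_proj M) (\<eta> x)))"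
        by (simp add: counit)
      also have "t (Fobj U (Fobj F x)) \<cdot>\<^bsub>Ho N\<^esub> Fmap L (Fmap (ho_proj M) (\<eta> x)) =
          Fmap (ho_proj N) (Fmap F (\<eta> x)) \<cdot>\<^bsub>Ho N\<^esub> t x"
        using nat_trans_natural[OF t_nat, of "\<eta> x"] by simp
      also have "Fmap (ho_proj N) (\<epsilon> (Fobj F x)) \<cdot>\<^bsub>Ho N\<^esub> \<dots> =
          Fmap (ho_proj N) (\<epsilon> (Fobj F x) \<cdot>\<^bsub>N\<^esub> Fmap F (\<eta> x)) \<cdot>\<^bsub>Ho N\<^esub> t x"
        by simp
      also have "\<dots> = t x \<cdot>\<^bsub>Ho N\<^esub> Id (Ho N) (Fobj L x)"
        by (simp add: adjunctionD(5)[OF adj])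
      finally show "t x \<cdot>\<^bsub>Ho N\<^esub> (c (Fobj L x) \<cdot>\<^bsub>Ho N\<^esub> Fmap L (e x)) = t x \<cdot>\<^bsub>Ho N\<^esub> Id (Ho N) (Fobj L x)" .
    qed simp_all
  qed
qed

lemma triangle_right:
  assumes "y \<in> Obj N"
  shows "Fmap R (c y) \<cdot>\<^bsub>Ho M\<^esub> e (Fobj R y) = Id (Ho M) (Fobj R y)"
proof -
  interpret HM: category "Ho M" by (rule M.category_Ho)
  interpret HN: category "Ho N" by (rule N.category_Ho)
  note [simp] = arrow_simps
  note cats = M.category_Ho N.category_Ho
  show ?thesis
  proof (rule N.eq_if_eq_on_fibrant[OF cats(1) N.inverts_weq_Ho[OF cats(1) R] _ _ _ assms,
        where \<eta> = "\<lambda>y. Fmap R (c y) \<cdot>\<^bsub>Ho M\<^esub> e (Fobj R y)" and \<mu> = "\<lambda>y. Id (Ho M) (Fobj R y)"])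
    have "nat_trans (Ho N) (Ho M) R R (\<lambda>y. Fmap R (c y) \<cdot>\<^bsub>Ho M\<^esub> e (Fobj R y))"
      using nat_trans_comp[OF cats(2,1) nat_trans_whisker_right[OF e R cats(2), unfolded fcomp_assoc]
          nat_trans_whisker_left[OF c R cats(2)]] by simp
    from nat_trans_whisker_right[OF this N.is_functor_ho_proj N.category_axioms]
    show "nat_trans N (Ho M) (R \<circ>\<^sub>F ho_proj N) (R \<circ>\<^sub>F ho_proj N) (\<lambda>y. Fmap R (c y) \<cdot>\<^bsub>Ho M\<^esub> e (Fobj R y))"
      by simp
    from nat_trans_whisker_right[OF nat_trans_id[OF cats(2,1) R] N.is_functor_ho_proj N.category_axioms]
    show "nat_trans N (Ho M) (R \<circ>\<^sub>F ho_proj N) (R \<circ>\<^sub>F ho_proj N) (\<lambda>y. Id (Ho M) (Fobj R y))"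
      by simp
    fix y assume y: "fibrant N y"
    have [simp]: "y \<in> Obj N" using y by (simp add: fibrant_def)
    show "Fmap R (c y) \<cdot>\<^bsub>Ho M\<^esub> e (Fobj R y) = Id (Ho M) (Fobj R y)"
    proof (rule HM.iso_cancel_right[OF s_iso[OF y]])
      have "(Fmap R (c y) \<cdot>\<^bsub>Ho M\<^esub> e (Fobj R y)) \<cdot>\<^bsub>Ho M\<^esub> s y =
          Fmap R (c y) \<cdot>\<^bsub>Ho M\<^esub> (e (Fobj R y) \<cdot>\<^bsub>Ho M\<^esub> s y)"
        by simp
      also have "e (Fobj R y) \<cdot>\<^bsub>Ho M\<^esub> s y = Fmap R (Fmap L (s y)) \<cdot>\<^bsub>Ho M\<^esub> e (Fobj U y)"
        using nat_trans_natural[OF e, of "s y"] by simp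
      also have "Fmap R (c y) \<cdot>\<^bsub>Ho M\<^esub> \<dots> = Fmap R (c y \<cdot>\<^bsub>Ho N\<^esub> Fmap L (s y)) \<cdot>\<^bsub>Ho M\<^esub> e (Fobj U y)"
        by simp
      also have "\<dots> = Fmap R (Fmap (ho_proj N) (\<epsilon> y)) \<cdot>\<^bsub>Ho M\<^esub> (Fmap R (t (Fobj U y)) \<cdot>\<^bsub>Ho M\<^esub> e (Fobj U y))"
        by (simp add: counit)
      also have "\<dots> = (Fmap R (Fmap (ho_proj N) (\<epsilon> y)) \<cdot>\<^bsub>Ho M\<^esub> s (Fobj F (Fobj U y))) \<cdot>\<^bsub>Ho M\<^esub>
          Fmap (ho_proj M) (\<eta> (Fobj U y))"
        by (simp add: unit)
      also have "Fmap R (Fmap (ho_proj N) (\<epsilon> y)) \<cdot>\<^bsub>Ho M\<^esub> s (Fobj F (Fobj U y)) =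
          s y \<cdot>\<^bsub>Ho M\<^esub> Fmap (ho_proj M) (Fmap U (\<epsilon> y))"
        using nat_trans_natural[OF s_nat, of "\<epsilon> y"] by simp
      also have "(s y \<cdot>\<^bsub>Ho M\<^esub> Fmap (ho_proj M) (Fmap U (\<epsilon> y))) \<cdot>\<^bsub>Ho M\<^esub> Fmap (ho_proj M) (\<eta> (Fobj U y)) =
          s y \<cdot>\<^bsub>Ho M\<^esub> Fmap (ho_proj M) (Fmap U (\<epsilon> y) \<cdot>\<^bsub>M\<^esub> \<eta> (Fobj U y))"
        by simp
      also have "\<dots> = Id (Ho M) (Fobj R y) \<cdot>\<^bsub>Ho M\<^esub> s y"
        by (simp add: adjunctionD(6)[OF adj])
      finally show "(Fmap R (c y) \<cdot>\<^bsub>Ho M\<^esub> e (Fobj R y)) \<cdot>\<^bsub>Ho M\<^esub> s y = Id (Ho M) (Fobj R y) \<cdot>\<^bsub>Ho M\<^esub> s y" .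
    qed simp_all
  qed
qed

lemma derived_adjunction: "adjunction (Ho M) (Ho N) L R e c"
  unfolding adjunction_def using L R e c triangle_left triangle_right by simp

end

section \<open>Invertible unit and counit for a Quillen equivalence\<close>

context derived_pair
begin

context
  assumes equiv: "\<And>x y f. cofibrant M x \<Longrightarrow> fibrant N y \<Longrightarrow> f \<in> hom N (Fobj F x) y \<Longrightarrow>
    f \<in> Weq N \<longleftrightarrow> Fmap U f \<cdot>\<^bsub>M\<^esub> \<eta> x \<in> Weq M"
begin

text \<open>For cofibrant \<open>x\<close> take a fibrant replacement \<open>j\<close> of
  \<open>F x\<close>: its adjunct is a weak equivalence, and \<open>s\<close> is invertible at the
  fibrant codomain of \<open>j\<close>. Naturality of \<open>s\<close> factors the resulting
  isomorphism through \<open>e x\<close>, with the images of \<open>j\<close> and \<open>t x\<close>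
  as invertible factors.\<close>

lemma unit_iso:
  assumes "x \<in> Obj M"
  shows "is_iso (Ho M) (e x)"
proof -
  interpret HM: category "Ho M" by (rule M.category_Ho)
  interpret HN: category "Ho N" by (rule N.category_Ho)
  note [simp] = arrow_simps
  note cats = M.category_Ho N.category_Ho
  have e': "nat_trans M (Ho M) (ho_proj M) ((R \<circ>\<^sub>F L) \<circ>\<^sub>F ho_proj M) e"
    using nat_trans_whisker_right[OF e M.is_functor_ho_proj M.category_axioms] by simp
  show ?thesis
  proof (rule M.iso_if_iso_on_cofibrant[OF cats(1) M.inverts_weq_ho_proj
        M.inverts_weq_Ho[OF cats(1) is_functor_fcomp[OF L R]] e' _ assms])
    fix x assume x: "cofibrant M x"
    have [simp]: "x \<in> Obj M" by (rule M.cofibrant_obj[OF x])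
    obtain j where j: "j \<in> Weq N" "Dom N j = Fobj F x" "fibrant N (Cod N j)"
      using N.fibrant_replacement_exists[of "Fobj F x"] by auto
    have [simp]: "j \<in> Arr N" using j by simp
    have "Fmap U j \<cdot>\<^bsub>M\<^esub> \<eta> x \<in> Weq M"
      using equiv[OF x j(3), of j] j by (simp add: hom_def)
    then have "is_iso (Ho M) (s (Cod N j) \<cdot>\<^bsub>Ho M\<^esub> Fmap (ho_proj M) (Fmap U j \<cdot>\<^bsub>M\<^esub> \<eta> x))"
      by (intro HM.is_iso_comp M.is_iso_ho_proj s_iso j(3)) (simp_all add: j)
    also have "s (Cod N j) \<cdot>\<^bsub>Ho M\<^esub> Fmap (ho_proj M) (Fmap U j \<cdot>\<^bsub>M\<^esub> \<eta> x) =
        (s (Cod N j) \<cdot>\<^bsub>Ho M\<^esub> Fmap (ho_proj M) (Fmap U j)) \<cdot>\<^bsub>Ho M\<^esub> Fmap (ho_proj M) (\<eta> x)"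
      by (simp add: j)
    also have "s (Cod N j) \<cdot>\<^bsub>Ho M\<^esub> Fmap (ho_proj M) (Fmap U j) =
        Fmap R (Fmap (ho_proj N) j) \<cdot>\<^bsub>Ho M\<^esub> s (Fobj F x)"
      using nat_trans_natural[OF s_nat, of j] by (simp add: j)
    also have "(Fmap R (Fmap (ho_proj N) j) \<cdot>\<^bsub>Ho M\<^esub> s (Fobj F x)) \<cdot>\<^bsub>Ho M\<^esub> Fmap (ho_proj M) (\<eta> x) =
        Fmap R (Fmap (ho_proj N) j) \<cdot>\<^bsub>Ho M\<^esub> (Fmap R (t x) \<cdot>\<^bsub>Ho M\<^esub> e x)"
      by (simp add: j unit)
    finally have "is_iso (Ho M) (Fmap R (t x) \<cdot>\<^bsub>Ho M\<^esub> e x)"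
      using functor_is_iso(1)[OF cats(2,1) R N.is_iso_ho_proj[OF j(1)]]
      by (rule HM.is_iso_right_factor) (simp_all add: j)
    then show "is_iso (Ho M) (e x)"
      using functor_is_iso(1)[OF cats(2,1) R t_iso[OF x]]
      by (rule HM.is_iso_right_factor) simp_all
  qed
qed

text \<open>Dually, a cofibrant replacement \<open>q\<close> of \<open>U y\<close> is the adjunct of
  an arrow \<open>F (Dom M q) \<rightarrow> y\<close>, which is therefore a weak equivalence when
  \<open>y\<close> is fibrant.\<close>

lemma counit_iso:
  assumes "y \<in> Obj N"
  shows "is_iso (Ho N) (c y)"
proof -
  interpret HM: category "Ho M" by (rule M.category_Ho)
  interpret HN: category "Ho N" by (rule N.category_Ho)
  note [simp] = arrow_simps
  note cats = M.category_Ho N.category_Ho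
  have c': "nat_trans N (Ho N) ((L \<circ>\<^sub>F R) \<circ>\<^sub>F ho_proj N) (ho_proj N) c"
    using nat_trans_whisker_right[OF c N.is_functor_ho_proj N.category_axioms] by simp
  show ?thesis
  proof (rule N.iso_if_iso_on_fibrant[OF cats(2) N.inverts_weq_Ho[OF cats(2) is_functor_fcomp[OF R L]]
        N.inverts_weq_ho_proj c' _ assms])
    fix y assume y: "fibrant N y"
    have [simp]: "y \<in> Obj N" using y by (simp add: fibrant_def)
    obtain q where q: "q \<in> Weq M" "Cod M q = Fobj U y" "cofibrant M (Dom M q)"
      using M.cofibrant_replacement_exists[of "Fobj U y"] by auto
    have [simp]: "q \<in> Arr M" using q by simp
    let ?f = "\<epsilon> y \<cdot>\<^bsub>N\<^esub> Fmap F q"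
    \<comment> \<open>The adjunct of \<open>?f\<close> is \<open>q\<close> itself, by naturality of
      \<eta> and a triangle identity.\<close>
    have "Fmap U ?f \<cdot>\<^bsub>M\<^esub> \<eta> (Dom M q) = Fmap U (\<epsilon> y) \<cdot>\<^bsub>M\<^esub> (Fmap U (Fmap F q) \<cdot>\<^bsub>M\<^esub> \<eta> (Dom M q))"
      by (simp add: q)
    also have "\<dots> = Fmap U (\<epsilon> y) \<cdot>\<^bsub>M\<^esub> (\<eta> (Fobj U y) \<cdot>\<^bsub>M\<^esub> q)"
      using adjunction_natural(1)[OF adj, of q] q by simp
    also have "\<dots> = q"
      by (subst M.reassoc[OF adjunctionD(6)[OF adj]]) (simp_all add: q)
    finally have "?f \<in> Weq N"
      using equiv[OF q(3) y, of ?f] q by (simp add: hom_def)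
    then have "is_iso (Ho N) (Fmap (ho_proj N) ?f \<cdot>\<^bsub>Ho N\<^esub> t (Dom M q))"
      by (intro HN.is_iso_comp N.is_iso_ho_proj t_iso q(3)) (simp_all add: q)
    also have "Fmap (ho_proj N) ?f \<cdot>\<^bsub>Ho N\<^esub> t (Dom M q) =
        Fmap (ho_proj N) (\<epsilon> y) \<cdot>\<^bsub>Ho N\<^esub> (Fmap (ho_proj N) (Fmap F q) \<cdot>\<^bsub>Ho N\<^esub> t (Dom M q))"
      by (simp add: q)
    also have "Fmap (ho_proj N) (Fmap F q) \<cdot>\<^bsub>Ho N\<^esub> t (Dom M q) =
        t (Fobj U y) \<cdot>\<^bsub>Ho N\<^esub> Fmap L (Fmap (ho_proj M) q)"
      using nat_trans_natural[OF t_nat, of q] by (simp add: q)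
    also have "Fmap (ho_proj N) (\<epsilon> y) \<cdot>\<^bsub>Ho N\<^esub> (t (Fobj U y) \<cdot>\<^bsub>Ho N\<^esub> Fmap L (Fmap (ho_proj M) q)) =
        (Fmap (ho_proj N) (\<epsilon> y) \<cdot>\<^bsub>Ho N\<^esub> t (Fobj U y)) \<cdot>\<^bsub>Ho N\<^esub> Fmap L (Fmap (ho_proj M) q)"
      by (simp add: q)
    finally have "is_iso (Ho N) (Fmap (ho_proj N) (\<epsilon> y) \<cdot>\<^bsub>Ho N\<^esub> t (Fobj U y))"
      using functor_is_iso(1)[OF cats L M.is_iso_ho_proj[OF q(1)]]
      by (rule HN.is_iso_left_factor) (simp_all add: q)
    then have "is_iso (Ho N) (c y \<cdot>\<^bsub>Ho N\<^esub> Fmap L (s y))"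
      by (simp add: counit)
    then show "is_iso (Ho N) (c y)"
      using functor_is_iso(1)[OF cats L s_iso[OF y]]
      by (rule HN.is_iso_left_factor) simp_all
  qed
qed

end

end

section \<open>Derived adjunctions and equivalences for the chosen functors\<close>

lemma derived_adjunction:
  assumes "model_category M" "model_category N" "quillen_adjunction M N F U"
  shows "\<exists>\<eta> \<epsilon>. adjunction (Ho M) (Ho N) (Lder M N F) (Rder N M U) \<eta> \<epsilon>"
proof -
  obtain \<eta> \<epsilon> where adj: "adjunction M N F U \<eta> \<epsilon>"
    using assms(3) by (auto simp: quillen_adjunction_def)
  obtain t s where t: "left_approx M (Ho N) (ho_proj N \<circ>\<^sub>F F) (Lder M N F \<circ>\<^sub>F ho_proj M) t"
    and s: "right_approx N (Ho M) (ho_proj M \<circ>\<^sub>F U) (Rder N M U \<circ>\<^sub>F ho_proj N) s"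
    using Lder_Quillen(2)[OF assms] Rder_Quillen(2)[OF assms] by blast
  show ?thesis
    using derived_pair_exists[OF model_pair.intro[OF assms(1,2)] adj Lder_Quillen(1)[OF assms]
        Rder_Quillen(1)[OF assms] t s] derived_pair.derived_adjunction by blast
qed

lemma quillen_equivalence_adjunction:
  "quillen_equivalence M N F U \<Longrightarrow> quillen_adjunction M N F U"
  by (auto simp: quillen_equivalence_def quillen_adjunction_def)

lemma derived_equivalence:
  assumes "model_category M" "model_category N" "quillen_equivalence M N F U"
  shows "nat_isomorphic (Ho M) (Ho M) id_ftor (Rder N M U \<circ>\<^sub>F Lder M N F)"
    "nat_isomorphic (Ho N) (Ho N) (Lder M N F \<circ>\<^sub>F Rder N M U) id_ftor"
proof -
  note qa = quillen_equivalence_adjunction[OF assms(3)]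
  \<comment> \<open>The adjunct condition refers to a particular unit, so \<eta> and the condition
    are obtained from the same witness.\<close>
  obtain \<eta> \<epsilon> where adj: "adjunction M N F U \<eta> \<epsilon>"
    and equiv: "\<And>x y f. cofibrant M x \<Longrightarrow> fibrant N y \<Longrightarrow> f \<in> hom N (Fobj F x) y \<Longrightarrow>
      f \<in> Weq N \<longleftrightarrow> Fmap U f \<cdot>\<^bsub>M\<^esub> \<eta> x \<in> Weq M"
    using assms(3) unfolding quillen_equivalence_def by blast
  obtain t s where t: "left_approx M (Ho N) (ho_proj N \<circ>\<^sub>F F) (Lder M N F \<circ>\<^sub>F ho_proj M) t"
    and s: "right_approx N (Ho M) (ho_proj M \<circ>\<^sub>F U) (Rder N M U \<circ>\<^sub>F ho_proj N) s"
    using Lder_Quillen(2)[OF assms(1,2) qa] Rder_Quillen(2)[OF assms(1,2) qa] by blast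
  obtain e c where ec: "derived_pair M N F U \<eta> \<epsilon> (Lder M N F) (Rder N M U) t s e c"
    using derived_pair_exists[OF model_pair.intro[OF assms(1,2)] adj Lder_Quillen(1)[OF assms(1,2) qa]
        Rder_Quillen(1)[OF assms(1,2) qa] t s] by blast
  then interpret derived_pair M N F U \<eta> \<epsilon> "Lder M N F" "Rder N M U" t s e c .
  show "nat_isomorphic (Ho M) (Ho M) id_ftor (Rder N M U \<circ>\<^sub>F Lder M N F)"
    unfolding nat_isomorphic_def using e unit_iso[OF equiv] by auto
  show "nat_isomorphic (Ho N) (Ho N) (Lder M N F \<circ>\<^sub>F Rder N M U) id_ftor"
    unfolding nat_isomorphic_def using c counit_iso[OF equiv] by auto
qed

section \<open>Squares of derived functors\<close>

text \<open>The transformation first applies the outer derived functor to \<open>t\<close> and then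
  uses \<open>t'\<close> at \<open>F x\<close>. The second factor is invertible because
  \<open>F\<close> preserves cofibrant objects.\<close>

lemma Lder_comp_approx:
  assumes "model_category M" "model_category N" "model_category Q"
    and q: "quillen_adjunction M N F U" and q': "quillen_adjunction N Q F' U'"
  shows "\<exists>t. left_approx M (Ho Q) (ho_proj Q \<circ>\<^sub>F (F' \<circ>\<^sub>F F)) ((Lder N Q F' \<circ>\<^sub>F Lder M N F) \<circ>\<^sub>F ho_proj M) t"
proof -
  interpret M: model_category M by fact
  interpret N: model_category N by fact
  interpret Q: model_category Q by fact
  interpret HQ: category "Ho Q" by (rule Q.category_Ho)
  note F = quillen_adjunctionD(1)[OF assms(1,2) q]
  note L = Lder_Quillen(1)[OF assms(1,2) q] and L' = Lder_Quillen(1)[OF assms(2,3) q']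
  obtain t t' where t: "left_approx M (Ho N) (ho_proj N \<circ>\<^sub>F F) (Lder M N F \<circ>\<^sub>F ho_proj M) t"
    and t': "left_approx N (Ho Q) (ho_proj Q \<circ>\<^sub>F F') (Lder N Q F' \<circ>\<^sub>F ho_proj N) t'"
    using Lder_Quillen(2)[OF assms(1,2) q] Lder_Quillen(2)[OF assms(2,3) q'] by blast
  note u = left_approx_fcomp[OF M.category_axioms N.category_Ho Q.category_Ho t L']
  have u_nat: "nat_trans M (Ho Q) (Lder N Q F' \<circ>\<^sub>F (Lder M N F \<circ>\<^sub>F ho_proj M)) (Lder N Q F' \<circ>\<^sub>F (ho_proj N \<circ>\<^sub>F F))
      (\<lambda>x. Fmap (Lder N Q F') (t x))"
    and t'_nat: "nat_trans N (Ho Q) (Lder N Q F' \<circ>\<^sub>F ho_proj N) (ho_proj Q \<circ>\<^sub>F F') t'"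
    using u t' by (simp_all add: left_approx_def)
  note t'F = nat_trans_whisker_right[OF t'_nat F M.category_axioms]
  let ?t = "\<lambda>x. t' (Fobj F x) \<cdot>\<^bsub>Ho Q\<^esub> Fmap (Lder N Q F') (t x)"
  have "nat_trans M (Ho Q) ((Lder N Q F' \<circ>\<^sub>F Lder M N F) \<circ>\<^sub>F ho_proj M) (ho_proj Q \<circ>\<^sub>F (F' \<circ>\<^sub>F F)) ?t"
    using nat_trans_comp[OF M.category_axioms Q.category_Ho u_nat t'F[unfolded fcomp_assoc]]
    by (simp add: fcomp_assoc)
  moreover have "is_iso (Ho Q) (?t x)" if x: "cofibrant M x" for x
  proof (rule HQ.is_iso_comp)
    show "is_iso (Ho Q) (Fmap (Lder N Q F') (t x))" using u x by (simp add: left_approx_def)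
    show "is_iso (Ho Q) (t' (Fobj F x))"
      using t' quillen_preserves_cofibrant[OF assms(1,2) q x] by (simp add: left_approx_def)
    show "Cod (Ho Q) (Fmap (Lder N Q F') (t x)) = Dom (Ho Q) (t' (Fobj F x))"
      using nat_trans_simps(3)[OF u_nat, of x] nat_trans_simps(2)[OF t'F, of x] M.cofibrant_obj[OF x] by simp
  qed
  ultimately show ?thesis
    unfolding left_approx_def
    using M.inverts_weq_Ho[OF Q.category_Ho is_functor_fcomp[OF L L']] by blast
qed

lemma Rder_comp_approx:
  assumes "model_category M" "model_category N" "model_category Q"
    and q: "quillen_adjunction M N F U" and q': "quillen_adjunction N Q F' U'"
  shows "\<exists>s. right_approx Q (Ho M) (ho_proj M \<circ>\<^sub>F (U \<circ>\<^sub>F U')) ((Rder N M U \<circ>\<^sub>F Rder Q N U') \<circ>\<^sub>F ho_proj Q) s"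
proof -
  interpret M: model_category M by fact
  interpret N: model_category N by fact
  interpret Q: model_category Q by fact
  interpret HM: category "Ho M" by (rule M.category_Ho)
  note U' = quillen_adjunctionD(2)[OF assms(2,3) q']
  note R = Rder_Quillen(1)[OF assms(1,2) q] and R' = Rder_Quillen(1)[OF assms(2,3) q']
  obtain s s' where s: "right_approx N (Ho M) (ho_proj M \<circ>\<^sub>F U) (Rder N M U \<circ>\<^sub>F ho_proj N) s"
    and s': "right_approx Q (Ho N) (ho_proj N \<circ>\<^sub>F U') (Rder Q N U' \<circ>\<^sub>F ho_proj Q) s'"
    using Rder_Quillen(2)[OF assms(1,2) q] Rder_Quillen(2)[OF assms(2,3) q'] by blast
  note u = right_approx_fcomp[OF Q.category_axioms N.category_Ho M.category_Ho s' R]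
  have u_nat: "nat_trans Q (Ho M) (Rder N M U \<circ>\<^sub>F (ho_proj N \<circ>\<^sub>F U')) (Rder N M U \<circ>\<^sub>F (Rder Q N U' \<circ>\<^sub>F ho_proj Q))
      (\<lambda>y. Fmap (Rder N M U) (s' y))"
    and s_nat: "nat_trans N (Ho M) (ho_proj M \<circ>\<^sub>F U) (Rder N M U \<circ>\<^sub>F ho_proj N) s"
    using u s by (simp_all add: right_approx_def)
  note sU = nat_trans_whisker_right[OF s_nat U' Q.category_axioms]
  let ?s = "\<lambda>y. Fmap (Rder N M U) (s' y) \<cdot>\<^bsub>Ho M\<^esub> s (Fobj U' y)"
  have "nat_trans Q (Ho M) (ho_proj M \<circ>\<^sub>F (U \<circ>\<^sub>F U')) ((Rder N M U \<circ>\<^sub>F Rder Q N U') \<circ>\<^sub>F ho_proj Q) ?s"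
    using nat_trans_comp[OF Q.category_axioms M.category_Ho sU[unfolded fcomp_assoc] u_nat]
    by (simp add: fcomp_assoc)
  moreover have "is_iso (Ho M) (?s y)" if y: "fibrant Q y" for y
  proof (rule HM.is_iso_comp)
    show "is_iso (Ho M) (Fmap (Rder N M U) (s' y))" using u y by (simp add: right_approx_def)
    show "is_iso (Ho M) (s (Fobj U' y))"
      using s quillen_preserves_fibrant[OF assms(2,3) q' y] by (simp add: right_approx_def)
    show "Cod (Ho M) (s (Fobj U' y)) = Dom (Ho M) (Fmap (Rder N M U) (s' y))"
      using nat_trans_simps(2)[OF u_nat, of y] nat_trans_simps(3)[OF sU, of y] y
      by (simp add: fibrant_def)
  qed
  ultimately show ?thesis
    unfolding right_approx_def
    using Q.inverts_weq_Ho[OF M.category_Ho is_functor_fcomp[OF R' R]] by blast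
qed

lemma nat_trans_between_weq_on_sym:
  "nat_trans_between_weq_on P M N F F' \<Longrightarrow> nat_trans_between_weq_on P M N F' F"
  by (auto simp: nat_trans_between_weq_on_def)

lemma Lder_square:
  assumes M: "model_category M" and N: "model_category N" and K: "model_category K" and Q: "model_category Q"
    and F: "quillen_adjunction M N F U" and F': "quillen_adjunction N Q F' U'"
    and G: "quillen_adjunction M K G V" and G': "quillen_adjunction K Q G' V'"
    and "nat_trans_between_weq_on (cofibrant M) M Q (F' \<circ>\<^sub>F F) (G' \<circ>\<^sub>F G)"
  shows "nat_isomorphic (Ho M) (Ho Q) (Lder N Q F' \<circ>\<^sub>F Lder M N F) (Lder K Q G' \<circ>\<^sub>F Lder M K G)"
proof -
  interpret M: model_category M by fact
  interpret Q: model_category Q by fact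
  note cats = M.category_Ho Q.category_Ho
  let ?L = "Lder N Q F' \<circ>\<^sub>F Lder M N F" and ?L' = "Lder K Q G' \<circ>\<^sub>F Lder M K G"
  have L: "is_functor (Ho M) (Ho Q) ?L"
    using is_functor_fcomp[OF Lder_Quillen(1)[OF M N F] Lder_Quillen(1)[OF N Q F']] .
  have L': "is_functor (Ho M) (Ho Q) ?L'"
    using is_functor_fcomp[OF Lder_Quillen(1)[OF M K G] Lder_Quillen(1)[OF K Q G']] .
  obtain t where t: "left_approx M (Ho Q) (ho_proj Q \<circ>\<^sub>F (F' \<circ>\<^sub>F F)) (?L \<circ>\<^sub>F ho_proj M) t"
    using Lder_comp_approx[OF M N Q F F'] by blast
  obtain t' where t': "left_approx M (Ho Q) (ho_proj Q \<circ>\<^sub>F (G' \<circ>\<^sub>F G)) (?L' \<circ>\<^sub>F ho_proj M) t'"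
    using Lder_comp_approx[OF M K Q G G'] by blast
  obtain \<tau> where \<tau>: "nat_trans M Q (F' \<circ>\<^sub>F F) (G' \<circ>\<^sub>F G) \<tau> \<or> nat_trans M Q (G' \<circ>\<^sub>F G) (F' \<circ>\<^sub>F F) \<tau>"
    and "\<forall>x \<in> Obj M. cofibrant M x \<longrightarrow> \<tau> x \<in> Weq Q"
    using assms(9) unfolding nat_trans_between_weq_on_def by blast
  then have iso: "is_iso (Ho Q) (Fmap (ho_proj Q) (\<tau> x))" if "cofibrant M x" for x
    using that M.cofibrant_obj Q.is_iso_ho_proj by blast
  \<comment> \<open>Either direction of \<tau> gives a comparison of the two composites; in the
    second case the isomorphism found is inverted.\<close>
  from \<tau> show ?thesis
  proof
    assume "nat_trans M Q (F' \<circ>\<^sub>F F) (G' \<circ>\<^sub>F G) \<tau>"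
    from M.left_approx_compare[OF cats(2) t t'
        nat_trans_whisker_left[OF this Q.is_functor_ho_proj M.category_axioms] iso]
    show ?thesis by (rule M.nat_isomorphic_Ho[OF cats(2) L L'])
  next
    assume "nat_trans M Q (G' \<circ>\<^sub>F G) (F' \<circ>\<^sub>F F) \<tau>"
    from M.left_approx_compare[OF cats(2) t' t
        nat_trans_whisker_left[OF this Q.is_functor_ho_proj M.category_axioms] iso]
    have "nat_isomorphic (Ho M) (Ho Q) ?L' ?L" by (rule M.nat_isomorphic_Ho[OF cats(2) L' L])
    then show ?thesis by (rule nat_isomorphic_sym[OF cats])
  qed
qed

lemma Rder_square:
  assumes M: "model_category M" and N: "model_category N" and K: "model_category K" and Q: "model_category Q"
    and F: "quillen_adjunction M N F U" and F': "quillen_adjunction N Q F' U'"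
    and G: "quillen_adjunction M K G V" and G': "quillen_adjunction K Q G' V'"
    and "nat_trans_between_weq_on (fibrant Q) Q M (U \<circ>\<^sub>F U') (V \<circ>\<^sub>F V')"
  shows "nat_isomorphic (Ho Q) (Ho M) (Rder N M U \<circ>\<^sub>F Rder Q N U') (Rder K M V \<circ>\<^sub>F Rder Q K V')"
proof -
  interpret M: model_category M by fact
  interpret Q: model_category Q by fact
  note cats = M.category_Ho Q.category_Ho
  let ?R = "Rder N M U \<circ>\<^sub>F Rder Q N U'" and ?R' = "Rder K M V \<circ>\<^sub>F Rder Q K V'"
  have R: "is_functor (Ho Q) (Ho M) ?R"
    using is_functor_fcomp[OF Rder_Quillen(1)[OF N Q F'] Rder_Quillen(1)[OF M N F]] .
  have R': "is_functor (Ho Q) (Ho M) ?R'"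
    using is_functor_fcomp[OF Rder_Quillen(1)[OF K Q G'] Rder_Quillen(1)[OF M K G]] .
  obtain s where s: "right_approx Q (Ho M) (ho_proj M \<circ>\<^sub>F (U \<circ>\<^sub>F U')) (?R \<circ>\<^sub>F ho_proj Q) s"
    using Rder_comp_approx[OF M N Q F F'] by blast
  obtain s' where s': "right_approx Q (Ho M) (ho_proj M \<circ>\<^sub>F (V \<circ>\<^sub>F V')) (?R' \<circ>\<^sub>F ho_proj Q) s'"
    using Rder_comp_approx[OF M K Q G G'] by blast
  obtain \<tau> where \<tau>: "nat_trans Q M (U \<circ>\<^sub>F U') (V \<circ>\<^sub>F V') \<tau> \<or> nat_trans Q M (V \<circ>\<^sub>F V') (U \<circ>\<^sub>F U') \<tau>"
    and "\<forall>y \<in> Obj Q. fibrant Q y \<longrightarrow> \<tau> y \<in> Weq M"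
    using assms(9) unfolding nat_trans_between_weq_on_def by blast
  then have iso: "is_iso (Ho M) (Fmap (ho_proj M) (\<tau> y))" if "fibrant Q y" for y
    using that M.is_iso_ho_proj unfolding fibrant_def by blast
  from \<tau> show ?thesis
  proof
    assume "nat_trans Q M (U \<circ>\<^sub>F U') (V \<circ>\<^sub>F V') \<tau>"
    from Q.right_approx_compare[OF cats(1) s s'
        nat_trans_whisker_left[OF this M.is_functor_ho_proj Q.category_axioms] iso]
    show ?thesis by (rule Q.nat_isomorphic_Ho[OF cats(1) R R'])
  next
    assume "nat_trans Q M (V \<circ>\<^sub>F V') (U \<circ>\<^sub>F U') \<tau>"
    from Q.right_approx_compare[OF cats(1) s' s
        nat_trans_whisker_left[OF this M.is_functor_ho_proj Q.category_axioms] iso]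
    have "nat_isomorphic (Ho Q) (Ho M) ?R' ?R" by (rule Q.nat_isomorphic_Ho[OF cats(1) R' R])
    then show ?thesis by (rule nat_isomorphic_sym[OF cats(2,1)])
  qed
qed

text \<open>The two composite left derived functors have the two composite right derived functors as
  right adjoints. An isomorphism on one side therefore yields one on the other, whichever of the two
  conditions is given.\<close>

lemma derived_squares:
  assumes M: "model_category M" and N: "model_category N" and K: "model_category K" and Q: "model_category Q"
    and F: "quillen_adjunction M N F U" and F': "quillen_adjunction N Q F' U'"
    and G: "quillen_adjunction M K G V" and G': "quillen_adjunction K Q G' V'"
    and sq: "nat_trans_between_weq_on (cofibrant M) M Q (F' \<circ>\<^sub>F F) (G' \<circ>\<^sub>F G) \<or>
      nat_trans_between_weq_on (fibrant Q) Q M (V \<circ>\<^sub>F V') (U \<circ>\<^sub>F U')"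
  shows "nat_isomorphic (Ho M) (Ho Q) (Lder N Q F' \<circ>\<^sub>F Lder M N F) (Lder K Q G' \<circ>\<^sub>F Lder M K G)"
    "nat_isomorphic (Ho Q) (Ho M) (Rder K M V \<circ>\<^sub>F Rder Q K V') (Rder N M U \<circ>\<^sub>F Rder Q N U')"
proof -
  let ?L = "Lder N Q F' \<circ>\<^sub>F Lder M N F" and ?L' = "Lder K Q G' \<circ>\<^sub>F Lder M K G"
  let ?R = "Rder N M U \<circ>\<^sub>F Rder Q N U'" and ?R' = "Rder K M V \<circ>\<^sub>F Rder Q K V'"
  note cats = model_category.category_Ho[OF M] model_category.category_Ho[OF N]
    model_category.category_Ho[OF K] model_category.category_Ho[OF Q]
  have adj: "\<exists>\<eta> \<epsilon>. adjunction (Ho M) (Ho Q) ?L ?R \<eta> \<epsilon>"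
    using derived_adjunction[OF M N F] derived_adjunction[OF N Q F']
      adjunction_comp[OF cats(1,2,4)] by blast
  have adj': "\<exists>\<eta> \<epsilon>. adjunction (Ho M) (Ho Q) ?L' ?R' \<eta> \<epsilon>"
    using derived_adjunction[OF M K G] derived_adjunction[OF K Q G']
      adjunction_comp[OF cats(1,3,4)] by blast
  have "nat_isomorphic (Ho M) (Ho Q) ?L ?L' \<and> nat_isomorphic (Ho Q) (Ho M) ?R ?R'"
    using sq
  proof
    assume "nat_trans_between_weq_on (cofibrant M) M Q (F' \<circ>\<^sub>F F) (G' \<circ>\<^sub>F G)"
    from Lder_square[OF M N K Q F F' G G' this]
    show ?thesis using right_adjoints_isomorphic[OF cats(1,4) adj adj'] by blast
  next
    assume "nat_trans_between_weq_on (fibrant Q) Q M (V \<circ>\<^sub>F V') (U \<circ>\<^sub>F U')"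
    \<comment> \<open>\<open>Rder_square\<close> compares the two routes in the opposite order to
      the given condition, which is symmetric in them.\<close>
    from Rder_square[OF M N K Q F F' G G' nat_trans_between_weq_on_sym[OF this]]
    show ?thesis using left_adjoints_isomorphic[OF cats(1,4) adj adj'] by blast
  qed
  then show "nat_isomorphic (Ho M) (Ho Q) ?L ?L'" "nat_isomorphic (Ho Q) (Ho M) ?R' ?R"
    using nat_isomorphic_sym[OF cats(4,1)] by blast+
qed

text \<open>Insert the unit on the left, apply the square in the middle, and cancel the counit on
  the right. Being stated for arbitrary functors, it can be used with left derived functors in the
  role of \<open>F\<close> and also with right derived ones.\<close>

lemma equivalence_transpose:
  assumes "category A" "category B" "category C" "category D"
    and F: "is_functor A B F" and U: "is_functor B A U" and U': "is_functor D C U'"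
    and T: "is_functor C A T" and S: "is_functor D B S"
    and unit: "nat_isomorphic A A id_ftor (U \<circ>\<^sub>F F)" and counit: "nat_isomorphic D D (F' \<circ>\<^sub>F U') id_ftor"
    and iso: "nat_isomorphic C B (F \<circ>\<^sub>F T) (S \<circ>\<^sub>F F')"
  shows "nat_isomorphic D A (T \<circ>\<^sub>F U') (U \<circ>\<^sub>F S)"
proof -
  have "nat_isomorphic D A (T \<circ>\<^sub>F U') (U \<circ>\<^sub>F F \<circ>\<^sub>F T \<circ>\<^sub>F U')"
    using nat_isomorphic_whisker_right[OF assms(4) unit is_functor_fcomp[OF U' T]]
    by (simp add: fcomp_assoc)
  moreover have "nat_isomorphic D A (U \<circ>\<^sub>F F \<circ>\<^sub>F T \<circ>\<^sub>F U') (U \<circ>\<^sub>F S \<circ>\<^sub>F F' \<circ>\<^sub>F U')"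
    using nat_isomorphic_whisker_left[OF assms(4,2,1)
        nat_isomorphic_whisker_right[OF assms(4) iso U', unfolded fcomp_assoc] U] .
  moreover have "nat_isomorphic D A (U \<circ>\<^sub>F S \<circ>\<^sub>F F' \<circ>\<^sub>F U') (U \<circ>\<^sub>F S)"
    using nat_isomorphic_whisker_left[OF assms(4,4,1) counit is_functor_fcomp[OF S U]]
    by (simp add: fcomp_assoc)
  ultimately show ?thesis
    using nat_isomorphic_trans[OF assms(4,1)] by blast
qed

theorem theorem4p4:
  fixes CG :: "('cg, 'cga) model_cat" and CH :: "('ch, 'cha) model_cat"
    and DG :: "('dg, 'dga) model_cat" and DH :: "('dh, 'dha) model_cat"
    and \<theta>_lstar :: "('cg, 'cga, 'ch, 'cha) ftor" and \<theta>_ustar :: "('ch, 'cha, 'cg, 'cga) ftor"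
    and \<theta>_dagger :: "('ch, 'cha, 'cg, 'cga) ftor" and \<theta>_paren :: "('cg, 'cga, 'ch, 'cha) ftor"
    and \<phi>_lstar :: "('dg, 'dga, 'dh, 'dha) ftor" and \<phi>_ustar :: "('dh, 'dha, 'dg, 'dga) ftor"
    and \<phi>_dagger :: "('dh, 'dha, 'dg, 'dga) ftor" and \<phi>_paren :: "('dg, 'dga, 'dh, 'dha) ftor"
    and FG :: "('cg, 'cga, 'dg, 'dga) ftor" and UG :: "('dg, 'dga, 'cg, 'cga) ftor"
    and FH :: "('ch, 'cha, 'dh, 'dha) ftor" and UH :: "('dh, 'dha, 'ch, 'cha) ftor"
  assumes "model_category CG" and "model_category CH"
    and "model_category DG" and "model_category DH"
    and "quillen_adjunction CG CH \<theta>_lstar \<theta>_ustar"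
    and "quillen_adjunction CH CG \<theta>_dagger \<theta>_paren"
    and "quillen_adjunction DG DH \<phi>_lstar \<phi>_ustar"
    and "quillen_adjunction DH DG \<phi>_dagger \<phi>_paren"
    and "quillen_equivalence CG DG FG UG"
    and "quillen_equivalence CH DH FH UH"
    and "nat_isomorphic (Ho CG) (Ho CH) (Lder CG CH \<theta>_lstar) (Rder CG CH \<theta>_paren)"
    and "nat_isomorphic (Ho DG) (Ho DH) (Lder DG DH \<phi>_lstar) (Rder DG DH \<phi>_paren)"
    and a_or_b:
      "nat_trans_between_weq_on (cofibrant CG) CG DH (\<phi>_lstar \<circ>\<^sub>F FG) (FH \<circ>\<^sub>F \<theta>_lstar) \<or>
       nat_trans_between_weq_on (fibrant DH) DH CG (\<theta>_ustar \<circ>\<^sub>F UH) (UG \<circ>\<^sub>F \<phi>_ustar)"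
    and c_or_d:
      "nat_trans_between_weq_on (cofibrant CH) CH DG (FG \<circ>\<^sub>F \<theta>_dagger) (\<phi>_dagger \<circ>\<^sub>F FH) \<or>
       nat_trans_between_weq_on (fibrant DG) DG CH (\<theta>_paren \<circ>\<^sub>F UG) (UH \<circ>\<^sub>F \<phi>_paren)"
  shows
    "nat_isomorphic (Ho CG) (Ho DH)
       (Lder DG DH \<phi>_lstar \<circ>\<^sub>F Lder CG DG FG) (Lder CH DH FH \<circ>\<^sub>F Lder CG CH \<theta>_lstar) \<and>
     nat_isomorphic (Ho DH) (Ho CG)
       (Rder CH CG \<theta>_ustar \<circ>\<^sub>F Rder DH CH UH) (Rder DG CG UG \<circ>\<^sub>F Rder DH DG \<phi>_ustar) \<and>
     nat_isomorphic (Ho CH) (Ho DG)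
       (Lder CG DG FG \<circ>\<^sub>F Lder CH CG \<theta>_dagger) (Lder DH DG \<phi>_dagger \<circ>\<^sub>F Lder CH DH FH) \<and>
     nat_isomorphic (Ho DG) (Ho CH)
       (Rder CG CH \<theta>_paren \<circ>\<^sub>F Rder DG CG UG) (Rder DH CH UH \<circ>\<^sub>F Rder DG DH \<phi>_paren) \<and>
     nat_isomorphic (Ho DH) (Ho CG)
       (Lder CH CG \<theta>_dagger \<circ>\<^sub>F Rder DH CH UH) (Rder DG CG UG \<circ>\<^sub>F Lder DH DG \<phi>_dagger) \<and>
     nat_isomorphic (Ho CH) (Ho DG)
       (Lder CG DG FG \<circ>\<^sub>F Rder CH CG \<theta>_ustar) (Rder DH DG \<phi>_ustar \<circ>\<^sub>F Lder CH DH FH)"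
proof -
  note CG = assms(1) and CH = assms(2) and DG = assms(3) and DH = assms(4)
  note \<theta> = assms(5) and \<theta>' = assms(6) and \<phi> = assms(7) and \<phi>' = assms(8)
  note FUG = quillen_equivalence_adjunction[OF assms(9)]
    and FUH = quillen_equivalence_adjunction[OF assms(10)]
  note cats = model_category.category_Ho[OF CG] model_category.category_Ho[OF CH]
    model_category.category_Ho[OF DG] model_category.category_Ho[OF DH]
  note eqG = derived_equivalence[OF CG DG assms(9)] and eqH = derived_equivalence[OF CH DH assms(10)]
  note sq12 = derived_squares[OF CG DG CH DH FUG \<phi> \<theta> FUH a_or_b]
  \<comment> \<open>Condition (d) lists the two routes in the other order than
    \<open>derived_squares\<close> expects.\<close>
  have sq: "nat_trans_between_weq_on (cofibrant CH) CH DG (FG \<circ>\<^sub>F \<theta>_dagger) (\<phi>_dagger \<circ>\<^sub>F FH) \<or>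
      nat_trans_between_weq_on (fibrant DG) DG CH (UH \<circ>\<^sub>F \<phi>_paren) (\<theta>_paren \<circ>\<^sub>F UG)"
    using c_or_d nat_trans_between_weq_on_sym by blast
  note sq34 = derived_squares[OF CH CG DH DG \<theta>' FUG FUH \<phi>' sq]
  note LG = Lder_Quillen(1)[OF CG DG FUG] and RG = Rder_Quillen(1)[OF CG DG FUG]
    and LH = Lder_Quillen(1)[OF CH DH FUH] and RH = Rder_Quillen(1)[OF CH DH FUH]
  \<comment> \<open>Square 3 transposed along the derived equivalences, with the left derived
    functors as \<open>F\<close> and \<open>F'\<close>.\<close>
  have 5: "nat_isomorphic (Ho DH) (Ho CG)
      (Lder CH CG \<theta>_dagger \<circ>\<^sub>F Rder DH CH UH) (Rder DG CG UG \<circ>\<^sub>F Lder DH DG \<phi>_dagger)"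
    by (rule equivalence_transpose[OF cats(1,3,2,4) LG RG RH Lder_Quillen(1)[OF CH CG \<theta>']
          Lder_Quillen(1)[OF DH DG \<phi>'] eqG(1) eqH(2) sq34(1)])
  \<comment> \<open>Here the right derived functors play the roles of \<open>F\<close> and
    \<open>F'\<close>, so the inverted counit and unit of the derived equivalences serve as unit and
    counit, and square 2 is used in reverse.\<close>
  have 6: "nat_isomorphic (Ho CH) (Ho DG)
      (Rder DH DG \<phi>_ustar \<circ>\<^sub>F Lder CH DH FH) (Lder CG DG FG \<circ>\<^sub>F Rder CH CG \<theta>_ustar)"
    by (rule equivalence_transpose[OF cats(3,1,4,2) RG LG LH Rder_Quillen(1)[OF DG DH \<phi>]
          Rder_Quillen(1)[OF CG CH \<theta>] nat_isomorphic_sym[OF cats(3,3) eqG(2)]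
          nat_isomorphic_sym[OF cats(2,2) eqH(1)] nat_isomorphic_sym[OF cats(4,1) sq12(2)]])
  show ?thesis
    using sq12 sq34(1) nat_isomorphic_sym[OF cats(3,2) sq34(2)] 5 nat_isomorphic_sym[OF cats(2,3) 6]
    by blast
qed

end
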